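(* Let $d\in\mathbb{N}$ and let $X$ be a Banach space with nontrivial Fourier type. (i) Let $1\le q\le\infty$, $b+1/q>0$ and $\rho>0$. There exist positive constants $a(\rho,b,q)$ and $A(\rho,b,q)$ such that for every $f$ with $\|f\|_{L^{1,q}(\log L)^{b+1}(\mathbb{T}^d;X)}\le\rho$, $$\sum_{n\in\mathbb{Z}^d}\exp\Big(-a(\rho,b,q)\,\|\widehat f(n)\|_X^{-\frac{1}{b+\frac1q}}\Big)\le A(\rho,b,q).$$ (ii) Let $1\le q\le\infty$, $b+1/q<0$ and $\rho>0$. There exist positive constants $a(\rho,b,q)$ and $A(\rho,b,q)$ such that every sequence $(c_n)_{n\in\mathbb{Z}^d}$ in $X$ with $\|(c_n)\|_{\ell^{1,q}(\log\ell)^{b+1}(\mathbb{Z}^d;X)}\le\rho$ is the sequence of Fourier coefficients of a function $f$ such that $$\int_{\mathbb{T}^d}\exp\Big(a(\rho,b,q)\,\|f(t)\|_X^{-\frac{1}{b+\frac1q}}\Big)\,dt\le A(\rho,b,q).$$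
   Context: Banach spaces are nonzero and over $\mathbb{C}$. $\mathbb{T}^d=[-\frac12,\frac12]^d$ and $\widehat f(n)=\int_{\mathbb{T}^d}f(x)e^{-2\pi i x\cdot n}\,dx$, $n\in\mathbb{Z}^d$. $X$ has nontrivial Fourier type if for some $p\in(1,2]$ there is $C$ with $\|\widehat f\|_{L^{p'}(\mathbb{R}^d;X)}\le C\|f\|_{L^p(\mathbb{R}^d;X)}$ for all $f\in\mathcal{S}(\mathbb{R}^d;X)$ (Fourier transform on $\mathbb{R}^d$: $\int_{\mathbb{R}^d}f(t)e^{-2\pi it\cdot\xi}dt$; $1/p+1/p'=1$). For strongly measurable $f:\mathbb{T}^d\to X$ with $f^*$ the non-increasing rearrangement of $\|f(\cdot)\|_X$, $\|f\|_{L^{1,q}(\log L)^{c}(\mathbb{T}^d;X)}=\big(\int_0^1(t(1+|\log t|)^cf^*(t))^q\frac{dt}{t}\big)^{1/q}$; for a sequence $(c_n)_{n\in\mathbb{Z}^d}$ in $X$ with $(c_k^* )_{k\ge1}$ the non-increasing rearrangement of $(\|c_n\|_X)_n$, $\|(c_n)\|_{\ell^{1,q}(\log\ell)^c(\mathbb{Z}^d;X)}=\big(\sum_{k\ge1}(k(1+\log k)^cc_k^* )^q\frac1k\big)^{1/q}$ (suprema if $q=\infty$, and $1/\infty=0$). In (i), terms with $\widehat f(n)=0$ are interpreted as $0$. The constants do not depend on $f$ or $(c_n)$; they may also depend on $X$ and $d$. *)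

theory Defs
  imports "HOL-Analysis.Analysis"
begin

section \<open>Complex Banach spaces\<close>

class complex_banach = banach +
  fixes scaleC :: "complex \<Rightarrow> 'a \<Rightarrow> 'a"  (infixr \<open>*\<^sub>C\<close> 75)
  assumes scaleC_add_right: "a *\<^sub>C (x + y) = a *\<^sub>C x + a *\<^sub>C y"
    and scaleC_add_left: "(a + b) *\<^sub>C x = a *\<^sub>C x + b *\<^sub>C x"
    and scaleC_scaleC: "a *\<^sub>C b *\<^sub>C x = (a * b) *\<^sub>C x"
    and scaleC_of_real: "complex_of_real r *\<^sub>C x = r *\<^sub>R x"
    and norm_scaleC: "norm (a *\<^sub>C x) = cmod a * norm x"

instantiation complex :: complex_banach
begin

definition scaleC_complex :: "complex \<Rightarrow> complex \<Rightarrow> complex" where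
  "scaleC_complex a x = a * x"

instance
  by standard (auto simp: scaleC_complex_def algebra_simps norm_mult scaleR_conv_of_real)

end


section \<open>The Bochner integral without separability of the range space\<close>

text \<open>The library's Bochner integral requires the range space to be second countable. The
  definitions below follow the library ones, except that Borel measurability is replaced by strong
  measurability, so that the Banach space may be non-separable.\<close>

definition strongly_measurable :: "'a measure \<Rightarrow> ('a \<Rightarrow> 'x::real_normed_vector) \<Rightarrow> bool" where
  "strongly_measurable M f \<longleftrightarrow>
     (\<exists>s. (\<forall>i::nat. simple_function M (s i)) \<and> (AE x in M. (\<lambda>i. s i x) \<longlonglongrightarrow> f x))"

definition has_strong_integral ::
    "'a measure \<Rightarrow> ('a \<Rightarrow> 'x::real_normed_vector) \<Rightarrow> 'x \<Rightarrow> bool" where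
  "has_strong_integral M f v \<longleftrightarrow>
     strongly_measurable M f \<and>
     (\<exists>s. (\<forall>i::nat. Bochner_Integration.simple_bochner_integrable M (s i)) \<and>
          (\<lambda>i. \<integral>\<^sup>+x. ennreal (norm (f x - s i x)) \<partial>M) \<longlonglongrightarrow> 0 \<and>
          (\<lambda>i. Bochner_Integration.simple_bochner_integral M (s i)) \<longlonglongrightarrow> v)"

definition strongly_integrable :: "'a measure \<Rightarrow> ('a \<Rightarrow> 'x::real_normed_vector) \<Rightarrow> bool" where
  "strongly_integrable M f \<longleftrightarrow> (\<exists>v. has_strong_integral M f v)"

definition strong_integral :: "'a measure \<Rightarrow> ('a \<Rightarrow> 'x::real_normed_vector) \<Rightarrow> 'x" where
  "strong_integral M f =
     (if strongly_integrable M f then THE v. has_strong_integral M f v else 0)"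


section \<open>Fourier transform and Fourier coefficients\<close>

definition fourier_transform :: "(real^'d \<Rightarrow> 'x::complex_banach) \<Rightarrow> real^'d \<Rightarrow> 'x" where
  "fourier_transform f \<xi> = strong_integral lebesgue (\<lambda>t. cis (- 2 * pi * (t \<bullet> \<xi>)) *\<^sub>C f t)"

definition torus :: "(real^'d) measure" where
  "torus = lebesgue_on (cbox (\<chi> i. - 1/2) (\<chi> i. 1/2))"

definition fourier_coeff :: "(real^'d \<Rightarrow> 'x::complex_banach) \<Rightarrow> int^'d \<Rightarrow> 'x" where
  "fourier_coeff f n =
     strong_integral torus (\<lambda>x. cis (- 2 * pi * (x \<bullet> (\<chi> i. of_int (n $ i)))) *\<^sub>C f x)"


section \<open>Nontrivial Fourier type\<close>

definition partial_deriv :: "'d \<Rightarrow> (real^'d \<Rightarrow> 'x::real_normed_vector) \<Rightarrow> real^'d \<Rightarrow> 'x" where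
  "partial_deriv i f x = frechet_derivative f (at x) (axis i 1)"

text \<open>A list of coordinates encodes an iterated partial derivative. The function is smooth iff all
  its iterated partial derivatives exist and are differentiable.\<close>

definition iterated_partial ::
    "'d list \<Rightarrow> (real^'d \<Rightarrow> 'x::real_normed_vector) \<Rightarrow> real^'d \<Rightarrow> 'x" where
  "iterated_partial is f = foldr partial_deriv is f"

definition schwartz :: "(real^'d \<Rightarrow> 'x::real_normed_vector) \<Rightarrow> bool" where
  "schwartz f \<longleftrightarrow>
     (\<forall>is x. iterated_partial is f differentiable (at x)) \<and>
     (\<forall>is (k::nat). \<exists>B. \<forall>x. norm x ^ k * norm (iterated_partial is f x) \<le> B)"

text \<open>Real powers of extended nonnegative numbers, only used with positive exponents.\<close>

definition epowr :: "ennreal \<Rightarrow> real \<Rightarrow> ennreal" where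
  "epowr x p = (if x = top then top else ennreal (enn2real x powr p))"

definition Lp_norm :: "real \<Rightarrow> 'a measure \<Rightarrow> ('a \<Rightarrow> 'x::real_normed_vector) \<Rightarrow> ennreal" where
  "Lp_norm p M f = epowr (\<integral>\<^sup>+x. ennreal (norm (f x) powr p) \<partial>M) (1 / p)"

text \<open>The conjugate exponent is \<open>p' = p / (p - 1)\<close>.\<close>

definition nontrivial_fourier_type :: "'d::finite itself \<Rightarrow> 'x::complex_banach itself \<Rightarrow> bool" where
  "nontrivial_fourier_type _ _ \<longleftrightarrow>
     (\<exists>p::real. 1 < p \<and> p \<le> 2 \<and>
       (\<exists>C::real. \<forall>f :: real^'d \<Rightarrow> 'x. schwartz f \<longrightarrow>
          Lp_norm (p / (p - 1)) lebesgue (fourier_transform f) \<le> ennreal C * Lp_norm p lebesgue f))"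


section \<open>Lorentz--Zygmund norms\<close>

definition decr_rearr :: "'a measure \<Rightarrow> ('a \<Rightarrow> 'x::real_normed_vector) \<Rightarrow> real \<Rightarrow> ennreal" where
  "decr_rearr M f t =
     Inf {s. emeasure M {x \<in> space M. s < ennreal (norm (f x))} \<le> ennreal t}"

definition L1_log_norm :: "ennreal \<Rightarrow> real \<Rightarrow> (real^'d \<Rightarrow> 'x::real_normed_vector) \<Rightarrow> ennreal" where
  "L1_log_norm q c f =
     (let w = (\<lambda>t. ennreal (t * (1 + \<bar>ln t\<bar>) powr c) * decr_rearr torus f t) in
      if q = top then (SUP t\<in>{0<..<1}. w t)
      else epowr (\<integral>\<^sup>+t\<in>{0<..<1}. epowr (w t) (enn2real q) * ennreal (1 / t) \<partial>lborel)
             (1 / enn2real q))"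

text \<open>For a sequence the \<open>k\<close>-th term \<open>c\<^sub>k\<^sup>*\<close>, counted from 1, is the value at \<open>k - 1\<close> of the
  rearrangement with respect to counting measure. Below \<open>k = Suc j\<close>.\<close>

definition l1_log_norm :: "ennreal \<Rightarrow> real \<Rightarrow> (int^'d \<Rightarrow> 'x::real_normed_vector) \<Rightarrow> ennreal" where
  "l1_log_norm q c a =
     (let w = (\<lambda>j::nat. ennreal (real (Suc j) * (1 + ln (real (Suc j))) powr c) *
                 decr_rearr (count_space UNIV) a (real j)) in
      if q = top then (SUP j. w j)
      else epowr (\<Sum>j. epowr (w j) (enn2real q) * ennreal (1 / real (Suc j))) (1 / enn2real q))"

end

theory Submission
  imports Defs "HOL-Probability.Probability" "HOL-Real_Asymp.Real_Asymp"
begin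

text \<open>
  Testing Fourier type on sums of Gaussian translates and on trigonometric polynomials times a Gaussian,
  both of which are explicit Schwartz functions, transfers the inequality from \<open>\<real>\<^sup>d\<close> to Fourier series:
  \<open>\<ell>\<^sup>p \<rightarrow> L\<^sup>p'(\<T>\<^sup>d)\<close> for trigonometric polynomials, and, by Fejer means,
  \<open>L\<^sup>p(\<T>\<^sup>d) \<rightarrow> \<ell>\<^sup>p'\<close> for bounded functions.

  Together with the trivial bounds \<open>L\<^sup>1 \<rightarrow> \<ell>\<^sup>\<infinity>\<close> and \<open>\<ell>\<^sup>1 \<rightarrow> L\<^sup>\<infinity>\<close> this is interpolated by truncation:
  cut \<open>f\<close> at the value of its rearrangement at \<open>2\<^sup>-\<^sup>I\<close>, respectively the sequence at the value of its
  rearrangement at \<open>2\<^sup>I\<close>. Hoelder's inequality on the dyadic values of the rearrangement bounds the large part by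
  \<open>(1 + I) powr (-(b + 1/q))\<close>, and geometric summation gives the matching bound for the small
  part. Hence at most \<open>2\<^sup>I\<close> coefficients, respectively a set of measure of order \<open>2\<^sup>-\<^sup>I\<close>, exceed a multiple of
  \<open>(1 + I) powr (-(b + 1/q))\<close>, which is exponential summability, respectively integrability.
\<close>

section \<open>Strongly measurable functions on complete measure spaces\<close>

text \<open>The exponent in Hoelder's inequality is 1 - 1/q - c with c = b + 1, that is -(b + 1/q).
  Its sign decides what is summed: a tail of the dyadic sequence for functions, an initial segment
  for sequences. In the small part, layer i contributes a power of 1 + i times 2^((p - 1) i),
  respectively 2^(-(p - 1) i). This is where p > 1 enters: the layer at the cut dominates, and after
  the type inequality it carries the same power of 1 + I as the trivial estimate of the large part.

  Fourier type speaks of Schwartz functions only, so every test function must be provably Schwartz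
  and have an explicit transform. Finite sums of modulated Gaussian translates have both properties,
  and their decay bounds all lattice sums uniformly.

  Strong measurability is an almost everywhere notion; norms of such functions are measurable
  because Lebesgue measure and its restriction to the cube are complete. In (ii) the function has to
  be produced first: it is the almost everywhere limit of the partial sums over the level sets of
  the sequence.\<close>

lemma complete_measure_torus: "complete_measure (torus :: (real^'d::finite) measure)"
proof
  fix A B :: "(real^'d) set"
  let ?Q = "cbox (\<chi> i. - 1/2) (\<chi> i. 1/2) :: (real^'d) set"
  assume AB: "B \<subseteq> A" "A \<in> null_sets torus"
  have A: "A \<subseteq> ?Q" "A \<in> null_sets lebesgue"
    using AB(2) by (auto simp: torus_def null_sets_restrict_space)
  have "B \<in> null_sets lebesgue"
    using completion.complete2[OF AB(1) A(2)] .
  then show "B \<in> sets torus"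
    using AB(1) A(1) by (auto simp: torus_def sets_restrict_space_iff)
qed

text \<open>The two preimages of a measurable set differ by a subset of a null set, which
  completeness makes measurable.\<close>

lemma measurable_AE_eq:
  assumes "complete_measure M" "g \<in> measurable M N" "AE x in M. f x = g x"
    and "\<And>x. x \<in> space M \<Longrightarrow> f x \<in> space N"
  shows "f \<in> measurable M N"
proof (rule measurableI)
  interpret complete_measure M by fact
  fix A assume "A \<in> sets N"
  with assms(2) have g: "g -` A \<inter> space M \<in> sets M" by (rule measurable_sets)
  show "f -` A \<inter> space M \<in> sets M"
    by (rule in_sets_AE[OF _ g]) (use assms(3) in auto)
qed (use assms(4) in auto)

lemma strongly_measurable_simple: "simple_function M f \<Longrightarrow> strongly_measurable M f"
  unfolding strongly_measurable_def by (rule exI[of _ "\<lambda>_. f"]) auto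

lemma strongly_measurable_borel:
  fixes f :: "'a \<Rightarrow> 'b::{real_normed_vector, second_countable_topology}"
  assumes "f \<in> borel_measurable M"
  shows "strongly_measurable M f"
  using borel_measurable_implies_sequence_metric[OF assms] unfolding strongly_measurable_def by blast

text \<open>A function of two simple functions is simple, and continuity passes to the limit
  wherever both approximations converge. Sums, differences, scalar multiples and cut-offs all come
  from this.\<close>

lemma strongly_measurable_compose2:
  fixes p :: "'b::real_normed_vector \<Rightarrow> 'c::real_normed_vector \<Rightarrow> 'd::real_normed_vector"
  assumes p: "\<And>a b. continuous (at (a, b)) (\<lambda>z. p (fst z) (snd z))"
    and f: "strongly_measurable M f" and g: "strongly_measurable M g"
  shows "strongly_measurable M (\<lambda>x. p (f x) (g x))"
proof -
  obtain s where s: "\<And>i::nat. simple_function M (s i)" "AE x in M. (\<lambda>i. s i x) \<longlonglongrightarrow> f x"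
    using f unfolding strongly_measurable_def by auto
  obtain t where t: "\<And>i::nat. simple_function M (t i)" "AE x in M. (\<lambda>i. t i x) \<longlonglongrightarrow> g x"
    using g unfolding strongly_measurable_def by auto
  have "AE x in M. (\<lambda>i. p (s i x) (t i x)) \<longlonglongrightarrow> p (f x) (g x)"
    using s(2) t(2)
  proof eventually_elim
    case (elim x)
    from isCont_tendsto_compose[OF p tendsto_Pair[OF elim]] show ?case by simp
  qed
  with s(1) t(1) show ?thesis
    unfolding strongly_measurable_def
    by (intro exI[of _ "\<lambda>i x. p (s i x) (t i x)"]) (auto intro: simple_function_compose2)
qed

lemma strongly_measurable_add:
  "strongly_measurable M f \<Longrightarrow> strongly_measurable M g \<Longrightarrow> strongly_measurable M (\<lambda>x. f x + g x)"
  by (rule strongly_measurable_compose2[of "(+)"]) (intro continuous_intros | assumption)+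

lemma strongly_measurable_diff:
  "strongly_measurable M f \<Longrightarrow> strongly_measurable M g \<Longrightarrow> strongly_measurable M (\<lambda>x. f x - g x)"
  by (rule strongly_measurable_compose2[of "(-)"]) (intro continuous_intros | assumption)+

lemma strongly_measurable_bounded_linear:
  assumes "bounded_linear T" "strongly_measurable M f"
  shows "strongly_measurable M (\<lambda>x. T (f x))"
proof -
  have "isCont T a" for a
    by (rule linear_continuous_at[OF assms(1)])
  then have "continuous (at (a, b)) (\<lambda>z. T (fst z))" for a b
    using isCont_o2[where f=fst and g=T and a="(a, b)"] by (simp add: continuous_fst)
  then show ?thesis
    using strongly_measurable_compose2[of "\<lambda>a b. T a" M f f] assms(2) by blast
qed

lemma bounded_bilinear_scaleC: "bounded_bilinear (scaleC :: complex \<Rightarrow> 'x::complex_banach \<Rightarrow> 'x)"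
proof
  fix a b :: complex and x y :: 'x and r :: real
  show "(a + b) *\<^sub>C x = a *\<^sub>C x + b *\<^sub>C x" "a *\<^sub>C (x + y) = a *\<^sub>C x + a *\<^sub>C y"
    by (rule scaleC_add_left scaleC_add_right)+
  show "(r *\<^sub>R a) *\<^sub>C x = r *\<^sub>R a *\<^sub>C x"
    by (metis scaleC_of_real scaleC_scaleC scaleR_conv_of_real)
  show "a *\<^sub>C r *\<^sub>R x = r *\<^sub>R a *\<^sub>C x"
    by (metis scaleC_of_real scaleC_scaleC mult.commute)
  show "\<exists>K. \<forall>a (x::'x). norm (a *\<^sub>C x) \<le> norm a * norm x * K"
    by (rule exI[of _ 1]) (simp add: norm_scaleC)
qed

interpretation scaleC: bounded_bilinear "scaleC :: complex \<Rightarrow> 'x::complex_banach \<Rightarrow> 'x"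
  by (rule bounded_bilinear_scaleC)

lemma strongly_measurable_scaleC:
  "strongly_measurable M h \<Longrightarrow> strongly_measurable M f \<Longrightarrow> strongly_measurable M (\<lambda>x. h x *\<^sub>C f x)"
  by (rule strongly_measurable_compose2[of "scaleC"]) (intro scaleC.continuous continuous_intros | assumption)+

lemma scaleC_one [simp]: "1 *\<^sub>C x = (x :: 'x::complex_banach)"
  using scaleC_of_real[of 1 x] by simp

text \<open>The norms of the approximating simple functions are measurable and converge almost
  everywhere; completeness absorbs the exceptional null set.\<close>

lemma strongly_measurable_norm:
  assumes M: "complete_measure M" and f: "strongly_measurable M f"
  shows "(\<lambda>x. norm (f x)) \<in> borel_measurable M"
proof -
  obtain s where s: "\<And>i::nat. simple_function M (s i)" "AE x in M. (\<lambda>i. s i x) \<longlonglongrightarrow> f x"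
    using f unfolding strongly_measurable_def by auto
  have [measurable]: "(\<lambda>x. norm (s i x)) \<in> borel_measurable M" for i
    by (intro borel_measurable_simple_function simple_function_compose1[OF s(1)])
  have "AE x in M. norm (f x) = lim (\<lambda>i. norm (s i x))"
    using s(2) by eventually_elim (metis limI tendsto_norm)
  from measurable_AE_eq[OF M _ this, of borel] show ?thesis by simp
qed

lemma strongly_measurable_indicator:
  fixes f :: "'a \<Rightarrow> 'x::real_normed_vector"
  assumes "strongly_measurable M f" "A \<in> sets M"
  shows "strongly_measurable M (\<lambda>x. if x \<in> A then f x else 0)"
proof -
  have "strongly_measurable M (\<lambda>x. indicator A x *\<^sub>R f x)"
  proof (rule strongly_measurable_compose2[of "\<lambda>a b. a *\<^sub>R b"])
    show "strongly_measurable M (indicator A :: _ \<Rightarrow> real)"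
      by (rule strongly_measurable_borel) (use assms in simp)
  qed (intro continuous_intros assms)+
  also have "(\<lambda>x. indicator A x *\<^sub>R f x) = (\<lambda>x. if x \<in> A then f x else 0)"
    by (auto simp: indicator_def)
  finally show ?thesis .
qed

section \<open>The strong integral\<close>

abbreviation "simple_strong_integrable \<equiv> Bochner_Integration.simple_bochner_integrable"
abbreviation "simple_strong_integral \<equiv> Bochner_Integration.simple_bochner_integral"

lemma ennreal_norm_triangle:
  "ennreal (norm (a - c)) \<le> ennreal (norm (a - b)) + ennreal (norm (b - c))"
  using norm_triangle_ineq[of "a - b" "b - c"] by (simp flip: ennreal_plus)

lemma ennreal_norm_triangle':
  "ennreal (norm a) \<le> ennreal (norm (a - b)) + ennreal (norm b)"
  using ennreal_norm_triangle[of a 0 b] by simp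

text \<open>Simple functions close to \<open>f\<close> in the mean are close to each other. This one
  estimate yields uniqueness of the integral, the norm bound (with \<open>t\<close> zero) and the
  Cauchy property behind existence.\<close>

lemma simple_bochner_integral_bounded':
  fixes f :: "'a \<Rightarrow> 'x::real_normed_vector"
  assumes M: "complete_measure M" and f: "strongly_measurable M f"
    and s: "simple_strong_integrable M s" and t: "simple_strong_integrable M t"
  shows "ennreal (norm (simple_strong_integral M s - simple_strong_integral M t)) \<le>
    (\<integral>\<^sup>+ x. norm (f x - s x) \<partial>M) + (\<integral>\<^sup>+ x. norm (f x - t x) \<partial>M)"
proof -
  have st: "simple_function M s" "simple_function M t"
    using s t by (auto elim: Bochner_Integration.simple_bochner_integrable.cases)
  have [measurable]: "(\<lambda>x. norm (f x - s x)) \<in> borel_measurable M" "(\<lambda>x. norm (f x - t x)) \<in> borel_measurable M"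
    by (intro strongly_measurable_norm[OF M] strongly_measurable_diff[OF f] strongly_measurable_simple st)+
  have sbi: "simple_strong_integrable M (\<lambda>x. s x - t x)"
       "simple_strong_integrable M (\<lambda>x. norm (s x - t x))"
    using simple_bochner_integrable_compose2[of "(-)" M s t]
      simple_bochner_integrable_compose2[of "\<lambda>x y. norm (x - y)" M s t] s t by auto
  have "ennreal (norm (simple_strong_integral M s - simple_strong_integral M t))
      \<le> simple_strong_integral M (\<lambda>x. norm (s x - t x))"
    using simple_bochner_integral_norm_bound[OF sbi(1)] s t
    by (simp add: simple_bochner_integral_diff ennreal_leI)
  also have "\<dots> = (\<integral>\<^sup>+x. norm (s x - t x) \<partial>M)"
    using sbi by (intro simple_bochner_integral_eq_nn_integral) auto
  also have "\<dots> \<le> (\<integral>\<^sup>+x. ennreal (norm (f x - s x)) + ennreal (norm (f x - t x)) \<partial>M)"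
    by (intro nn_integral_mono) (metis ennreal_norm_triangle norm_minus_commute)
  also have "\<dots> = (\<integral>\<^sup>+ x. norm (f x - s x) \<partial>M) + (\<integral>\<^sup>+ x. norm (f x - t x) \<partial>M)"
    by (rule nn_integral_add) auto
  finally show ?thesis .
qed

lemma has_strong_integralE:
  assumes "has_strong_integral M f v"
  obtains s where "strongly_measurable M f" "\<And>i::nat. simple_strong_integrable M (s i)"
    "(\<lambda>i. \<integral>\<^sup>+x. ennreal (norm (f x - s i x)) \<partial>M) \<longlonglongrightarrow> 0"
    "(\<lambda>i. simple_strong_integral M (s i)) \<longlonglongrightarrow> v"
  using assms unfolding has_strong_integral_def by blast

lemma has_strong_integral_unique:
  assumes M: "complete_measure M" and f: "has_strong_integral M f v" "has_strong_integral M f w"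
  shows "v = w"
proof -
  obtain s where s: "strongly_measurable M f" "\<And>i::nat. simple_strong_integrable M (s i)"
    "(\<lambda>i. \<integral>\<^sup>+x. ennreal (norm (f x - s i x)) \<partial>M) \<longlonglongrightarrow> 0"
    "(\<lambda>i. simple_strong_integral M (s i)) \<longlonglongrightarrow> v"
    using f(1) by (rule has_strong_integralE) blast
  obtain t where t: "\<And>i::nat. simple_strong_integrable M (t i)"
    "(\<lambda>i. \<integral>\<^sup>+x. ennreal (norm (f x - t i x)) \<partial>M) \<longlonglongrightarrow> 0"
    "(\<lambda>i. simple_strong_integral M (t i)) \<longlonglongrightarrow> w"
    using f(2) by (rule has_strong_integralE) blast
  let ?d = "\<lambda>i. simple_strong_integral M (s i) - simple_strong_integral M (t i)"
  have "(\<lambda>i. ennreal (norm (?d i))) \<longlonglongrightarrow> 0"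
  proof (rule tendsto_sandwich[OF _ _ tendsto_const])
    show "\<forall>\<^sub>F i in sequentially. ennreal (norm (?d i)) \<le> (\<integral>\<^sup>+ x. norm (f x - s i x) \<partial>M) + (\<integral>\<^sup>+ x. norm (f x - t i x) \<partial>M)"
      by (intro always_eventually allI simple_bochner_integral_bounded' M s t)
    show "(\<lambda>i. (\<integral>\<^sup>+ x. norm (f x - s i x) \<partial>M) + (\<integral>\<^sup>+ x. norm (f x - t i x) \<partial>M)) \<longlonglongrightarrow> 0"
      using tendsto_add[OF s(3) t(2)] by simp
  qed auto
  moreover have "(\<lambda>i. ennreal (norm (?d i))) \<longlonglongrightarrow> ennreal (norm (v - w))"
    by (intro tendsto_ennrealI tendsto_norm tendsto_diff s t)
  ultimately have "ennreal (norm (v - w)) = 0" by (rule LIMSEQ_unique[symmetric])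
  then show ?thesis by simp
qed

lemma strong_integral_eqI:
  assumes "complete_measure M" "has_strong_integral M f v"
  shows "strong_integral M f = v"
  using assms has_strong_integral_unique[OF assms(1)]
  unfolding strong_integral_def strongly_integrable_def by (auto intro!: the_equality)

lemma has_strong_integral_add:
  fixes f g :: "'a \<Rightarrow> 'x::real_normed_vector"
  assumes M: "complete_measure M" and f: "has_strong_integral M f v" and g: "has_strong_integral M g w"
  shows "has_strong_integral M (\<lambda>x. f x + g x) (v + w)"
proof -
  obtain s where s: "strongly_measurable M f" "\<And>i::nat. simple_strong_integrable M (s i)"
    "(\<lambda>i. \<integral>\<^sup>+x. ennreal (norm (f x - s i x)) \<partial>M) \<longlonglongrightarrow> 0"
    "(\<lambda>i. simple_strong_integral M (s i)) \<longlonglongrightarrow> v"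
    using f by (rule has_strong_integralE) blast
  obtain t where t: "strongly_measurable M g" "\<And>i::nat. simple_strong_integrable M (t i)"
    "(\<lambda>i. \<integral>\<^sup>+x. ennreal (norm (g x - t i x)) \<partial>M) \<longlonglongrightarrow> 0"
    "(\<lambda>i. simple_strong_integral M (t i)) \<longlonglongrightarrow> w"
    using g by (rule has_strong_integralE) blast
  have st: "simple_function M (s i)" "simple_function M (t i)" for i
    using s(2)[of i] t(2)[of i] by (auto elim: Bochner_Integration.simple_bochner_integrable.cases)
  have [measurable]: "(\<lambda>x. norm (f x - s i x)) \<in> borel_measurable M" "(\<lambda>x. norm (g x - t i x)) \<in> borel_measurable M" for i
    by (intro strongly_measurable_norm[OF M] strongly_measurable_diff[OF s(1)] strongly_measurable_diff[OF t(1)] strongly_measurable_simple st)+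
  let ?u = "\<lambda>i. \<integral>\<^sup>+x. ennreal (norm (f x + g x - (s i x + t i x))) \<partial>M"
  have "?u \<longlonglongrightarrow> 0"
  proof (rule tendsto_sandwich[OF _ _ tendsto_const])
    show "\<forall>\<^sub>F i in sequentially. ?u i \<le> (\<integral>\<^sup>+ x. norm (f x - s i x) \<partial>M) + (\<integral>\<^sup>+ x. norm (g x - t i x) \<partial>M)"
      by (intro always_eventually allI, subst nn_integral_add[symmetric])
         (auto intro!: nn_integral_mono norm_diff_triangle_ineq simp flip: ennreal_plus)
    show "(\<lambda>i. (\<integral>\<^sup>+ x. norm (f x - s i x) \<partial>M) + (\<integral>\<^sup>+ x. norm (g x - t i x) \<partial>M)) \<longlonglongrightarrow> 0"
      using tendsto_add[OF s(3) t(3)] by simp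
  qed auto
  moreover have "(\<lambda>i. simple_strong_integral M (\<lambda>x. s i x + t i x)) \<longlonglongrightarrow> v + w"
    using s t by (simp add: simple_bochner_integral_add tendsto_add)
  moreover have "simple_strong_integrable M (\<lambda>x. s i x + t i x)" for i
    using s(2) t(2) by (simp add: simple_bochner_integrable_compose2)
  ultimately show ?thesis
    using s(1) t(1) unfolding has_strong_integral_def
    by (auto intro!: strongly_measurable_add exI[of _ "\<lambda>i x. s i x + t i x"])
qed

lemma has_strong_integral_bounded_linear:
  fixes f :: "'a \<Rightarrow> 'x::real_normed_vector"
  assumes M: "complete_measure M" and f: "has_strong_integral M f v" and "bounded_linear T"
  shows "has_strong_integral M (\<lambda>x. T (f x)) (T v)"
proof -
  interpret T: bounded_linear T by fact
  obtain s where s: "strongly_measurable M f" "\<And>i::nat. simple_strong_integrable M (s i)"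
    "(\<lambda>i. \<integral>\<^sup>+x. ennreal (norm (f x - s i x)) \<partial>M) \<longlonglongrightarrow> 0"
    "(\<lambda>i. simple_strong_integral M (s i)) \<longlonglongrightarrow> v"
    using f by (rule has_strong_integralE) blast
  obtain K where K: "K > 0" "\<And>x. norm (T x) \<le> norm x * K"
    using T.pos_bounded by blast
  have [measurable]: "(\<lambda>x. norm (f x - s i x)) \<in> borel_measurable M" for i
    using s(2)[of i] by (intro strongly_measurable_norm[OF M] strongly_measurable_diff[OF s(1)]
      strongly_measurable_simple) (auto elim: Bochner_Integration.simple_bochner_integrable.cases)
  let ?u = "\<lambda>i. \<integral>\<^sup>+x. ennreal (norm (T (f x) - T (s i x))) \<partial>M"
  have "?u \<longlonglongrightarrow> 0"
  proof (rule tendsto_sandwich[OF _ _ tendsto_const])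
    show "\<forall>\<^sub>F i in sequentially. ?u i \<le> ennreal K * (\<integral>\<^sup>+ x. norm (f x - s i x) \<partial>M)"
    proof (intro always_eventually allI)
      fix i
      have "?u i \<le> (\<integral>\<^sup>+x. ennreal K * ennreal (norm (f x - s i x)) \<partial>M)"
        using K by (intro nn_integral_mono) (simp add: T.diff[symmetric] ennreal_mult[symmetric] mult.commute)
      also have "\<dots> = ennreal K * (\<integral>\<^sup>+ x. norm (f x - s i x) \<partial>M)"
        by (rule nn_integral_cmult) auto
      finally show "?u i \<le> ennreal K * (\<integral>\<^sup>+ x. norm (f x - s i x) \<partial>M)" .
    qed
    show "(\<lambda>i. ennreal K * (\<integral>\<^sup>+ x. norm (f x - s i x) \<partial>M)) \<longlonglongrightarrow> 0"
      using ennreal_tendsto_cmult[OF _ s(3), of "ennreal K"] by simp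
  qed auto
  moreover have "(\<lambda>i. simple_strong_integral M (\<lambda>x. T (s i x))) \<longlonglongrightarrow> T v"
    using s by (simp add: simple_bochner_integral_linear T.linear_axioms T.tendsto)
  moreover have "simple_strong_integrable M (\<lambda>x. T (s i x))" for i
    using s(2) simple_bochner_integrable_compose2[of "\<lambda>x y. T x" M "s i" "s i"] by (simp add: T.zero)
  ultimately show ?thesis
    using s(1) strongly_measurable_bounded_linear[OF assms(3)] unfolding has_strong_integral_def
    by (auto intro!: exI[of _ "\<lambda>i x. T (s i x)"])
qed

lemma has_strong_integral_zero: "has_strong_integral M (\<lambda>x. 0) 0"
  unfolding has_strong_integral_def
  by (auto intro!: exI[of _ "\<lambda>_ _. 0"] strongly_measurable_simple simp: zero_ennreal_def[symmetric]
      Bochner_Integration.simple_bochner_integrable.simps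
      Bochner_Integration.simple_bochner_integral_def image_constant_conv)

lemma has_strong_integral_sum:
  fixes f :: "'i \<Rightarrow> 'a \<Rightarrow> 'x::real_normed_vector"
  assumes "complete_measure M" "\<And>i. i \<in> I \<Longrightarrow> has_strong_integral M (f i) (v i)"
  shows "has_strong_integral M (\<lambda>x. \<Sum>i\<in>I. f i x) (\<Sum>i\<in>I. v i)"
  using assms(2)
  by (induction I rule: infinite_finite_induct)
     (auto intro: has_strong_integral_zero has_strong_integral_add[OF assms(1)])

lemma has_strong_integral_norm_bound:
  fixes f :: "'a \<Rightarrow> 'x::real_normed_vector"
  assumes M: "complete_measure M" and f: "has_strong_integral M f v"
  shows "ennreal (norm v) \<le> (\<integral>\<^sup>+x. norm (f x) \<partial>M)"
proof -
  obtain s where s: "strongly_measurable M f" "\<And>i::nat. simple_strong_integrable M (s i)"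
    "(\<lambda>i. \<integral>\<^sup>+x. ennreal (norm (f x - s i x)) \<partial>M) \<longlonglongrightarrow> 0"
    "(\<lambda>i. simple_strong_integral M (s i)) \<longlonglongrightarrow> v"
    using f by (rule has_strong_integralE) blast
  have z: "simple_strong_integrable M (\<lambda>_. 0::'x)"
    by (auto simp: Bochner_Integration.simple_bochner_integrable.simps)
  have "ennreal (norm (simple_strong_integral M (s i)))
      \<le> (\<integral>\<^sup>+ x. norm (f x - s i x) \<partial>M) + (\<integral>\<^sup>+ x. norm (f x) \<partial>M)" for i
    using simple_bochner_integral_bounded'[OF M s(1) s(2) z, of i]
    by (simp add: Bochner_Integration.simple_bochner_integral_def[of M "\<lambda>_. 0"] image_constant_conv cong: if_cong split: if_splits)
  moreover have "(\<lambda>i. ennreal (norm (simple_strong_integral M (s i)))) \<longlonglongrightarrow> ennreal (norm v)"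
    by (intro tendsto_ennrealI tendsto_norm s)
  moreover have "(\<lambda>i. (\<integral>\<^sup>+ x. norm (f x - s i x) \<partial>M) + (\<integral>\<^sup>+ x. norm (f x) \<partial>M)) \<longlonglongrightarrow> 0 + (\<integral>\<^sup>+ x. norm (f x) \<partial>M)"
    by (intro tendsto_add s tendsto_const)
  ultimately show ?thesis
    by (auto intro: LIMSEQ_le)
qed

lemma strongly_integrableI_bounded:
  fixes f :: "'a \<Rightarrow> 'x::banach"
  assumes M: "complete_measure M" and f: "strongly_measurable M f" and fin: "(\<integral>\<^sup>+x. norm (f x) \<partial>M) < \<infinity>"
  shows "\<exists>v. has_strong_integral M f v"
proof -
  obtain s where s: "\<And>i::nat. simple_function M (s i)" "AE x in M. (\<lambda>i. s i x) \<longlonglongrightarrow> f x"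
    using f unfolding strongly_measurable_def by auto
  \<comment> \<open>Cutting the approximants at twice the norm of \<open>f\<close> makes them
    integrable and provides the dominating function \<open>3 * norm (f x)\<close>. Where
    \<open>f x\<close> is nonzero, the factor 2 leaves \<open>s i x\<close> untouched from some
    index on; where it is zero, the cut value is zero as well.\<close>
  define t where "t = (\<lambda>i x. if norm (s i x) \<le> 2 * norm (f x) then s i x else 0)"
  have [measurable]: "(\<lambda>x. norm (f x)) \<in> borel_measurable M"
    by (rule strongly_measurable_norm[OF M f])
  have [measurable]: "(\<lambda>x. norm (s i x)) \<in> borel_measurable M" for i
    by (intro borel_measurable_simple_function simple_function_compose1[OF s(1)])
  have t: "simple_function M (t i)" for i
    unfolding t_def by (intro simple_function_If s) auto
  have tn: "norm (t i x) \<le> 2 * norm (f x)" for i x by (simp add: t_def)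
  have "(\<integral>\<^sup>+x. norm (t i x) \<partial>M) \<le> (\<integral>\<^sup>+x. 2 * ennreal (norm (f x)) \<partial>M)" for i
    by (intro nn_integral_mono) (metis tn ennreal_leI ennreal_mult' ennreal_numeral zero_le_numeral)
  also have "\<dots> < \<infinity>" using fin by (simp add: nn_integral_cmult ennreal_mult_less_top)
  finally have tb: "simple_strong_integrable M (t i)" for i
    using simple_bochner_integrableI_bounded[OF t] by blast
  have [measurable]: "(\<lambda>x. norm (f x - t i x)) \<in> borel_measurable M" for i
    by (intro strongly_measurable_norm[OF M] strongly_measurable_diff[OF f] strongly_measurable_simple t)
  have "(\<lambda>i. \<integral>\<^sup>+x. ennreal (norm (f x - t i x)) \<partial>M) \<longlonglongrightarrow> (\<integral>\<^sup>+x. 0 \<partial>M)"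
  proof (rule nn_integral_dominated_convergence[where w="\<lambda>x. 3 * ennreal (norm (f x))"])
    show "AE x in M. ennreal (norm (f x - t i x)) \<le> 3 * ennreal (norm (f x))" for i
    proof (rule AE_I2)
      fix x
      have "norm (f x - t i x) \<le> 3 * norm (f x)"
        using norm_triangle_ineq4[of "f x" "t i x"] tn[of i x] by linarith
      then show "ennreal (norm (f x - t i x)) \<le> 3 * ennreal (norm (f x))"
        by (metis ennreal_leI ennreal_mult' ennreal_numeral zero_le_numeral)
    qed
    show "(\<integral>\<^sup>+ x. 3 * ennreal (norm (f x)) \<partial>M) < \<infinity>"
      using fin by (simp add: nn_integral_cmult ennreal_mult_less_top)
    show "AE x in M. (\<lambda>i. ennreal (norm (f x - t i x))) \<longlonglongrightarrow> 0"
      using s(2)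
    proof eventually_elim
      case (elim x)
      have "(\<lambda>i. t i x) \<longlonglongrightarrow> f x"
      proof (cases "f x = 0")
        case True
        then have "t i x = 0" for i by (auto simp: t_def)
        then show ?thesis using True by simp
      next
        case False
        have "(\<lambda>i. norm (s i x)) \<longlonglongrightarrow> norm (f x)" by (intro tendsto_norm elim)
        then have "\<forall>\<^sub>F i in sequentially. norm (s i x) < 2 * norm (f x)"
          by (rule order_tendstoD) (use False in auto)
        then have "\<forall>\<^sub>F i in sequentially. s i x = t i x"
          by eventually_elim (simp add: t_def)
        then show ?thesis by (rule Lim_transform_eventually[OF elim])
      qed
      from tendsto_norm[OF tendsto_diff[OF tendsto_const this, of "f x"]]
      have "(\<lambda>i. norm (f x - t i x)) \<longlonglongrightarrow> 0" by simp
      then show ?case by (metis ennreal_0 tendsto_ennrealI)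
    qed
  qed auto
  then have lim: "(\<lambda>i. \<integral>\<^sup>+x. ennreal (norm (f x - t i x)) \<partial>M) \<longlonglongrightarrow> 0" by simp
  have "Cauchy (\<lambda>i. simple_strong_integral M (t i))"
  proof (rule metric_CauchyI)
    fix e :: real assume e: "0 < e"
    then have "0 < ennreal (e / 2)" by simp
    from order_tendstoD(2)[OF lim this] obtain N where
      N: "\<And>i. i \<ge> N \<Longrightarrow> (\<integral>\<^sup>+x. ennreal (norm (f x - t i x)) \<partial>M) < ennreal (e / 2)"
      by (auto simp: eventually_sequentially)
    show "\<exists>N. \<forall>m\<ge>N. \<forall>n\<ge>N. dist (simple_strong_integral M (t m)) (simple_strong_integral M (t n)) < e"
    proof (intro exI allI impI)
      fix m n assume mn: "N \<le> m" "N \<le> n"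
      have "ennreal (dist (simple_strong_integral M (t m)) (simple_strong_integral M (t n)))
        \<le> (\<integral>\<^sup>+ x. norm (f x - t m x) \<partial>M) + (\<integral>\<^sup>+ x. norm (f x - t n x) \<partial>M)"
        unfolding dist_norm by (rule simple_bochner_integral_bounded'[OF M f tb tb])
      also have "\<dots> < ennreal (e/2) + ennreal (e/2)"
        by (rule add_strict_mono[OF N[OF mn(1)] N[OF mn(2)]])
      also have "\<dots> = ennreal e" using e by (simp flip: ennreal_plus)
      finally show "dist (simple_strong_integral M (t m)) (simple_strong_integral M (t n)) < e"
        by (simp add: ennreal_less_iff)
    qed
  qed
  then obtain v where "(\<lambda>i. simple_strong_integral M (t i)) \<longlonglongrightarrow> v"
    using Cauchy_convergent_iff convergent_def by blast
  with lim tb f show ?thesis unfolding has_strong_integral_def by blast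
qed

lemma has_strong_integral_implies_finite_norm:
  fixes f :: "'a \<Rightarrow> 'x::real_normed_vector"
  assumes M: "complete_measure M" and "has_strong_integral M f v"
  shows "(\<integral>\<^sup>+x. norm (f x) \<partial>M) < \<infinity>"
proof -
  obtain s where s: "strongly_measurable M f" "\<And>i::nat. simple_strong_integrable M (s i)"
    "(\<lambda>i. \<integral>\<^sup>+x. ennreal (norm (f x - s i x)) \<partial>M) \<longlonglongrightarrow> 0"
    using assms(2) by (rule has_strong_integralE) blast
  obtain i where i: "(\<integral>\<^sup>+x. ennreal (norm (f x - s i x)) \<partial>M) < \<infinity>"
    using order_tendstoD(2)[OF s(3), of "\<infinity>"] by (auto simp: eventually_sequentially)
  have si: "simple_function M (s i)"
    using s(2)[of i] by (auto elim: Bochner_Integration.simple_bochner_integrable.cases)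
  have [measurable]: "(\<lambda>x. norm (f x - s i x)) \<in> borel_measurable M" "(\<lambda>x. norm (s i x)) \<in> borel_measurable M"
    by (intro strongly_measurable_norm[OF M] strongly_measurable_diff[OF s(1)] strongly_measurable_simple si)+
  have "simple_strong_integrable M (\<lambda>x. norm (s i x))"
    using simple_bochner_integrable_compose2[of "\<lambda>x y. norm x" M "s i" "s i"] s(2) by simp
  from simple_bochner_integral_eq_nn_integral[OF this]
  have fin: "(\<integral>\<^sup>+x. norm (s i x) \<partial>M) < \<infinity>" by (metis ennreal_less_top infinity_ennreal_def norm_ge_zero)
  have "(\<integral>\<^sup>+x. norm (f x) \<partial>M) \<le> (\<integral>\<^sup>+x. ennreal (norm (f x - s i x)) + ennreal (norm (s i x)) \<partial>M)"
    by (intro nn_integral_mono ennreal_norm_triangle')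
  also have "\<dots> = (\<integral>\<^sup>+x. norm (f x - s i x) \<partial>M) + (\<integral>\<^sup>+x. norm (s i x) \<partial>M)"
    by (rule nn_integral_add) auto
  also have "\<dots> < \<infinity>" using i fin by simp
  finally show ?thesis .
qed

text \<open>The scalar integral is an ordinary Bochner integral, carried into the Banach space by
  the bounded linear map that multiplies \<open>v\<close> by a scalar.\<close>

lemma has_strong_integral_complex:
  assumes M: "complete_measure M" and "has_bochner_integral M h z"
  shows "has_strong_integral M (\<lambda>x. h x *\<^sub>C v) (z *\<^sub>C (v::'x::complex_banach))"
proof (rule has_strong_integral_bounded_linear[OF M _ scaleC.bounded_linear_left])
  show "has_strong_integral M h z"
    using assms(2) by cases (auto simp: has_strong_integral_def intro!: strongly_measurable_borel)
qed

text \<open>By monotone convergence the integral of the series is finite, so the series itself is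
  finite almost everywhere.\<close>

lemma AE_summable_of_summable_integrals:
  fixes u :: "nat \<Rightarrow> 'a \<Rightarrow> real"
  assumes [measurable]: "\<And>i. u i \<in> borel_measurable M" and nn: "\<And>i x. 0 \<le> u i x"
    and fin: "(\<Sum>i. \<integral>\<^sup>+x. ennreal (u i x) \<partial>M) < \<infinity>"
  shows "AE x in M. summable (\<lambda>i. u i x)"
proof -
  have "(\<integral>\<^sup>+x. (\<Sum>i. ennreal (u i x)) \<partial>M) < \<infinity>"
    using fin by (subst nn_integral_suminf) auto
  then have "AE x in M. (\<Sum>i. ennreal (u i x)) \<noteq> \<infinity>"
    by (intro nn_integral_PInf_AE) auto
  then show ?thesis
    by eventually_elim (rule summable_suminf_not_top, rule nn, simp)
qed

text \<open>The limit function need not be known to be strongly measurable: simple functions that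
  approximate rapidly in the mean also converge almost everywhere.\<close>

lemma has_strong_integral_limit:
  fixes f :: "'a \<Rightarrow> 'x::banach"
  assumes M: "complete_measure M"
    and g: "\<And>i::nat. has_strong_integral M (g i) (v i)"
    and lim: "AE x in M. (\<lambda>i. g i x) \<longlonglongrightarrow> f x"
    and L1: "(\<lambda>i. \<integral>\<^sup>+x. ennreal (norm (f x - g i x)) \<partial>M) \<longlonglongrightarrow> 0"
  shows "\<exists>w. has_strong_integral M f w \<and> v \<longlonglongrightarrow> w"
proof -
  have gm: "strongly_measurable M (g i)" for i
    using g[of i] by (auto simp: has_strong_integral_def)
  \<comment> \<open>Strong measurability of \<open>f\<close> is still to be proved, so these norms
    are obtained as almost everywhere limits of the measurable norms of
    \<open>g i x - s x\<close>.\<close>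
  have meas: "(\<lambda>x. norm (f x - s x)) \<in> borel_measurable M" if s: "strongly_measurable M s" for s
  proof -
    have [measurable]: "(\<lambda>x. norm (g i x - s x)) \<in> borel_measurable M" for i
      by (intro strongly_measurable_norm[OF M] strongly_measurable_diff gm s)
    have "AE x in M. norm (f x - s x) = lim (\<lambda>i. norm (g i x - s x))"
      using lim by eventually_elim (intro limI[symmetric] tendsto_norm tendsto_diff tendsto_const)
    from measurable_AE_eq[OF M _ this, of borel] show ?thesis by simp
  qed
  have "\<exists>s. simple_function M s \<and> (\<integral>\<^sup>+x. ennreal (norm (f x - s x)) \<partial>M) \<le> ennreal ((1/2)^n)" for n :: nat
  proof -
    have pos: "0 < ennreal ((1/2)^Suc n)" by simp
    obtain i where i: "(\<integral>\<^sup>+x. ennreal (norm (f x - g i x)) \<partial>M) < ennreal ((1/2)^Suc n)"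
      using order_tendstoD(2)[OF L1 pos] by (auto simp: eventually_sequentially)
    obtain s where s: "\<And>i::nat. simple_strong_integrable M (s i)"
      "(\<lambda>j. \<integral>\<^sup>+x. ennreal (norm (g i x - s j x)) \<partial>M) \<longlonglongrightarrow> 0"
      using g[of i] by (rule has_strong_integralE) blast
    obtain j where j: "(\<integral>\<^sup>+x. ennreal (norm (g i x - s j x)) \<partial>M) < ennreal ((1/2)^Suc n)"
      using order_tendstoD(2)[OF s(2) pos] by (auto simp: eventually_sequentially)
    have sj: "simple_function M (s j)"
      using s(1)[of j] by (auto elim: Bochner_Integration.simple_bochner_integrable.cases)
    have "(\<integral>\<^sup>+x. ennreal (norm (f x - s j x)) \<partial>M)
      \<le> (\<integral>\<^sup>+x. ennreal (norm (f x - g i x)) + ennreal (norm (g i x - s j x)) \<partial>M)"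
      by (intro nn_integral_mono ennreal_norm_triangle)
    also have "\<dots> = (\<integral>\<^sup>+x. ennreal (norm (f x - g i x)) \<partial>M) + (\<integral>\<^sup>+x. ennreal (norm (g i x - s j x)) \<partial>M)"
      using meas[OF gm] strongly_measurable_norm[OF M strongly_measurable_diff[OF gm strongly_measurable_simple[OF sj]]]
      by (intro nn_integral_add) auto
    also have "\<dots> \<le> ennreal ((1/2)^Suc n) + ennreal ((1/2)^Suc n)"
      using i j by (intro add_mono) auto
    also have "\<dots> = ennreal ((1/2)^n)" by (simp flip: ennreal_plus)
    finally show ?thesis using sj by blast
  qed
  then obtain s where s: "\<And>n. simple_function M (s n)"
    "\<And>n. (\<integral>\<^sup>+x. ennreal (norm (f x - s n x)) \<partial>M) \<le> ennreal ((1/2)^n)" by metis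
  have "(\<Sum>i. \<integral>\<^sup>+x. ennreal (norm (f x - s i x)) \<partial>M) \<le> (\<Sum>i. ennreal ((1/2)^i))"
    by (intro suminf_le s) auto
  also have "\<dots> = ennreal (\<Sum>i. (1/2)^i)"
    by (intro suminf_ennreal_eq) (auto intro!: summable_sums complete_algebra_summable_geometric)
  finally have fin: "(\<Sum>i. \<integral>\<^sup>+x. ennreal (norm (f x - s i x)) \<partial>M) < \<infinity>"
    by (simp add: le_less_trans)
  have "AE x in M. summable (\<lambda>i. norm (f x - s i x))"
    by (rule AE_summable_of_summable_integrals[OF _ _ fin])
       (intro meas strongly_measurable_simple s norm_ge_zero)+
  then have "AE x in M. (\<lambda>i. s i x) \<longlonglongrightarrow> f x"
  proof eventually_elim
    case (elim x)
    show ?case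
      using summable_LIMSEQ_zero[OF elim] by (subst LIM_zero_iff[symmetric], subst tendsto_norm_zero_iff[symmetric]) (simp add: norm_minus_commute)
  qed
  then have f: "strongly_measurable M f"
    unfolding strongly_measurable_def using s(1) by blast
  have [measurable]: "(\<lambda>x. norm (f x - g i x)) \<in> borel_measurable M" "(\<lambda>x. norm (g i x)) \<in> borel_measurable M" for i
    using meas[OF gm] strongly_measurable_norm[OF M gm] by auto
  obtain i where i: "(\<integral>\<^sup>+x. ennreal (norm (f x - g i x)) \<partial>M) < \<infinity>"
    using order_tendstoD(2)[OF L1, of \<infinity>] by (auto simp: eventually_sequentially)
  have "(\<integral>\<^sup>+x. norm (f x) \<partial>M) \<le> (\<integral>\<^sup>+x. ennreal (norm (f x - g i x)) + ennreal (norm (g i x)) \<partial>M)"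
    by (intro nn_integral_mono ennreal_norm_triangle')
  also have "\<dots> = (\<integral>\<^sup>+x. norm (f x - g i x) \<partial>M) + (\<integral>\<^sup>+x. norm (g i x) \<partial>M)"
    by (rule nn_integral_add) auto
  also have "\<dots> < \<infinity>" using i has_strong_integral_implies_finite_norm[OF M g] by simp
  finally obtain w where w: "has_strong_integral M f w"
    using strongly_integrableI_bounded[OF M f] by blast
  have "ennreal (norm (w - v i)) \<le> (\<integral>\<^sup>+x. ennreal (norm (f x - g i x)) \<partial>M)" for i
  proof -
    have "has_strong_integral M (\<lambda>x. f x + - g i x) (w + - v i)"
      by (intro has_strong_integral_add M w has_strong_integral_bounded_linear[OF M g, of uminus] bounded_linear_minus bounded_linear_ident)
    from has_strong_integral_norm_bound[OF M this] show ?thesis by simp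
  qed
  then have "(\<lambda>i. ennreal (norm (w - v i))) \<longlonglongrightarrow> 0"
    by (intro tendsto_sandwich[OF _ _ tendsto_const L1]) auto
  then have "(\<lambda>i. norm (w - v i)) \<longlonglongrightarrow> 0"
    by (simp flip: ennreal_0)
  then have "v \<longlonglongrightarrow> w"
    by (subst LIM_zero_iff[symmetric], subst tendsto_norm_zero_iff[symmetric]) (simp add: norm_minus_commute)
  with w show ?thesis by blast
qed

section \<open>Characters and Gaussians\<close>

abbreviation ivec :: "int^'d \<Rightarrow> real^'d" where "ivec n \<equiv> (\<chi> i. of_int (n $ i))"

definition character :: "int^'d \<Rightarrow> real^'d \<Rightarrow> complex" where
  "character n x = cis (2 * pi * (x \<bullet> ivec n))"

text \<open>Lebesgue measure on \<open>real^'d\<close> is the image of the product measure indexed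
  by \<open>Basis\<close>, so Fubini's theorem for products applies once basis vectors are
  identified with coordinates through \<open>axis\<close>.\<close>

lemma has_bochner_integral_vec_prod:
  fixes h :: "'d::finite \<Rightarrow> real \<Rightarrow> complex"
  assumes "\<And>i. has_bochner_integral lborel (h i) (z i)"
  shows "has_bochner_integral lborel (\<lambda>x::real^'d. \<Prod>i\<in>UNIV. h i (x $ i)) (\<Prod>i\<in>UNIV. z i)"
proof -
  interpret product_sigma_finite "\<lambda>_::real^'d. lborel :: real measure" ..
  define ax where "ax = (\<lambda>i::'d. axis i (1::real))"
  have inj: "inj ax" by (auto simp: ax_def inj_on_def axis_eq_axis)
  have Basis: "(Basis :: (real^'d) set) = range ax" by (auto simp: Basis_vec_def ax_def)
  define H where "H = (\<lambda>b. h (inv ax b))"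
  have H: "H (ax i) = h i" for i by (simp add: H_def inv_f_f[OF inj])
  have intH: "integrable lborel (H b)" for b
    using assms by (auto simp: H_def has_bochner_integral_iff)
  have prod: "(\<Prod>b\<in>Basis. F b) = (\<Prod>i\<in>UNIV. F (ax i))" for F :: "real^'d \<Rightarrow> complex"
    unfolding Basis by (subst prod.reindex[OF inj]) simp
  let ?T = "\<lambda>f. \<Sum>b\<in>Basis. f b *\<^sub>R (b::real^'d)"
  have [measurable]: "H b \<in> borel_measurable borel" for b
    using borel_measurable_integrable[OF intH] by simp
  have hm: "h i \<in> borel_measurable borel" for i
    using borel_measurable_integrable[OF intH, of "ax i"] by (simp add: H)
  have m: "(\<lambda>x::real^'d. \<Prod>i\<in>UNIV. h i (x $ i)) \<in> borel_measurable borel"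
    by (intro borel_measurable_prod measurable_compose[OF _ hm]) (auto intro: borel_measurable_continuous_onI continuous_intros)
  have eq: "(\<Prod>i\<in>UNIV. h i (?T f $ i)) = (\<Prod>b\<in>Basis. H b (f b))" for f
  proof -
    have "?T f $ i = f (ax i)" for i
      using inner_sum_left_Basis[of "ax i" f] by (simp add: ax_def cart_eq_inner_axis)
    then show ?thesis by (simp add: prod H)
  qed
  have "has_bochner_integral (\<Pi>\<^sub>M b\<in>(Basis::(real^'d) set). lborel) (\<lambda>f. \<Prod>b\<in>Basis. H b (f b)) (\<Prod>b\<in>Basis. integral\<^sup>L lborel (H b))"
    using product_integrable_prod[of Basis H] product_integral_prod[of Basis H] intH
    by (simp add: has_bochner_integral_iff)
  also have "(\<Prod>b\<in>Basis. integral\<^sup>L lborel (H b)) = (\<Prod>i\<in>UNIV. z i)"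
    using assms by (simp add: prod H has_bochner_integral_iff)
  finally have "has_bochner_integral (\<Pi>\<^sub>M b\<in>(Basis::(real^'d) set). lborel) (\<lambda>f. \<Prod>i\<in>UNIV. h i (?T f $ i)) (\<Prod>i\<in>UNIV. z i)"
    by (simp only: eq)
  then have "has_bochner_integral (distr (\<Pi>\<^sub>M b\<in>Basis. lborel) borel ?T) (\<lambda>x::real^'d. \<Prod>i\<in>UNIV. h i (x $ i)) (\<Prod>i\<in>UNIV. z i)"
    using m by (simp add: has_bochner_integral_iff integrable_distr_eq integral_distr)
  then show ?thesis by (simp only: lborel_eq[symmetric])
qed

lemma has_bochner_integral_lebesgue:
  fixes f :: "'a::euclidean_space \<Rightarrow> complex"
  shows "has_bochner_integral lborel f z \<Longrightarrow> has_bochner_integral lebesgue f z"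
  by (auto simp: has_bochner_integral_iff integrable_completion integral_completion)

text \<open>The transform of a translated Gaussian is the characteristic function of the standard
  normal law after an affine substitution.\<close>

lemma has_bochner_integral_gaussian_real:
  fixes s u \<zeta> :: real
  assumes s: "s > 0"
  shows "has_bochner_integral lborel (\<lambda>y. of_real (exp (- pi * s * (y + u)\<^sup>2)) * cis (2 * pi * (y * \<zeta>)))
    (cis (- 2 * pi * (u * \<zeta>)) * of_real (exp (- pi * \<zeta>\<^sup>2 / s) / sqrt s))"
proof -
  \<comment> \<open>With this \<open>c\<close>, half the square of c (y + u) is pi s (y + u)^2, so
    the substitution produces the standard normal density; \<open>\<tau>\<close> is the frequency
    for which \<open>\<tau> * c\<close> equals 2 pi \<open>\<zeta>\<close>.\<close>
  define c where "c = sqrt (2 * pi * s)"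
  define \<tau> where "\<tau> = 2 * pi * \<zeta> / c"
  have c: "c > 0" "c\<^sup>2 = 2 * pi * s" using s by (auto simp: c_def)
  have [measurable]: "(\<lambda>x. cis (\<tau> * x)) \<in> borel_measurable borel"
    by (intro borel_measurable_continuous_onI continuous_intros)
  have "(\<integral>x. std_normal_density x *\<^sub>R cis (\<tau> * x) \<partial>lborel) = exp (- \<tau>\<^sup>2 / 2)"
    using fun_cong[OF char_std_normal_distribution, of \<tau>]
    by (simp add: char_def integral_density normal_density_nonneg cis_conv_exp)
  moreover have "integrable lborel (\<lambda>x. std_normal_density x *\<^sub>R cis (\<tau> * x))"
    by (rule Bochner_Integration.integrable_bound[of _ std_normal_density]) (auto simp: normal_density_nonneg)
  ultimately have "has_bochner_integral lborel (\<lambda>x. std_normal_density x *\<^sub>R cis (\<tau> * x)) (of_real (exp (- \<tau>\<^sup>2 / 2)))"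
    by (simp add: has_bochner_integral_iff exp_of_real)
  then have "has_bochner_integral lborel (\<lambda>y. std_normal_density (c * u + c * y) *\<^sub>R cis (\<tau> * (c * u + c * y)))
      (of_real (exp (- \<tau>\<^sup>2 / 2)) /\<^sub>R \<bar>c\<bar>)"
    using c by (subst (asm) lborel_has_bochner_integral_real_affine_iff[where c=c and t="c * u"]) auto
  from has_bochner_integral_mult_right[OF this, of "of_real (sqrt (2 * pi)) * cis (- 2 * pi * (u * \<zeta>))"]
  have "has_bochner_integral lborel (\<lambda>y. of_real (sqrt (2 * pi)) * cis (- 2 * pi * (u * \<zeta>)) *
      (std_normal_density (c * u + c * y) *\<^sub>R cis (\<tau> * (c * u + c * y))))
      (of_real (sqrt (2 * pi)) * cis (- 2 * pi * (u * \<zeta>)) * (of_real (exp (- \<tau>\<^sup>2 / 2)) /\<^sub>R \<bar>c\<bar>))" .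
  also have "(\<lambda>y. of_real (sqrt (2 * pi)) * cis (- 2 * pi * (u * \<zeta>)) *
      (std_normal_density (c * u + c * y) *\<^sub>R cis (\<tau> * (c * u + c * y)))) =
    (\<lambda>y. of_real (exp (- pi * s * (y + u)\<^sup>2)) * cis (2 * pi * (y * \<zeta>)))"
  proof
    fix y
    have "(c * u + c * y)\<^sup>2 = 2 * (pi * s * (y + u)\<^sup>2)"
      using c(2) by (simp add: distrib_left[symmetric] power_mult_distrib add.commute)
    then have 1: "sqrt (2 * pi) * std_normal_density (c * u + c * y) = exp (- pi * s * (y + u)\<^sup>2)"
      by (simp add: normal_density_def)
    have "\<tau> * (c * u + c * y) = 2 * pi * (y * \<zeta>) + 2 * pi * (u * \<zeta>)"
      using c(1) by (simp add: \<tau>_def field_simps)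
    then have 2: "cis (- 2 * pi * (u * \<zeta>)) * cis (\<tau> * (c * u + c * y)) = cis (2 * pi * (y * \<zeta>))"
      by (simp add: cis_mult)
    show "of_real (sqrt (2 * pi)) * cis (- 2 * pi * (u * \<zeta>)) *
      (std_normal_density (c * u + c * y) *\<^sub>R cis (\<tau> * (c * u + c * y))) =
      of_real (exp (- pi * s * (y + u)\<^sup>2)) * cis (2 * pi * (y * \<zeta>))"
      unfolding 1[symmetric] 2[symmetric] by (simp add: scaleR_conv_of_real mult_ac)
  qed
  also have "of_real (sqrt (2 * pi)) * cis (- 2 * pi * (u * \<zeta>)) * (of_real (exp (- \<tau>\<^sup>2 / 2)) /\<^sub>R \<bar>c\<bar>)
     = cis (- 2 * pi * (u * \<zeta>)) * of_real (exp (- pi * \<zeta>\<^sup>2 / s) / sqrt s)"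
  proof -
    have "\<tau>\<^sup>2 / 2 = pi * \<zeta>\<^sup>2 / s"
      unfolding \<tau>_def power_divide c(2) using s by (simp add: field_simps power2_eq_square)
    moreover have "sqrt (2 * pi) / c = 1 / sqrt s"
      using s by (simp add: c_def real_sqrt_mult)
    ultimately have "exp (- (\<tau>\<^sup>2 / 2)) * (sqrt (2 * pi) / c) = exp (- (pi * \<zeta>\<^sup>2 / s)) * (1 / sqrt s)"
      by (simp only:)
    then have E: "sqrt (2 * pi) * (exp (- \<tau>\<^sup>2 / 2) / c) = exp (- pi * \<zeta>\<^sup>2 / s) / sqrt s"
      by (simp add: mult_ac)
    have "of_real (sqrt (2 * pi)) * cis (- 2 * pi * (u * \<zeta>)) * (of_real (exp (- \<tau>\<^sup>2 / 2)) /\<^sub>R \<bar>c\<bar>)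
      = cis (- 2 * pi * (u * \<zeta>)) * complex_of_real (sqrt (2 * pi) * (exp (- \<tau>\<^sup>2 / 2) / c))"
    proof -
      have "complex_of_real a * z * (of_real e /\<^sub>R \<bar>c\<bar>) = z * of_real (a * (e / c))" for a e z
        using c(1) by (simp add: scaleR_conv_of_real divide_inverse)
      then show ?thesis .
    qed
    also note E
    finally show ?thesis .
  qed
  finally show ?thesis .
qed

lemma cis_sum: "finite I \<Longrightarrow> cis (\<Sum>i\<in>I. f i) = (\<Prod>i\<in>I. cis (f i))"
  by (induction I rule: finite_induct) (auto simp: cis_mult[symmetric])

lemma norm_vec_sq: "(norm (x::real^'d::finite))\<^sup>2 = (\<Sum>i\<in>UNIV. (x $ i)\<^sup>2)"
  by (simp add: power2_norm_eq_inner inner_vec_def, simp add: power2_eq_square)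

lemma has_bochner_integral_gaussian:
  fixes u \<zeta> :: "real^'d::finite"
  assumes s: "s > 0"
  shows "has_bochner_integral lebesgue
    (\<lambda>y::real^'d. of_real (exp (- pi * s * (norm (y + u))\<^sup>2)) * cis (2 * pi * (y \<bullet> \<zeta>)))
    (cis (- 2 * pi * (u \<bullet> \<zeta>)) * of_real (exp (- pi * (norm \<zeta>)\<^sup>2 / s) / sqrt s ^ CARD('d)))"
proof (rule has_bochner_integral_lebesgue)
  have "has_bochner_integral lborel
     (\<lambda>y::real^'d. \<Prod>i\<in>UNIV. of_real (exp (- pi * s * (y $ i + u $ i)\<^sup>2)) * cis (2 * pi * (y $ i * \<zeta> $ i)))
     (\<Prod>i\<in>UNIV. cis (- 2 * pi * (u $ i * \<zeta> $ i)) * of_real (exp (- pi * (\<zeta> $ i)\<^sup>2 / s) / sqrt s))"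
    by (rule has_bochner_integral_vec_prod[where
      h="\<lambda>i y. of_real (exp (- pi * s * (y + u $ i)\<^sup>2)) * cis (2 * pi * (y * \<zeta> $ i))"])
      (rule has_bochner_integral_gaussian_real[OF s])
  moreover have "(\<Prod>i\<in>UNIV. of_real (exp (- pi * s * (y $ i + u $ i)\<^sup>2)) * cis (2 * pi * (y $ i * \<zeta> $ i)))
     = complex_of_real (exp (- pi * s * (norm (y + u))\<^sup>2)) * cis (2 * pi * (y \<bullet> \<zeta>))" for y :: "real^'d"
    by (simp add: norm_vec_sq inner_vec_def sum_distrib_left cis_sum exp_sum prod.distrib)
  moreover have "(\<Prod>i\<in>UNIV. cis (- 2 * pi * (u $ i * \<zeta> $ i)) * of_real (exp (- pi * (\<zeta> $ i)\<^sup>2 / s) / sqrt s))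
     = cis (- 2 * pi * (u \<bullet> \<zeta>)) * of_real (exp (- pi * (norm \<zeta>)\<^sup>2 / s) / sqrt s ^ CARD('d))"
    by (simp add: norm_vec_sq inner_vec_def sum_distrib_left sum_divide_distrib cis_sum exp_sum prod.distrib prod_dividef
        flip: sum_negf)
  ultimately show "has_bochner_integral lborel
    (\<lambda>y::real^'d. of_real (exp (- pi * s * (norm (y + u))\<^sup>2)) * cis (2 * pi * (y \<bullet> \<zeta>)))
    (cis (- 2 * pi * (u \<bullet> \<zeta>)) * of_real (exp (- pi * (norm \<zeta>)\<^sup>2 / s) / sqrt s ^ CARD('d)))"
    by simp
qed

section \<open>Orthogonality of the characters on the unit cube\<close>

lemma has_bochner_integral_character_real:
  "has_bochner_integral lborel (\<lambda>x. indicator {-1/2..1/2} x *\<^sub>R cis (2 * pi * (x * of_int k)))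
     (if k = 0 then 1 else 0)"
proof (cases "k = 0")
  case True
  have "has_bochner_integral lborel (\<lambda>x. indicator {-1/2..1/2::real} x *\<^sub>R (1::complex)) (measure lborel {-1/2..1/2::real} *\<^sub>R 1)"
    by (rule has_bochner_integral_indicator) auto
  then show ?thesis using True by simp
next
  case False
  define F where "F = (\<lambda>x::real. cis (2 * pi * (x * of_int k)) / (\<i> * (2 * pi * of_int k)))"
  have "has_bochner_integral lborel (\<lambda>x. indicator {-1/2..1/2} x *\<^sub>R cis (2 * pi * (x * of_int k))) (F (1/2) - F (-1/2))"
  proof (rule has_bochner_integral_FTC_Icc)
    fix x :: real
    have "((\<lambda>z. exp (\<i> * (2 * pi * (z * of_int k))) / (\<i> * (2 * pi * of_int k))) has_field_derivative
      exp (\<i> * (2 * pi * (of_real x * of_int k)))) (at (of_real x))"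
      using False by (auto intro!: derivative_eq_intros)
    from has_vector_derivative_real_field[OF this]
    show "(F has_vector_derivative cis (2 * pi * (x * of_int k))) (at x within {- 1/2..1/2})"
      by (simp add: F_def cis_conv_exp)
  qed (auto intro!: continuous_intros)
  \<comment> \<open>The antiderivative agrees at the two end points because \<open>k\<close> is an
    integer.\<close>
  moreover have "cis (2 * pi * (1/2 * of_int k)) = cis (2 * pi * (- 1/2 * of_int k)) * cis (2 * pi * of_int k)"
    by (simp add: cis_mult field_simps)
  then have "F (1/2) = F (-1/2)"
    by (simp add: F_def cis_multiple_2pi)
  ultimately show ?thesis using False by simp
qed

lemma character_prod: "character n x = (\<Prod>i\<in>UNIV. cis (2 * pi * (x $ i * of_int (n $ i))))"
  by (simp add: character_def inner_vec_def sum_distrib_left cis_sum)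

lemma has_bochner_integral_torus:
  fixes h :: "'d::finite \<Rightarrow> real \<Rightarrow> complex"
  assumes "\<And>i. has_bochner_integral lborel (\<lambda>x. indicator {-1/2..1/2} x *\<^sub>R h i x) (z i)"
  shows "has_bochner_integral torus (\<lambda>x::real^'d. \<Prod>i\<in>UNIV. h i (x $ i)) (\<Prod>i\<in>UNIV. z i)"
proof -
  have "has_bochner_integral lebesgue (\<lambda>x::real^'d. \<Prod>i\<in>UNIV. indicator {-1/2..1/2} (x $ i) *\<^sub>R h i (x $ i)) (\<Prod>i\<in>UNIV. z i)"
    by (rule has_bochner_integral_lebesgue[OF has_bochner_integral_vec_prod[where h="\<lambda>i x. indicator {-1/2..1/2} x *\<^sub>R h i x"]]) (rule assms)
  also have "(\<lambda>x::real^'d. \<Prod>i\<in>UNIV. indicator {-1/2..1/2} (x $ i) *\<^sub>R h i (x $ i))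
    = (\<lambda>x. indicator (cbox (\<chi> i. - 1/2) (\<chi> i. 1/2)) x *\<^sub>R (\<Prod>i\<in>UNIV. h i (x $ i)))"
  proof
    fix x :: "real^'d"
    have "(\<Prod>i\<in>UNIV. indicator {-1/2..1/2} (x $ i)) = (indicator (cbox (\<chi> i. - 1/2) (\<chi> i. 1/2)) x :: real)"
      by (auto simp: indicator_def mem_box_cart split: if_splits)
    then show "(\<Prod>i\<in>UNIV. indicator {-1/2..1/2} (x $ i) *\<^sub>R h i (x $ i)) =
      indicator (cbox (\<chi> i. - 1/2) (\<chi> i. 1/2)) x *\<^sub>R (\<Prod>i\<in>UNIV. h i (x $ i))"
      by (simp add: scaleR_conv_of_real prod.distrib flip: of_real_prod)
  qed
  finally show ?thesis
    unfolding torus_def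
    by (auto simp: has_bochner_integral_iff integrable_restrict_space integral_restrict_space)
qed

lemma has_bochner_integral_character:
  fixes n :: "int^'d::finite"
  shows "has_bochner_integral torus (character n) (if n = 0 then 1 else 0)"
proof -
  have "has_bochner_integral torus (\<lambda>x::real^'d. \<Prod>i\<in>UNIV. cis (2 * pi * (x $ i * of_int (n $ i))))
     (\<Prod>i\<in>UNIV. if n $ i = 0 then 1 else 0)"
    by (rule has_bochner_integral_torus[where h="\<lambda>i x. cis (2 * pi * (x * of_int (n $ i)))"])
      (rule has_bochner_integral_character_real)
  moreover have "(\<Prod>i\<in>UNIV. if n $ i = 0 then 1 else 0) = (if n = 0 then 1 else (0::complex))"
    by (auto simp: vec_eq_iff)
  ultimately show ?thesis by (simp add: character_prod[abs_def])
qed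

text \<open>The mass of the cube is read off as the integral of the trivial character.\<close>

lemma emeasure_torus: "emeasure torus (space (torus :: (real^'d::finite) measure)) = 1"
proof -
  have "has_bochner_integral (torus :: (real^'d) measure) (character 0) 1"
    using has_bochner_integral_character[of "0::int^'d"] by simp
  then have "has_bochner_integral (torus :: (real^'d) measure) (\<lambda>_. 1) (1::complex)"
    by (simp add: character_def[abs_def] inner_vec_def)
  then have "(\<integral>x. (1::complex) \<partial>(torus :: (real^'d) measure)) = 1" "integrable (torus :: (real^'d) measure) (\<lambda>_. 1::complex)"
    by (auto simp: has_bochner_integral_iff)
  moreover have "emeasure lborel (cbox (\<chi> i. - 1/2) (\<chi> i. 1/2) :: (real^'d) set) < \<infinity>"
    by (rule emeasure_lborel_cbox_finite)
  then have "finite_measure (torus :: (real^'d) measure)"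
    by (intro finite_measureI) (simp add: torus_def emeasure_restrict_space less_top)
  then interpret finite_measure "torus :: (real^'d) measure" .
  have "measure (torus :: (real^'d) measure) (space torus) = 1"
    using \<open>(\<integral>x. (1::complex) \<partial>(torus :: (real^'d) measure)) = 1\<close> by (simp add: scaleR_conv_of_real)
  then show ?thesis by (simp add: emeasure_eq_measure)
qed

lemma prob_space_torus: "prob_space (torus :: (real^'d::finite) measure)"
  by (rule prob_spaceI[OF emeasure_torus])

lemma norm_character [simp]: "norm (character n x) = 1"
  by (simp add: character_def)

lemma character_mult: "character m x * character n x = character (m + n) x"
proof -
  have "ivec (m + n) = ivec m + (ivec n :: real^'a)" by (simp add: vec_eq_iff)
  then show ?thesis by (simp add: character_def cis_mult inner_add_right distrib_left)
qed

lemma character_add: "character n (x + y) = character n x * character n y"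
  by (simp add: character_def cis_mult inner_add_left distrib_left)

lemma character_minus: "character (- n) x = character n (- x)"
proof -
  have "ivec (- n) = - (ivec n :: real^'a)" by (simp add: vec_eq_iff)
  then show ?thesis by (simp add: character_def)
qed

lemma character_0 [simp]: "character n 0 = 1" "character 0 x = 1"
  by (auto simp: character_def inner_vec_def)

lemma cnj_character: "cnj (character n x) = character n (- x)"
  by (simp add: character_def cis_cnj)

lemma continuous_character [continuous_intros]:
  "continuous_on S g \<Longrightarrow> continuous_on S (\<lambda>x. character n (g x))"
  unfolding character_def by (intro continuous_intros) auto

lemma fourier_coeff_character:
  "fourier_coeff f n = strong_integral torus (\<lambda>x. character (- n) x *\<^sub>C f x)"
proof -
  have "cis (- 2 * pi * (x \<bullet> ivec n)) = character (- n) x" for x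
    unfolding character_minus by (simp add: character_def)
  then show ?thesis by (simp add: fourier_coeff_def)
qed

section \<open>Lattice sums\<close>

lemma sum_vec_prod:
  fixes h :: "'a \<Rightarrow> 'c::comm_semiring_1"
  assumes "finite S"
  shows "(\<Sum>m\<in>{m::'a^'d::finite. \<forall>i. m $ i \<in> S}. \<Prod>i\<in>UNIV. h (m $ i)) = (\<Sum>a\<in>S. h a) ^ CARD('d)"
proof -
  have "(\<Sum>a\<in>S. h a) ^ CARD('d) = (\<Prod>i\<in>(UNIV::'d set). \<Sum>a\<in>S. h a)" by simp
  also have "\<dots> = (\<Sum>g\<in>PiE UNIV (\<lambda>_. S). \<Prod>i\<in>(UNIV::'d set). h (g i))"
    using assms by (intro prod_sum_PiE) auto
  also have "\<dots> = (\<Sum>m\<in>{m::'a^'d. \<forall>i. m $ i \<in> S}. \<Prod>i\<in>UNIV. h (m $ i))"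
    by (rule sum.reindex_bij_witness[of _ "\<lambda>m i. m $ i" "\<lambda>g. \<chi> i. g i"]) auto
  finally show ?thesis by simp
qed

lemma finite_vec_box:
  assumes "finite S"
  shows "finite {m::'a^'d::finite. \<forall>i. m $ i \<in> S}"
proof -
  have "{m::'a^'d. \<forall>i. m $ i \<in> S} \<subseteq> vec_lambda ` (PiE UNIV (\<lambda>_. S))"
  proof
    fix m :: "'a^'d" assume "m \<in> {m. \<forall>i. m $ i \<in> S}"
    then show "m \<in> vec_lambda ` (PiE UNIV (\<lambda>_. S))"
      by (intro image_eqI[of _ _ "\<lambda>i. m $ i"]) auto
  qed
  then show ?thesis by (rule finite_subset) (intro finite_imageI finite_PiE assms, simp)
qed

lemma card_vec_box:
  assumes "finite S"
  shows "card {m::'a^'d::finite. \<forall>i. m $ i \<in> S} = card S ^ CARD('d)"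
  using sum_vec_prod[OF assms, of "\<lambda>_. 1::nat", where 'd='d] by simp

lemma finite_int_vec_bounded:
  assumes "finite (N :: (int^'d::finite) set)"
  obtains L :: int where "L \<ge> 1" "\<And>n i. n \<in> N \<Longrightarrow> \<bar>n $ i\<bar> \<le> L"
proof -
  let ?S = "(\<lambda>(n, i). \<bar>n $ i\<bar>) ` (N \<times> UNIV)"
  have "finite ?S" using assms by auto
  then have "\<forall>k\<in>?S. k \<le> Max (insert 1 ?S)" "1 \<le> Max (insert 1 ?S)" by auto
  then show ?thesis by (intro that[of "Max (insert 1 ?S)"]) auto
qed

text \<open>For integers k^2 is at least |k|, so each coordinate factor is at most
  \<open>r ^ nat \<bar>k\<bar>\<close>, and the lattice sum is at most the d-th power of a two-sided
  geometric series. Each of its halves is at most 1/(1 - r), whence the constant.\<close>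

lemma lattice_gaussian_sum_bounded:
  assumes "\<alpha> > (0::real)"
  obtains \<Gamma> where "\<Gamma> > 0" "\<And>N :: (int^'d::finite) set. finite N \<Longrightarrow> (\<Sum>m\<in>N. exp (- \<alpha> * (norm (ivec m))\<^sup>2)) \<le> \<Gamma>"
proof -
  define r where "r = exp (- \<alpha>)"
  have r: "0 < r" "r < 1" using assms by (auto simp: r_def)
  have one: "(\<Sum>k\<in>{-L..L}. r ^ nat \<bar>k\<bar>) \<le> 2 / (1 - r)" for L :: int
  proof (cases "L \<ge> 0")
    case True
    have nat: "(\<Sum>k\<in>{0..L}. r ^ nat k) \<le> 1 / (1 - r)"
    proof -
      have "(\<Sum>k\<in>{0..L}. r ^ nat k) = (\<Sum>j\<in>{..nat L}. r ^ j)"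
        by (rule sum.reindex_bij_witness[of _ int nat]) (use True in auto)
      also have "\<dots> \<le> (\<Sum>j. r ^ j)"
        by (rule sum_le_suminf) (use r in \<open>auto intro: complete_algebra_summable_geometric\<close>)
      also have "\<dots> = 1 / (1 - r)" using r by (intro suminf_geometric) auto
      finally show ?thesis .
    qed
    have neg: "(\<Sum>k\<in>{-L..0}. r ^ nat \<bar>k\<bar>) = (\<Sum>k\<in>{0..L}. r ^ nat k)"
      by (rule sum.reindex_bij_witness[of _ uminus uminus]) auto
    have "(\<Sum>k\<in>{-L..L}. r ^ nat \<bar>k\<bar>) \<le> (\<Sum>k\<in>{-L..0}. r ^ nat \<bar>k\<bar>) + (\<Sum>k\<in>{0..L}. r ^ nat \<bar>k\<bar>)"
    proof -
      have "{-L..L} = {-L..0} \<union> {0..L}" using True by auto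
      then show ?thesis
        using sum.union_inter[of "{-L..0}" "{0..L}" "\<lambda>k. r ^ nat \<bar>k\<bar>"] r
          sum_nonneg[of "{-L..0} \<inter> {0..L}" "\<lambda>k. r ^ nat \<bar>k\<bar>"] by simp
    qed
    also have "(\<Sum>k\<in>{0..L}. r ^ nat \<bar>k\<bar>) = (\<Sum>k\<in>{0..L}. r ^ nat k)"
      by (rule sum.cong) auto
    finally show ?thesis using nat neg by simp
  next
    case False
    then have "{-L..L} = {}" by auto
    then show ?thesis using r by simp
  qed
  have "(\<Sum>m\<in>N. exp (- \<alpha> * (norm (ivec m))\<^sup>2)) \<le> (2 / (1 - r)) ^ CARD('d)"
    if N: "finite N" for N :: "(int^'d) set"
  proof -
    obtain L :: int where L: "\<And>n i. n \<in> N \<Longrightarrow> \<bar>n $ i\<bar> \<le> L"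
      using finite_int_vec_bounded[OF N] by blast
    have le: "exp (- \<alpha> * (norm (ivec m))\<^sup>2) \<le> (\<Prod>i\<in>UNIV. r ^ nat \<bar>m $ i\<bar>)" for m :: "int^'d"
    proof -
      have "real (nat \<bar>k\<bar>) \<le> (of_int k)\<^sup>2" for k :: int
      proof -
        have "\<bar>k\<bar> \<le> k\<^sup>2"
        proof (cases "k = 0")
          case False
          then have "1 * \<bar>k\<bar> \<le> \<bar>k\<bar> * \<bar>k\<bar>" by (intro mult_right_mono) linarith+
          then show ?thesis by (simp add: power2_eq_square)
        qed simp
        then have "real_of_int \<bar>k\<bar> \<le> of_int (k\<^sup>2)" by (simp only: of_int_le_iff)
        then show ?thesis by simp
      qed
      then have "(\<Sum>i\<in>UNIV. real (nat \<bar>m $ i\<bar>)) \<le> (norm (ivec m :: real^'d))\<^sup>2"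
        unfolding norm_vec_sq by (intro sum_mono) simp
      then have "exp (- \<alpha> * (norm (ivec m :: real^'d))\<^sup>2) \<le> exp (- \<alpha> * (\<Sum>i\<in>UNIV. real (nat \<bar>m $ i\<bar>)))"
        using assms by simp
      also have "\<dots> = (\<Prod>i\<in>UNIV. r ^ nat \<bar>m $ i\<bar>)"
        by (simp add: sum_distrib_left exp_sum r_def exp_of_nat_mult[symmetric] mult.commute flip: sum_negf)
      finally show ?thesis .
    qed
    have "(\<Sum>m\<in>N. exp (- \<alpha> * (norm (ivec m))\<^sup>2)) \<le> (\<Sum>m\<in>N. \<Prod>i\<in>UNIV. r ^ nat \<bar>m $ i\<bar>)"
      by (intro sum_mono le)
    also have "\<dots> \<le> (\<Sum>m\<in>{m::int^'d. \<forall>i. m $ i \<in> {-L..L}}. \<Prod>i\<in>UNIV. r ^ nat \<bar>m $ i\<bar>)"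
    proof (rule sum_mono2)
      show "finite {m::int^'d. \<forall>i. m $ i \<in> {-L..L}}" by (rule finite_vec_box) simp
      show "N \<subseteq> {m. \<forall>i. m $ i \<in> {-L..L}}"
      proof
        fix m assume "m \<in> N"
        then have "\<bar>m $ i\<bar> \<le> L" for i by (rule L)
        then have "- L \<le> m $ i" "m $ i \<le> L" for i by (smt (verit))+
        then show "m \<in> {m. \<forall>i. m $ i \<in> {-L..L}}" by simp
      qed
      show "0 \<le> (\<Prod>i\<in>UNIV. r ^ nat \<bar>b $ i\<bar>)" for b :: "int^'d"
        using r by (intro prod_nonneg) simp
    qed
    also have "\<dots> = (\<Sum>k\<in>{-L..L}. r ^ nat \<bar>k\<bar>) ^ CARD('d)"
      by (rule sum_vec_prod) simp
    also have "\<dots> \<le> (2 / (1 - r)) ^ CARD('d)"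
      using one r by (intro power_mono sum_nonneg) auto
    finally show ?thesis .
  qed
  then show ?thesis using r by (intro that[of "(2 / (1 - r)) ^ CARD('d)"]) auto
qed

lemma norm_ivec_ge_1:
  assumes "(m :: int^'d::finite) \<noteq> 0"
  shows "1 \<le> (norm (ivec m :: real^'d))\<^sup>2"
proof -
  obtain i where "m $ i \<noteq> 0" using assms by (auto simp: vec_eq_iff)
  then have "1 \<le> \<bar>m $ i\<bar>" by linarith
  then have "1 \<le> (m $ i)\<^sup>2" by (metis abs_le_square_iff abs_1 one_power2)
  then have "1 \<le> (of_int (m $ i) :: real)\<^sup>2" by (simp flip: of_int_power)
  also have "\<dots> \<le> (\<Sum>i\<in>UNIV. (of_int (m $ i))\<^sup>2)"
    by (rule member_le_sum) auto
  finally show ?thesis by (simp add: norm_vec_sq)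
qed

text \<open>Away from the origin the squared norm is at least 1, so raising the exponent from 1 to 1
  + b gains a factor exp(-b) over the sum for exponent 1. The number \<open>b\<close> is chosen so
  that this factor times \<open>\<Gamma>\<close> is at most \<open>\<epsilon>\<close>.\<close>

lemma lattice_gaussian_sum_small:
  assumes "\<epsilon> > (0::real)"
  obtains \<alpha> where "\<alpha> > (0::real)"
    "\<And>N :: (int^'d::finite) set. finite N \<Longrightarrow> 0 \<notin> N \<Longrightarrow> (\<Sum>m\<in>N. exp (- \<alpha> * (norm (ivec m))\<^sup>2)) \<le> \<epsilon>"
proof -
  obtain \<Gamma> where \<Gamma>: "\<Gamma> > 0" "\<And>N :: (int^'d) set. finite N \<Longrightarrow> (\<Sum>m\<in>N. exp (- 1 * (norm (ivec m))\<^sup>2)) \<le> \<Gamma>"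
    by (rule lattice_gaussian_sum_bounded[of 1, where 'd='d]) auto
  define b where "b = max 1 (- ln (\<epsilon> / \<Gamma>))"
  have b: "b > 0" "exp (- b) \<le> \<epsilon> / \<Gamma>"
  proof -
    have "exp (- b) \<le> exp (ln (\<epsilon> / \<Gamma>))" by (auto simp: b_def)
    then show "exp (- b) \<le> \<epsilon> / \<Gamma>" using assms \<Gamma>(1) by simp
  qed (simp add: b_def)
  have "(\<Sum>m\<in>N. exp (- (1 + b) * (norm (ivec m))\<^sup>2)) \<le> \<epsilon>"
    if N: "finite N" "0 \<notin> N" for N :: "(int^'d) set"
  proof -
    have "exp (- (1 + b) * (norm (ivec m))\<^sup>2) \<le> exp (- b) * exp (- 1 * (norm (ivec m))\<^sup>2)" if "m \<in> N" for m :: "int^'d"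
    proof -
      have "1 \<le> (norm (ivec m :: real^'d))\<^sup>2" by (rule norm_ivec_ge_1) (use that N in auto)
      then have "b * 1 \<le> b * (norm (ivec m :: real^'d))\<^sup>2" using b by (intro mult_left_mono) auto
      then have "- (1 + b) * (norm (ivec m :: real^'d))\<^sup>2 \<le> - b + - 1 * (norm (ivec m :: real^'d))\<^sup>2"
        by (simp add: algebra_simps)
      then show ?thesis unfolding mult_exp_exp by (subst exp_le_cancel_iff)
    qed
    then have "(\<Sum>m\<in>N. exp (- (1 + b) * (norm (ivec m))\<^sup>2)) \<le> exp (- b) * (\<Sum>m\<in>N. exp (- 1 * (norm (ivec m))\<^sup>2))"
      unfolding sum_distrib_left by (rule sum_mono)
    also have "\<dots> \<le> \<epsilon> / \<Gamma> * \<Gamma>"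
    proof (rule mult_mono)
      show "(\<Sum>m\<in>N. exp (- 1 * (norm (ivec m :: real^'d))\<^sup>2)) \<le> \<Gamma>" by (rule \<Gamma>(2)[OF N(1)])
    qed (use b \<Gamma>(1) assms in \<open>auto intro!: sum_nonneg\<close>)
    also have "\<dots> = \<epsilon>" using \<Gamma>(1) by simp
    finally show ?thesis .
  qed
  then show ?thesis using b by (intro that[of "1 + b"]) auto
qed

section \<open>Gaussian test functions\<close>

text \<open>Polynomials times modulated Gaussian translates, with a common decay rate
  \<open>\<alpha>\<close>. The real linear term \<open>\<beta>\<close> encodes translations and the
  imaginary one \<open>\<gamma>\<close> modulations; the rule \<open>coord\<close> is there because
  differentiating a Gaussian creates coordinate factors.\<close>

inductive gauss_poly :: "real \<Rightarrow> (real^'d::finite \<Rightarrow> 'x::complex_banach) \<Rightarrow> bool" for \<alpha> where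
  base: "gauss_poly \<alpha> (\<lambda>x. exp (of_real (\<beta> \<bullet> x - \<alpha> * (x \<bullet> x)) + \<i> * of_real (\<gamma> \<bullet> x)) *\<^sub>C v)"
| add: "gauss_poly \<alpha> g \<Longrightarrow> gauss_poly \<alpha> h \<Longrightarrow> gauss_poly \<alpha> (\<lambda>x. g x + h x)"
| coord: "gauss_poly \<alpha> g \<Longrightarrow> gauss_poly \<alpha> (\<lambda>x. (x $ i) *\<^sub>R g x)"
| scale: "gauss_poly \<alpha> g \<Longrightarrow> gauss_poly \<alpha> (\<lambda>x. c *\<^sub>C g x)"

lemma gauss_poly_scaleR: "gauss_poly \<alpha> g \<Longrightarrow> gauss_poly \<alpha> (\<lambda>x. r *\<^sub>R g x)"
  using gauss_poly.scale[of \<alpha> g "of_real r"] by (simp add: scaleC_of_real)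

lemma gauss_poly_zero: "gauss_poly \<alpha> (\<lambda>x. 0)"
  using gauss_poly_scaleR[OF gauss_poly.base[of \<alpha> 0 0 0], of 0] by simp

lemma gauss_poly_sum: "(\<And>i. i \<in> I \<Longrightarrow> gauss_poly \<alpha> (g i)) \<Longrightarrow> gauss_poly \<alpha> (\<lambda>x. \<Sum>i\<in>I. g i x)"
  by (induction I rule: infinite_finite_induct) (auto intro: gauss_poly_zero gauss_poly.add)

text \<open>Differentiating a base function multiplies it by an affine function of \<open>x\<close>,
  and the product rule keeps coordinate factors in the class. The class is therefore stable under
  all iterated partial derivatives, which is what the definition of \<open>schwartz\<close> asks
  about.\<close>

lemma gauss_poly_derivative:
  assumes "gauss_poly \<alpha> g"
  shows "\<exists>g'. (\<forall>x. (g has_derivative g' x) (at x)) \<and> (\<forall>j. gauss_poly \<alpha> (\<lambda>x. g' x (axis j 1)))"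
  using assms
proof induction
  case (base \<beta> \<gamma> v)
  let ?e = "\<lambda>x. exp (complex_of_real (\<beta> \<bullet> x - \<alpha> * (x \<bullet> x)) + \<i> * of_real (\<gamma> \<bullet> x))"
  let ?d = "\<lambda>x h. complex_of_real (\<beta> \<bullet> h - \<alpha> * (2 * (x \<bullet> h))) + \<i> * of_real (\<gamma> \<bullet> h)"
  have der: "((\<lambda>x. ?e x *\<^sub>C v) has_derivative (\<lambda>h. (?e x * ?d x h) *\<^sub>C v)) (at x)" for x
  proof (rule bounded_linear.has_derivative[OF scaleC.bounded_linear_left])
    have "((\<lambda>x. complex_of_real (\<beta> \<bullet> x - \<alpha> * (x \<bullet> x)) + \<i> * of_real (\<gamma> \<bullet> x)) has_derivative ?d x) (at x)"
      by (auto intro!: derivative_eq_intros simp: inner_commute algebra_simps)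
    moreover have "(exp has_derivative (\<lambda>h. exp z * h)) (at z)" for z :: complex
      using DERIV_exp[of z] by (simp add: has_field_derivative_def)
    ultimately show "((\<lambda>x. ?e x) has_derivative (\<lambda>h. ?e x * ?d x h)) (at x)"
      by (rule has_derivative_compose)
  qed
  have "gauss_poly \<alpha> (\<lambda>x. (?e x * ?d x (axis j 1)) *\<^sub>C v)" for j
  proof -
    have "gauss_poly \<alpha> (\<lambda>x. (complex_of_real (\<beta> $ j) + \<i> * of_real (\<gamma> $ j)) *\<^sub>C ?e x *\<^sub>C v
        + (- 2 * \<alpha>) *\<^sub>R (x $ j) *\<^sub>R ?e x *\<^sub>C v)"
      by (intro gauss_poly.add gauss_poly.scale gauss_poly_scaleR gauss_poly.coord gauss_poly.base)
    also have "(\<lambda>x. (complex_of_real (\<beta> $ j) + \<i> * of_real (\<gamma> $ j)) *\<^sub>C ?e x *\<^sub>C v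
        + (- 2 * \<alpha>) *\<^sub>R (x $ j) *\<^sub>R ?e x *\<^sub>C v) = (\<lambda>x. (?e x * ?d x (axis j 1)) *\<^sub>C v)"
    proof
      fix x
      have "w *\<^sub>C z *\<^sub>C v + a *\<^sub>R b *\<^sub>R z *\<^sub>C v = (w * z + of_real (a * b) * z) *\<^sub>C v" for w z a b
        by (simp only: scaleC_of_real[symmetric] scaleC_scaleC scaleC_add_left of_real_mult mult.assoc)
      then have "(complex_of_real (\<beta> $ j) + \<i> * of_real (\<gamma> $ j)) *\<^sub>C ?e x *\<^sub>C v
        + (- 2 * \<alpha>) *\<^sub>R (x $ j) *\<^sub>R ?e x *\<^sub>C v =
        ((complex_of_real (\<beta> $ j) + \<i> * of_real (\<gamma> $ j)) * ?e x + of_real ((- 2 * \<alpha>) * (x $ j)) * ?e x) *\<^sub>C v" .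
      also have "(complex_of_real (\<beta> $ j) + \<i> * of_real (\<gamma> $ j)) * ?e x + of_real ((- 2 * \<alpha>) * (x $ j)) * ?e x
        = ?e x * ?d x (axis j 1)"
        by (simp add: inner_axis' inner_axis algebra_simps)
      finally show "(complex_of_real (\<beta> $ j) + \<i> * of_real (\<gamma> $ j)) *\<^sub>C ?e x *\<^sub>C v
        + (- 2 * \<alpha>) *\<^sub>R (x $ j) *\<^sub>R ?e x *\<^sub>C v = (?e x * ?d x (axis j 1)) *\<^sub>C v" .
    qed
    finally show ?thesis .
  qed
  with der show ?case by (intro exI[of _ "\<lambda>x h. (?e x * ?d x h) *\<^sub>C v"]) blast
next
  case (add g h)
  then obtain g' h' where g': "\<And>x. (g has_derivative g' x) (at x)" "\<And>j. gauss_poly \<alpha> (\<lambda>x. g' x (axis j 1))"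
    and h': "\<And>x. (h has_derivative h' x) (at x)" "\<And>j. gauss_poly \<alpha> (\<lambda>x. h' x (axis j 1))"
    by blast
  then show ?case
    by (intro exI[of _ "\<lambda>x k. g' x k + h' x k"]) (auto intro: has_derivative_add gauss_poly.add)
next
  case (coord g i)
  then obtain g' where g': "\<And>x. (g has_derivative g' x) (at x)" "\<And>j. gauss_poly \<alpha> (\<lambda>x. g' x (axis j 1))"
    by blast
  have "((\<lambda>x. (x $ i) *\<^sub>R g x) has_derivative (\<lambda>k. (x $ i) *\<^sub>R g' x k + (k $ i) *\<^sub>R g x)) (at x)" for x
    by (rule has_derivative_scaleR[OF bounded_linear.has_derivative[OF bounded_linear_vec_nth has_derivative_ident] g'(1)])
  moreover have "gauss_poly \<alpha> (\<lambda>x. (x $ i) *\<^sub>R g' x (axis j 1) + (axis j 1 $ i) *\<^sub>R g x)" for j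
    by (intro gauss_poly.add gauss_poly.coord gauss_poly_scaleR g' coord)
  ultimately show ?case
    by (intro exI[of _ "\<lambda>x k. (x $ i) *\<^sub>R g' x k + (k $ i) *\<^sub>R g x"]) blast
next
  case (scale g c)
  then obtain g' where g': "\<And>x. (g has_derivative g' x) (at x)" "\<And>j. gauss_poly \<alpha> (\<lambda>x. g' x (axis j 1))"
    by blast
  then show ?case
    by (intro exI[of _ "\<lambda>x k. c *\<^sub>C g' x k"])
      (auto intro!: bounded_linear.has_derivative[OF scaleC.bounded_linear_right] gauss_poly.scale)
qed

text \<open>The induction generalises over \<open>k\<close> because a coordinate factor costs one
  power of \<open>norm x\<close>. For a base function, r^k is at most k! exp(r), and completing the
  square in the remaining exponent gives the constant.\<close>

lemma gauss_poly_decay: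
  fixes k :: nat
  assumes "gauss_poly \<alpha> g" "\<alpha> > 0"
  shows "\<exists>B. \<forall>x. norm x ^ k * norm (g x) \<le> B"
  using assms(1)
proof (induction arbitrary: k)
  case (base \<beta> \<gamma> v)
  have "norm x ^ k * norm (exp (complex_of_real (\<beta> \<bullet> x - \<alpha> * (x \<bullet> x)) + \<i> * of_real (\<gamma> \<bullet> x)) *\<^sub>C v)
     \<le> fact k * exp ((norm \<beta> + 1)\<^sup>2 / (4 * \<alpha>)) * norm v" for x
  proof -
    define r where "r = norm x"
    have r: "r \<ge> 0" by (simp add: r_def)
    have "r ^ k \<le> fact k * exp r"
    proof -
      have "r ^ k /\<^sub>R fact k \<le> (\<Sum>j. r ^ j /\<^sub>R fact j)"
        using sum_le_suminf[OF summable_exp_generic[of r], of "{k}"] r by simp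
      then show ?thesis by (simp add: exp_def field_simps)
    qed
    moreover have "\<beta> \<bullet> x \<le> norm \<beta> * r" unfolding r_def by (rule norm_cauchy_schwarz)
    then have "exp (\<beta> \<bullet> x - \<alpha> * (x \<bullet> x)) \<le> exp (norm \<beta> * r - \<alpha> * r\<^sup>2)"
      by (simp add: r_def power2_norm_eq_inner)
    ultimately have "r ^ k * exp (\<beta> \<bullet> x - \<alpha> * (x \<bullet> x)) \<le> (fact k * exp r) * exp (norm \<beta> * r - \<alpha> * r\<^sup>2)"
      using r by (intro mult_mono) auto
    also have "\<dots> = fact k * exp (r + (norm \<beta> * r - \<alpha> * r\<^sup>2))" by (simp add: exp_add)
    also have "\<dots> \<le> fact k * exp ((norm \<beta> + 1)\<^sup>2 / (4 * \<alpha>))"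
    proof -
      have "0 \<le> (2 * \<alpha> * r - (norm \<beta> + 1))\<^sup>2 / (4 * \<alpha>)" using assms(2) by simp
      also have "\<dots> = (norm \<beta> + 1)\<^sup>2 / (4 * \<alpha>) - (r + (norm \<beta> * r - \<alpha> * r\<^sup>2))"
        using assms(2) by (simp add: field_simps power2_eq_square)
      finally show ?thesis by simp
    qed
    finally have "r ^ k * exp (\<beta> \<bullet> x - \<alpha> * (x \<bullet> x)) * norm v \<le> fact k * exp ((norm \<beta> + 1)\<^sup>2 / (4 * \<alpha>)) * norm v"
      by (rule mult_right_mono) simp
    then show ?thesis by (simp add: norm_scaleC r_def mult.assoc)
  qed
  then show ?case by blast
next
  case (add g h)
  obtain B C where "\<And>x. norm x ^ k * norm (g x) \<le> B" "\<And>x. norm x ^ k * norm (h x) \<le> C"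
    using add.IH by metis
  then have "norm x ^ k * norm (g x + h x) \<le> B + C" for x
    using mult_left_mono[OF norm_triangle_ineq[of "g x" "h x"], of "norm x ^ k"]
    by (smt (verit) distrib_left norm_ge_zero zero_le_power)
  then show ?case by blast
next
  case (coord g i)
  obtain B where B: "\<And>x. norm x ^ Suc k * norm (g x) \<le> B"
    using coord.IH by metis
  have "norm x ^ k * norm ((x $ i) *\<^sub>R g x) \<le> B" for x
  proof -
    have "norm x ^ k * norm ((x $ i) *\<^sub>R g x) = \<bar>x $ i\<bar> * (norm x ^ k * norm (g x))" by simp
    also have "\<dots> \<le> norm x * (norm x ^ k * norm (g x))"
      by (intro mult_right_mono component_le_norm_cart) simp
    also have "\<dots> \<le> B" using B[of x] by (simp add: mult.assoc)
    finally show ?thesis .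
  qed
  then show ?case by blast
next
  case (scale g c)
  obtain B where B: "\<And>x. norm x ^ k * norm (g x) \<le> B"
    using scale.IH by metis
  have "norm x ^ k * norm (c *\<^sub>C g x) \<le> cmod c * B" for x
    using mult_left_mono[OF B[of x], of "cmod c"] by (simp add: norm_scaleC mult_ac)
  then show ?case by blast
qed

lemma schwartz_gauss_poly:
  assumes "gauss_poly \<alpha> g" "\<alpha> > 0"
  shows "schwartz g"
proof -
  have iter: "gauss_poly \<alpha> (iterated_partial js g)" for js
  proof (induction js)
    case Nil
    then show ?case using assms by (simp add: iterated_partial_def)
  next
    case (Cons j js)
    obtain g' where g': "\<And>x. (iterated_partial js g has_derivative g' x) (at x)"
      "\<And>j. gauss_poly \<alpha> (\<lambda>x. g' x (axis j 1))"
      using gauss_poly_derivative[OF Cons] by blast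
    have "iterated_partial (j # js) g = (\<lambda>x. g' x (axis j 1))"
      using frechet_derivative_at[OF g'(1)] by (simp add: iterated_partial_def partial_deriv_def fun_eq_iff)
    with g'(2) show ?case by simp
  qed
  show ?thesis
    unfolding schwartz_def
    using gauss_poly_derivative[OF iter] gauss_poly_decay[OF iter assms(2)]
    by (meson differentiableI)
qed

section \<open>Consequences of Fourier type for test functions\<close>

text \<open>Fourier type in terms of integrals of powers instead of their roots. Raising the
  inequality to the power p' turns the root 1/p into p'/p = 1/(p - 1), and a real bound
  \<open>y\<close> on the right-hand side removes infinite values from all later estimates.\<close>

lemma fourier_type_schwartz:
  assumes "nontrivial_fourier_type TYPE('d::finite) TYPE('x::complex_banach)"
  obtains p D :: real where "1 < p" "p \<le> 2" "0 < D"
    "\<And>(f :: real^'d \<Rightarrow> 'x) y. schwartz f \<Longrightarrow> 0 \<le> y \<Longrightarrow> (\<integral>\<^sup>+x. ennreal (norm (f x) powr p) \<partial>lebesgue) \<le> ennreal y \<Longrightarrow>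
      (\<integral>\<^sup>+x. ennreal (norm (fourier_transform f x) powr (p / (p - 1))) \<partial>lebesgue)
        \<le> ennreal (D * y powr (1 / (p - 1)))"
proof -
  obtain p C where p: "1 < p" "p \<le> 2" and C: "\<And>f :: real^'d \<Rightarrow> 'x. schwartz f \<Longrightarrow>
          Lp_norm (p / (p - 1)) lebesgue (fourier_transform f) \<le> ennreal C * Lp_norm p lebesgue f"
    using assms unfolding nontrivial_fourier_type_def by blast
  define r where "r = p / (p - 1)"
  have r: "r > 0" "r / p = 1 / (p - 1)" using p by (auto simp: r_def)
  \<comment> \<open>The maximum keeps \<open>D\<close> positive for every sign of
    \<open>C\<close>.\<close>
  define D where "D = max C 1 powr r"
  have "(\<integral>\<^sup>+x. ennreal (norm (fourier_transform f x) powr r) \<partial>lebesgue) \<le> ennreal (D * y powr (1 / (p - 1)))"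
    if f: "schwartz f" and y: "0 \<le> y" "(\<integral>\<^sup>+x. ennreal (norm (f x) powr p) \<partial>lebesgue) \<le> ennreal y"
    for f :: "real^'d \<Rightarrow> 'x" and y
  proof -
    let ?I = "\<integral>\<^sup>+x. ennreal (norm (f x) powr p) \<partial>lebesgue"
    let ?J = "\<integral>\<^sup>+x. ennreal (norm (fourier_transform f x) powr r) \<partial>lebesgue"
    have I: "?I < top" using y(2) by (rule le_less_trans) simp
    have "epowr ?J (1 / r) \<le> ennreal C * epowr ?I (1 / p)"
      using C[OF f] by (simp add: Lp_norm_def r_def)
    also have "\<dots> \<le> ennreal (max C 1) * ennreal (y powr (1 / p))"
      using I y p by (intro mult_mono) (auto simp: epowr_def intro!: ennreal_leI powr_mono2 enn2real_leI)
    also have "\<dots> = ennreal (max C 1 * y powr (1 / p))"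
      by (simp add: ennreal_mult')
    finally have le: "epowr ?J (1 / r) \<le> ennreal (max C 1 * y powr (1 / p))" .
    then have J: "?J \<noteq> top" by (auto simp: epowr_def top_unique)
    define j where "j = enn2real ?J"
    have j: "?J = ennreal j" "j \<ge> 0" using J by (auto simp: j_def less_top)
    have "j powr (1 / r) \<le> max C 1 * y powr (1 / p)"
      using le j by (simp add: epowr_def)
    then have "(j powr (1 / r)) powr r \<le> (max C 1 * y powr (1 / p)) powr r"
      using r by (intro powr_mono2) auto
    moreover have "(j powr (1 / r)) powr r = j"
      using r(1) j(2) by (simp add: powr_powr)
    moreover have "(max C 1 * y powr (1 / p)) powr r = D * y powr (r / p)"
      by (simp add: powr_powr powr_mult D_def)
    ultimately have "j \<le> D * y powr (1 / (p - 1))"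
      unfolding r(2) by simp
    then show ?thesis using j by (simp add: ennreal_leI)
  qed
  then show ?thesis using p by (intro that[of p D]) (auto simp: D_def r_def)
qed

section \<open>Power means\<close>

text \<open>Hoelder's inequality for the measure with density \<open>w\<close>, of mass at most
  \<open>W\<close>. It follows from Young's inequality pointwise, at the scale
  \<open>l = B / W\<close> that balances the two terms: they integrate to at most B/r and (1 - 1/r)
  B. If \<open>T = 0\<close> the scale would vanish, but then the integrand is zero almost
  everywhere.\<close>

lemma nn_integral_power_mean:
  fixes h w :: "'a \<Rightarrow> real"
  assumes r: "r > 1" and [measurable]: "h \<in> borel_measurable M" "w \<in> borel_measurable M"
    and nn: "\<And>x. 0 \<le> h x" "\<And>x. 0 \<le> w x" and W: "0 < W" "(\<integral>\<^sup>+x. ennreal (w x) \<partial>M) \<le> ennreal W"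
    and T: "0 \<le> T" "(\<integral>\<^sup>+x. ennreal (h x powr r * w x) \<partial>M) \<le> ennreal T"
  shows "(\<integral>\<^sup>+x. ennreal (h x * w x) \<partial>M) \<le> ennreal ((W powr (r - 1) * T) powr (1 / r))"
proof (cases "T = 0")
  case True
  then have "(\<integral>\<^sup>+x. ennreal (h x powr r * w x) \<partial>M) = 0" using T by simp
  then have "AE x in M. ennreal (h x powr r * w x) = 0"
    by (subst (asm) nn_integral_0_iff_AE) auto
  then have "AE x in M. ennreal (h x * w x) = 0"
    by eventually_elim (use nn in \<open>auto simp: ennreal_eq_0_iff mult_le_0_iff\<close>)
  then have "(\<integral>\<^sup>+x. ennreal (h x * w x) \<partial>M) = 0"
    by (subst nn_integral_0_iff_AE) auto
  then show ?thesis by simp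
next
  case False
  define B where "B = (W powr (r - 1) * T) powr (1 / r)"
  have B: "B > 0" "B powr r = W powr (r - 1) * T" using False T W r by (auto simp: B_def powr_powr)
  define l where "l = B / W"
  have l0: "l > 0" using B W by (simp add: l_def)
  have young: "a \<le> l powr (1 - r) / r * a powr r + (1 - 1 / r) * l" if "a \<ge> 0" for a
  proof -
    have "a * l powr (r - 1) \<le> a powr r / r + (l powr (r - 1)) powr (r / (r - 1)) / (r / (r - 1))"
      by (rule Youngs_inequality) (use r that l0 in \<open>auto simp: field_simps\<close>)
    also have "(l powr (r - 1)) powr (r / (r - 1)) = l powr r" using r by (simp add: powr_powr)
    also have "l powr r / (r / (r - 1)) = (1 - 1 / r) * l * l powr (r - 1)"
      using r l0 by (simp add: powr_diff field_simps)
    finally have "(a * l powr (r - 1)) * l powr (1 - r) \<le> (a powr r / r + (1 - 1 / r) * l * l powr (r - 1)) * l powr (1 - r)"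
      by (rule mult_right_mono) simp
    moreover have "l powr (r - 1) * l powr (1 - r) = 1" using l0 by (simp flip: powr_add)
    ultimately show ?thesis by (simp add: distrib_right mult.assoc) (simp add: mult_ac)
  qed
  have "(\<integral>\<^sup>+x. ennreal (h x * w x) \<partial>M)
      \<le> (\<integral>\<^sup>+x. ennreal (l powr (1 - r) / r) * ennreal (h x powr r * w x) + ennreal ((1 - 1 / r) * l) * ennreal (w x) \<partial>M)"
  proof (rule nn_integral_mono)
    fix x
    have "h x * w x \<le> (l powr (1 - r) / r * h x powr r + (1 - 1 / r) * l) * w x"
      by (intro mult_right_mono young nn)
    also have "\<dots> = l powr (1 - r) / r * (h x powr r * w x) + (1 - 1 / r) * l * w x"
      by (simp add: algebra_simps)
    finally show "ennreal (h x * w x) \<le> ennreal (l powr (1 - r) / r) * ennreal (h x powr r * w x)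
      + ennreal ((1 - 1 / r) * l) * ennreal (w x)"
      using r l0 nn by (simp flip: ennreal_mult ennreal_plus)
  qed
  also have "\<dots> = ennreal (l powr (1 - r) / r) * (\<integral>\<^sup>+x. ennreal (h x powr r * w x) \<partial>M)
      + ennreal ((1 - 1 / r) * l) * (\<integral>\<^sup>+x. ennreal (w x) \<partial>M)"
    by (simp add: nn_integral_add nn_integral_cmult)
  also have "\<dots> \<le> ennreal (l powr (1 - r) / r) * ennreal T + ennreal ((1 - 1 / r) * l) * ennreal W"
    by (intro add_mono mult_left_mono T W) auto
  also have "\<dots> = ennreal (l powr (1 - r) / r * T + (1 - 1 / r) * l * W)"
    using r l0 T W by (simp flip: ennreal_mult ennreal_plus)
  also have "l powr (1 - r) / r * T + (1 - 1 / r) * l * W = B"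
  proof -
    have "l powr (1 - r) * T = B powr (1 - r) * (W powr (r - 1) * T)"
      using B(1) W(1) by (simp add: l_def powr_divide powr_diff field_simps)
    also have "\<dots> = B" using B by (simp flip: B(2) powr_add)
    finally have "l powr (1 - r) / r * T = B / r" by simp
    moreover have "l * W = B" using W by (simp add: l_def)
    ultimately show ?thesis using r by (simp add: field_simps)
  qed
  finally show ?thesis by (simp add: B_def)
qed

lemma sum_power_mean:
  fixes a w :: "'i \<Rightarrow> real"
  assumes r: "r > 1" and "finite I" and nn: "\<And>i. 0 \<le> a i" "\<And>i. 0 \<le> w i"
    and W: "0 < W" "(\<Sum>i\<in>I. w i) \<le> W"
  shows "(\<Sum>i\<in>I. a i * w i) powr r \<le> W powr (r - 1) * (\<Sum>i\<in>I. a i powr r * w i)"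
proof -
  have T: "0 \<le> (\<Sum>i\<in>I. a i powr r * w i)" using nn by (intro sum_nonneg) auto
  have "(\<integral>\<^sup>+i. ennreal (a i * w i) \<partial>count_space I) \<le> ennreal ((W powr (r - 1) * (\<Sum>i\<in>I. a i powr r * w i)) powr (1 / r))"
    using assms T by (intro nn_integral_power_mean) (auto simp: nn_integral_count_space_finite sum_ennreal)
  then have "(\<Sum>i\<in>I. a i * w i) \<le> (W powr (r - 1) * (\<Sum>i\<in>I. a i powr r * w i)) powr (1 / r)"
    using assms by (simp add: nn_integral_count_space_finite sum_ennreal)
  then have "(\<Sum>i\<in>I. a i * w i) powr r \<le> ((W powr (r - 1) * (\<Sum>i\<in>I. a i powr r * w i)) powr (1 / r)) powr r"
    using r nn by (intro powr_mono2 sum_nonneg) auto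
  also have "\<dots> = W powr (r - 1) * (\<Sum>i\<in>I. a i powr r * w i)"
    using r W T by (simp add: powr_powr)
  finally show ?thesis .
qed

lemma powr_add_le:
  fixes a b :: real
  assumes "r > 1" "0 \<le> a" "0 \<le> b"
  shows "(a + b) powr r \<le> 2 powr (r - 1) * (a powr r + b powr r)"
  using sum_power_mean[of r "UNIV :: bool set" "\<lambda>i. if i then a else b" "\<lambda>_. 1" 2] assms
  by (simp add: UNIV_bool add.commute)

section \<open>Transference to Fourier series\<close>

lemma nn_integral_torus_le:
  fixes F G :: "real^'d::finite \<Rightarrow> ennreal"
  assumes "\<And>x. x \<in> cbox (\<chi> i. - 1/2) (\<chi> i. 1/2) \<Longrightarrow> F x \<le> G x"
  shows "(\<integral>\<^sup>+x. F x \<partial>torus) \<le> (\<integral>\<^sup>+x. G x \<partial>lebesgue)"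
proof -
  have "(\<integral>\<^sup>+x. F x \<partial>torus) = (\<integral>\<^sup>+x. F x * indicator (cbox (\<chi> i. - 1/2) (\<chi> i. 1/2)) x \<partial>lebesgue)"
    unfolding torus_def by (subst nn_integral_restrict_space) auto
  also have "\<dots> \<le> (\<integral>\<^sup>+x. G x \<partial>lebesgue)"
    using assms by (intro nn_integral_mono) (auto simp: indicator_def)
  finally show ?thesis .
qed

lemma borel_measurable_lebesgue_continuous:
  fixes f :: "'a::euclidean_space \<Rightarrow> 'b::topological_space"
  shows "continuous_on UNIV f \<Longrightarrow> f \<in> borel_measurable lebesgue"
  by (intro measurable_completion) (simp add: borel_measurable_continuous_onI)

lemma borel_measurable_gaussian [measurable]:
  fixes u :: "real^'d::finite"
  shows "(\<lambda>y. exp (- pi * s * (norm (y + u))\<^sup>2)) \<in> borel_measurable lebesgue"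
  by (intro borel_measurable_lebesgue_continuous continuous_intros)

lemma nn_integral_gaussian:
  fixes u :: "real^'d::finite"
  assumes "s > 0"
  shows "(\<integral>\<^sup>+y. ennreal (exp (- pi * s * (norm (y + u))\<^sup>2)) \<partial>lebesgue) = ennreal (1 / sqrt s ^ CARD('d))"
proof -
  have "has_bochner_integral lebesgue (\<lambda>y::real^'d. complex_of_real (exp (- pi * s * (norm (y + u))\<^sup>2))) (of_real (1 / sqrt s ^ CARD('d)))"
    using has_bochner_integral_gaussian[OF assms, of u 0] by simp
  from has_bochner_integral_Re[OF this]
  have "has_bochner_integral lebesgue (\<lambda>y::real^'d. exp (- pi * s * (norm (y + u))\<^sup>2)) (1 / sqrt s ^ CARD('d))"
    by (simp del: of_real_exp)
  then show ?thesis
    by (subst nn_integral_eq_integral) (auto simp: has_bochner_integral_iff)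
qed

text \<open>Let \<open>k\<close> be -t rounded to the lattice. In each coordinate t + k is at most
  1/2 in modulus, while m - k is 0 or at least 1 in modulus, so |m - k| is at most 2 |t + m|. Hence
  the shifted sum is bounded, uniformly in \<open>t\<close>, by a centred one with
  \<open>\<alpha> / 4\<close>.\<close>

lemma lattice_gaussian_sum_shifted:
  assumes "\<alpha> > (0::real)"
  obtains \<Gamma> where "\<Gamma> > 0" "\<And>(N :: (int^'d::finite) set) t. finite N \<Longrightarrow> (\<Sum>m\<in>N. exp (- \<alpha> * (norm (t + ivec m))\<^sup>2)) \<le> \<Gamma>"
proof -
  obtain \<Gamma> where \<Gamma>: "\<Gamma> > 0" "\<And>N :: (int^'d) set. finite N \<Longrightarrow> (\<Sum>m\<in>N. exp (- (\<alpha> / 4) * (norm (ivec m))\<^sup>2)) \<le> \<Gamma>"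
    using lattice_gaussian_sum_bounded[of "\<alpha> / 4", where 'd='d] assms by (metis zero_less_divide_iff zero_less_numeral)
  have "(\<Sum>m\<in>N. exp (- \<alpha> * (norm (t + ivec m))\<^sup>2)) \<le> \<Gamma>" if N: "finite N" for N :: "(int^'d) set" and t
  proof -
    define k :: "int^'d" where "k = (\<chi> i. round (- (t $ i)))"
    have "exp (- \<alpha> * (norm (t + ivec m))\<^sup>2) \<le> exp (- (\<alpha> / 4) * (norm (ivec (m - k) :: real^'d))\<^sup>2)" for m
    proof -
      have "(of_int (m $ i - k $ i))\<^sup>2 \<le> 4 * (t $ i + of_int (m $ i))\<^sup>2" for i
      proof -
        have rd: "\<bar>of_int (k $ i) + t $ i\<bar> \<le> 1 / 2"
          using of_int_round_abs_le[of "- (t $ i)"] by (simp add: k_def)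
        have "\<bar>of_int (m $ i - k $ i)\<bar> \<le> 2 * \<bar>t $ i + of_int (m $ i)\<bar>"
        proof (cases "m $ i = k $ i")
          case False
          then have "1 \<le> \<bar>m $ i - k $ i\<bar>" by linarith
          then have "1 \<le> \<bar>real_of_int (m $ i - k $ i)\<bar>" by linarith
          then show ?thesis using rd by (simp add: abs_if split: if_splits)
        qed simp
        then show ?thesis
          using power_mono[of "\<bar>real_of_int (m $ i - k $ i)\<bar>" "2 * \<bar>t $ i + of_int (m $ i)\<bar>" 2]
          by (simp add: power_mult_distrib)
      qed
      then have "(norm (ivec (m - k) :: real^'d))\<^sup>2 \<le> 4 * (norm (t + ivec m))\<^sup>2"
        unfolding norm_vec_sq sum_distrib_left by (intro sum_mono) simp
      then show ?thesis using assms by simp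
    qed
    then have "(\<Sum>m\<in>N. exp (- \<alpha> * (norm (t + ivec m))\<^sup>2)) \<le> (\<Sum>m\<in>N. exp (- (\<alpha> / 4) * (norm (ivec (m - k) :: real^'d))\<^sup>2))"
      by (rule sum_mono)
    also have "\<dots> = (\<Sum>m\<in>(\<lambda>m. m - k) ` N. exp (- (\<alpha> / 4) * (norm (ivec m :: real^'d))\<^sup>2))"
      by (subst sum.reindex) (auto simp: inj_on_def)
    also have "\<dots> \<le> \<Gamma>" using N by (intro \<Gamma>(2)) simp
    finally show ?thesis .
  qed
  with \<Gamma>(1) show ?thesis using that by blast
qed

lemma complete_measure_lebesgue: "complete_measure lebesgue"
  by (rule completion.complete_measure_axioms)

lemma norm_sq_shift: "(norm (x + u))\<^sup>2 = x \<bullet> x + 2 * (x \<bullet> u) + u \<bullet> u"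
  by (simp add: power2_norm_eq_inner inner_add_left inner_add_right inner_commute)

text \<open>Expanding the square turns the translation into a linear term in the exponent and a
  constant factor, which is moved into the vector.\<close>

lemma gauss_poly_shifted:
  "gauss_poly \<alpha> (\<lambda>x. (of_real (exp (- \<alpha> * (norm (x + u))\<^sup>2)) * character n x) *\<^sub>C v)"
proof -
  have "exp (complex_of_real ((- 2 * \<alpha>) *\<^sub>R u \<bullet> x - \<alpha> * (x \<bullet> x)) + \<i> * of_real ((2 * pi) *\<^sub>R ivec n \<bullet> x)) *\<^sub>C
      of_real (exp (- \<alpha> * (u \<bullet> u))) *\<^sub>C v = (of_real (exp (- \<alpha> * (norm (x + u))\<^sup>2)) * character n x) *\<^sub>C v" for x
  proof -
    have "complex_of_real ((- 2 * \<alpha>) *\<^sub>R u \<bullet> x - \<alpha> * (x \<bullet> x)) + of_real (- \<alpha> * (u \<bullet> u))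
        = of_real (- \<alpha> * (norm (x + u))\<^sup>2)"
      unfolding norm_sq_shift of_real_add[symmetric] by (simp add: inner_commute algebra_simps)
    then have "exp (complex_of_real ((- 2 * \<alpha>) *\<^sub>R u \<bullet> x - \<alpha> * (x \<bullet> x))) * exp (of_real (- \<alpha> * (u \<bullet> u)))
      = complex_of_real (exp (- \<alpha> * (norm (x + u))\<^sup>2))"
      unfolding mult_exp_exp by (simp only: exp_of_real)
    moreover have "exp (\<i> * of_real ((2 * pi) *\<^sub>R ivec n \<bullet> x)) = character n x"
      by (simp add: character_def cis_conv_exp inner_commute)
    ultimately show ?thesis
      unfolding exp_add scaleC_scaleC by (simp only: exp_of_real[symmetric] mult_ac)
  qed
  then show ?thesis
    using gauss_poly.base[of \<alpha> "(- 2 * \<alpha>) *\<^sub>R u" "(2 * pi) *\<^sub>R ivec n" "of_real (exp (- \<alpha> * (u \<bullet> u))) *\<^sub>C v"]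
    by simp
qed

text \<open>Translations become phases and modulations become translations. Two special cases are
  used: unmodulated translates, whose transform is a trigonometric polynomial times a Gaussian, and
  centred modulated Gaussians, whose transform is a sum of Gaussian bumps at lattice points.\<close>

lemma fourier_transform_gaussian_sum:
  fixes c :: "'i \<Rightarrow> 'x::complex_banach" and u :: "'i \<Rightarrow> real^'d::finite"
  assumes s: "s > 0"
  shows "fourier_transform (\<lambda>t. \<Sum>k\<in>I. (of_real (exp (- pi * s * (norm (t + u k))\<^sup>2)) * character (n k) t) *\<^sub>C c k) \<xi>
    = (\<Sum>k\<in>I. (cis (2 * pi * (u k \<bullet> (\<xi> - ivec (n k)))) * of_real (exp (- pi * (norm (\<xi> - ivec (n k)))\<^sup>2 / s) / sqrt s ^ CARD('d))) *\<^sub>C c k)"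
  unfolding fourier_transform_def
proof (rule strong_integral_eqI[OF complete_measure_lebesgue])
  have "has_strong_integral lebesgue
      (\<lambda>t. \<Sum>k\<in>I. (of_real (exp (- pi * s * (norm (t + u k))\<^sup>2)) * cis (2 * pi * (t \<bullet> (ivec (n k) - \<xi>)))) *\<^sub>C c k)
      (\<Sum>k\<in>I. (cis (- 2 * pi * (u k \<bullet> (ivec (n k) - \<xi>))) * of_real (exp (- pi * (norm (ivec (n k) - \<xi>))\<^sup>2 / s) / sqrt s ^ CARD('d))) *\<^sub>C c k)"
    by (intro has_strong_integral_sum[OF complete_measure_lebesgue] has_strong_integral_complex[OF complete_measure_lebesgue]
      has_bochner_integral_gaussian s)
  moreover have "cis (- 2 * pi * (t \<bullet> \<xi>)) *\<^sub>C (\<Sum>k\<in>I. (of_real (exp (- pi * s * (norm (t + u k))\<^sup>2)) * character (n k) t) *\<^sub>C c k)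
     = (\<Sum>k\<in>I. (of_real (exp (- pi * s * (norm (t + u k))\<^sup>2)) * cis (2 * pi * (t \<bullet> (ivec (n k) - \<xi>)))) *\<^sub>C c k)" for t
    unfolding scaleC.sum_right
  proof (rule sum.cong[OF refl])
    fix k
    have "cis (- 2 * pi * (t \<bullet> \<xi>)) * character (n k) t = cis (2 * pi * (t \<bullet> (ivec (n k) - \<xi>)))"
      by (simp add: character_def cis_mult inner_diff_right algebra_simps)
    then show "cis (- 2 * pi * (t \<bullet> \<xi>)) *\<^sub>C (of_real (exp (- pi * s * (norm (t + u k))\<^sup>2)) * character (n k) t) *\<^sub>C c k =
      (of_real (exp (- pi * s * (norm (t + u k))\<^sup>2)) * cis (2 * pi * (t \<bullet> (ivec (n k) - \<xi>)))) *\<^sub>C c k"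
      unfolding scaleC_scaleC by (metis mult.left_commute)
  qed
  moreover have "cis (- 2 * pi * (u k \<bullet> (ivec (n k) - \<xi>))) = cis (2 * pi * (u k \<bullet> (\<xi> - ivec (n k))))" for k
    by (simp add: inner_diff_right algebra_simps)
  ultimately show "has_strong_integral lebesgue
     (\<lambda>t. cis (- 2 * pi * (t \<bullet> \<xi>)) *\<^sub>C
          (\<Sum>k\<in>I. (of_real (exp (- pi * s * (norm (t + u k))\<^sup>2)) * character (n k) t) *\<^sub>C c k))
     (\<Sum>k\<in>I. (cis (2 * pi * (u k \<bullet> (\<xi> - ivec (n k)))) *
       of_real (exp (- pi * (norm (\<xi> - ivec (n k)))\<^sup>2 / s) / sqrt s ^ CARD('d))) *\<^sub>C c k)"
    by (simp only: norm_minus_commute)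
qed

text \<open>The test function is a sum of Gaussian translates: its Fourier transform is the trigonometric
  polynomial times a Gaussian, which is bounded below on the cube.\<close>

lemma fourier_type_sequence:
  fixes D p :: real
  assumes p: "1 < p" and D: "0 < D"
    and type: "\<And>(f :: real^'d::finite \<Rightarrow> 'x::complex_banach) y. schwartz f \<Longrightarrow> 0 \<le> y \<Longrightarrow>
      (\<integral>\<^sup>+x. ennreal (norm (f x) powr p) \<partial>lebesgue) \<le> ennreal y \<Longrightarrow>
      (\<integral>\<^sup>+x. ennreal (norm (fourier_transform f x) powr (p / (p - 1))) \<partial>lebesgue)
        \<le> ennreal (D * y powr (1 / (p - 1)))"
  obtains K where "0 < K" "\<And>(N :: (int^'d) set) (c :: int^'d \<Rightarrow> 'x). finite N \<Longrightarrow>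
      (\<integral>\<^sup>+x. ennreal (norm (\<Sum>n\<in>N. character n x *\<^sub>C c n) powr (p / (p - 1))) \<partial>torus)
        \<le> ennreal (K * (\<Sum>n\<in>N. norm (c n) powr p) powr (1 / (p - 1)))"
proof -
  define r where "r = p / (p - 1)"
  have r: "r > 0" using p by (simp add: r_def)
  obtain \<Gamma> where \<Gamma>: "\<Gamma> > 0" "\<And>(N :: (int^'d) set) t. finite N \<Longrightarrow> (\<Sum>m\<in>N. exp (- pi * (norm (t + ivec m))\<^sup>2)) \<le> \<Gamma>"
    by (rule lattice_gaussian_sum_shifted[OF pi_gt_zero, where 'd='d]) blast
  \<comment> \<open>On the cube the squared norm is at most the dimension, so
    \<open>\<delta>\<close> is a lower bound for the Gaussian factor there.\<close>
  define \<delta> where "\<delta> = exp (- pi * real CARD('d))"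
  define K where "K = \<delta> powr (- r) * (D * (\<Gamma> powr (p - 1)) powr (1 / (p - 1)))"
  have "(\<integral>\<^sup>+x. ennreal (norm (\<Sum>n\<in>N. character n x *\<^sub>C c n) powr r) \<partial>torus)
        \<le> ennreal (K * (\<Sum>n\<in>N. norm (c n) powr p) powr (1 / (p - 1)))"
    if N: "finite N" for N :: "(int^'d) set" and c :: "int^'d \<Rightarrow> 'x"
  proof -
    define g where "g = (\<lambda>t::real^'d. \<Sum>k\<in>N. (of_real (exp (- pi * 1 * (norm (t + ivec k))\<^sup>2)) * character 0 t) *\<^sub>C c k)"
    have g: "schwartz g"
      unfolding g_def
    proof (rule schwartz_gauss_poly[OF gauss_poly_sum])
      fix k
      show "gauss_poly (pi * 1) (\<lambda>t. (of_real (exp (- pi * 1 * (norm (t + ivec k))\<^sup>2)) * character 0 t) *\<^sub>C c k)"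
        using gauss_poly_shifted[of "pi * 1" "ivec k" 0 "c k"] by (simp only: mult_minus_left)
    qed simp
    have ghat: "fourier_transform g \<xi> = of_real (exp (- pi * (norm \<xi>)\<^sup>2)) *\<^sub>C (\<Sum>n\<in>N. character n \<xi> *\<^sub>C c n)" for \<xi>
    proof -
      have "fourier_transform g \<xi> = (\<Sum>k\<in>N. (cis (2 * pi * (ivec k \<bullet> (\<xi> - ivec 0))) *
          of_real (exp (- pi * (norm (\<xi> - ivec 0))\<^sup>2 / 1) / sqrt 1 ^ CARD('d))) *\<^sub>C c k)"
        unfolding g_def by (rule fourier_transform_gaussian_sum) simp
      also have "ivec 0 = (0 :: real^'d)" by (simp add: vec_eq_iff)
      finally show ?thesis
        by (simp add: scaleC.sum_right scaleC_scaleC character_def inner_commute mult.commute)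
    qed
    \<comment> \<open>The power mean inequality with Gaussian weights of total mass at most
      \<open>\<Gamma>\<close> costs \<open>\<Gamma> powr (p - 1)\<close>; each Gaussian then
      integrates to 1.\<close>
    define y where "y = \<Gamma> powr (p - 1) * (\<Sum>n\<in>N. norm (c n) powr p)"
    have y: "0 \<le> y" unfolding y_def by (intro mult_nonneg_nonneg sum_nonneg) auto
    have "(\<integral>\<^sup>+t. ennreal (norm (g t) powr p) \<partial>lebesgue) \<le>
      (\<integral>\<^sup>+t. (\<Sum>n\<in>N. ennreal (\<Gamma> powr (p - 1) * norm (c n) powr p) * ennreal (exp (- pi * 1 * (norm (t + ivec n))\<^sup>2))) \<partial>lebesgue)"
    proof (rule nn_integral_mono)
      fix t :: "real^'d"
      have "norm (g t) \<le> (\<Sum>n\<in>N. norm (c n) * exp (- pi * (norm (t + ivec n))\<^sup>2))"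
        unfolding g_def by (rule order_trans[OF norm_sum]) (simp add: norm_scaleC norm_mult mult.commute del: of_real_exp)
      then have "norm (g t) powr p \<le> (\<Sum>n\<in>N. norm (c n) * exp (- pi * (norm (t + ivec n))\<^sup>2)) powr p"
        using p by (intro powr_mono2) auto
      also have "\<dots> \<le> \<Gamma> powr (p - 1) * (\<Sum>n\<in>N. norm (c n) powr p * exp (- pi * (norm (t + ivec n))\<^sup>2))"
        using p N \<Gamma> by (intro sum_power_mean) auto
      also have "\<dots> = (\<Sum>n\<in>N. \<Gamma> powr (p - 1) * norm (c n) powr p * exp (- pi * 1 * (norm (t + ivec n))\<^sup>2))"
        by (simp add: sum_distrib_left mult.assoc)
      finally have "ennreal (norm (g t) powr p) \<le> ennreal (\<Sum>n\<in>N. \<Gamma> powr (p - 1) * norm (c n) powr p * exp (- pi * 1 * (norm (t + ivec n))\<^sup>2))"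
        by (rule ennreal_leI)
      also have "\<dots> = (\<Sum>n\<in>N. ennreal (\<Gamma> powr (p - 1) * norm (c n) powr p) * ennreal (exp (- pi * 1 * (norm (t + ivec n))\<^sup>2)))"
        by (subst sum_ennreal[symmetric]) (auto simp: ennreal_mult)
      finally show "ennreal (norm (g t) powr p) \<le> (\<Sum>n\<in>N. ennreal (\<Gamma> powr (p - 1) * norm (c n) powr p) * ennreal (exp (- pi * 1 * (norm (t + ivec n))\<^sup>2)))" .
    qed
    also have "\<dots> = (\<Sum>n\<in>N. ennreal (\<Gamma> powr (p - 1) * norm (c n) powr p) * (\<integral>\<^sup>+t. ennreal (exp (- pi * 1 * (norm (t + ivec n :: real^'d))\<^sup>2)) \<partial>lebesgue))"
      by (subst nn_integral_sum, measurable, intro sum.cong refl nn_integral_cmult, measurable)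
    also have "\<dots> = (\<Sum>n\<in>N. ennreal (\<Gamma> powr (p - 1) * norm (c n) powr p))"
      by (subst nn_integral_gaussian) auto
    also have "\<dots> = ennreal y"
      by (simp add: y_def sum_distrib_left sum_ennreal)
    finally have gy: "(\<integral>\<^sup>+t. ennreal (norm (g t) powr p) \<partial>lebesgue) \<le> ennreal y" .
    have "(\<integral>\<^sup>+x. ennreal (norm (\<Sum>n\<in>N. character n x *\<^sub>C c n) powr r) \<partial>torus)
      \<le> (\<integral>\<^sup>+x. ennreal (\<delta> powr (- r)) * ennreal (norm (fourier_transform g x) powr r) \<partial>lebesgue)"
    proof (rule nn_integral_torus_le)
      fix x :: "real^'d" assume x: "x \<in> cbox (\<chi> i. - 1/2) (\<chi> i. 1/2)"
      have "(norm x)\<^sup>2 \<le> (\<Sum>i\<in>(UNIV::'d set). 1)"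
        unfolding norm_vec_sq
      proof (rule sum_mono)
        fix i
        have "- 1 / 2 \<le> x $ i \<and> x $ i \<le> 1 / 2" using x by (simp add: mem_box_cart)
        then have "\<bar>x $ i\<bar> \<le> 1" by linarith
        then show "(x $ i)\<^sup>2 \<le> 1" using power_mono[of "\<bar>x $ i\<bar>" 1 2] by simp
      qed
      then have "\<delta> \<le> exp (- pi * (norm x)\<^sup>2)" by (simp add: \<delta>_def)
      then have "\<delta> * norm (\<Sum>n\<in>N. character n x *\<^sub>C c n) \<le> norm (fourier_transform g x)"
        unfolding ghat norm_scaleC by (intro mult_right_mono) (auto simp del: of_real_exp)
      then have "(\<delta> * norm (\<Sum>n\<in>N. character n x *\<^sub>C c n)) powr r \<le> norm (fourier_transform g x) powr r"
        using r by (intro powr_mono2) (auto simp: \<delta>_def)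
      then have "\<delta> powr (- r) * (\<delta> powr r * norm (\<Sum>n\<in>N. character n x *\<^sub>C c n) powr r) \<le> \<delta> powr (- r) * norm (fourier_transform g x) powr r"
        by (intro mult_left_mono) (auto simp: powr_mult)
      also have "\<delta> powr (- r) * (\<delta> powr r * norm (\<Sum>n\<in>N. character n x *\<^sub>C c n) powr r) = norm (\<Sum>n\<in>N. character n x *\<^sub>C c n) powr r"
        unfolding mult.assoc[symmetric] powr_add[symmetric] by (simp add: \<delta>_def)
      finally show "ennreal (norm (\<Sum>n\<in>N. character n x *\<^sub>C c n) powr r) \<le> ennreal (\<delta> powr (- r)) * ennreal (norm (fourier_transform g x) powr r)"
        by (simp add: ennreal_leI flip: ennreal_mult)
    qed
    also have "\<dots> = ennreal (\<delta> powr (- r)) * (\<integral>\<^sup>+x. ennreal (norm (fourier_transform g x) powr r) \<partial>lebesgue)"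
    proof (rule nn_integral_cmult)
      have "continuous_on UNIV (\<lambda>\<xi>::real^'d. norm (fourier_transform g \<xi>))"
        unfolding ghat by (intro continuous_intros scaleC.continuous_on)
      from borel_measurable_lebesgue_continuous[OF this]
      show "(\<lambda>x. ennreal (norm (fourier_transform g x) powr r)) \<in> borel_measurable lebesgue"
        by simp
    qed
    also have "\<dots> \<le> ennreal (\<delta> powr (- r)) * ennreal (D * y powr (1 / (p - 1)))"
      unfolding r_def by (intro mult_left_mono type g y gy) auto
    also have "\<dots> = ennreal (K * (\<Sum>n\<in>N. norm (c n) powr p) powr (1 / (p - 1)))"
      using D by (simp add: K_def y_def powr_mult mult.assoc flip: ennreal_mult)
    finally show ?thesis .
  qed
  moreover have "K > 0" using D \<Gamma>(1) by (simp add: K_def \<delta>_def)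
  ultimately show ?thesis using that by (simp add: r_def)
qed

text \<open>Near \<open>n\<close> the Gaussian centred at \<open>n\<close> dominates. For small \<open>s\<close> the other ones contribute at most a
  convolution with a kernel of mass \<open>1/2\<close>, which is absorbed on the left-hand side.\<close>

lemma gaussian_sampling:
  fixes r :: real
  assumes r: "r > 1"
  obtains s K :: real where "s > 0" "K > 0"
    "\<And>(M :: (int^'d::finite) set) (c :: int^'d \<Rightarrow> 'x::real_normed_vector). finite M \<Longrightarrow>
      ennreal (\<Sum>n\<in>M. norm (c n) powr r)
        \<le> ennreal K * (\<integral>\<^sup>+\<xi>. ennreal (norm (\<Sum>m\<in>M. exp (- pi * (norm (\<xi> - ivec m))\<^sup>2 / s) *\<^sub>R c m) powr r) \<partial>lebesgue)"
proof -
  obtain \<alpha> where \<alpha>: "\<alpha> > 0" "\<And>N :: (int^'d) set. finite N \<Longrightarrow> 0 \<notin> N \<Longrightarrow> (\<Sum>m\<in>N. exp (- \<alpha> * (norm (ivec m))\<^sup>2)) \<le> 1 / 2"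
    by (rule lattice_gaussian_sum_small[of "1/2", where 'd='d]) auto
  \<comment> \<open>Makes the Gaussians decay like exp(-2 \<open>\<alpha>\<close> |.|^2): one half
    of this decay is spent on the distance between lattice points, and that half has small lattice
    sum by the choice of \<open>\<alpha>\<close>.\<close>
  define s where "s = pi / (2 * \<alpha>)"
  have s: "s > 0" "pi / s = 2 * \<alpha>" using \<alpha>(1) by (auto simp: s_def)
  define \<delta> where "\<delta> = exp (- 2 * \<alpha> * real CARD('d))"
  have \<delta>: "\<delta> > 0" by (simp add: \<delta>_def)
  define w where "w = (\<lambda>m::int^'d. exp (- \<alpha> * (norm (ivec m :: real^'d))\<^sup>2))"
  have w0: "w m > 0" for m by (simp add: w_def)
  have w_sum: "(\<Sum>m\<in>M - {n}. w (m - n)) \<le> 1 / 2" "(\<Sum>m\<in>M - {n}. w (n - m)) \<le> 1 / 2" if M: "finite M" for M n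
  proof -
    have "(\<Sum>m\<in>M - {n}. w (m - n)) = (\<Sum>m\<in>(\<lambda>m. m - n) ` (M - {n}). w m)"
      by (subst sum.reindex) (auto simp: inj_on_def)
    also have "\<dots> \<le> 1 / 2" unfolding w_def by (rule \<alpha>(2)) (use M in auto)
    finally show "(\<Sum>m\<in>M - {n}. w (m - n)) \<le> 1 / 2" .
    have "(\<Sum>m\<in>M - {n}. w (n - m)) = (\<Sum>m\<in>(\<lambda>m. n - m) ` (M - {n}). w m)"
      by (subst sum.reindex) (auto simp: inj_on_def)
    also have "\<dots> \<le> 1 / 2" unfolding w_def by (rule \<alpha>(2)) (use M in auto)
    finally show "(\<Sum>m\<in>M - {n}. w (n - m)) \<le> 1 / 2" .
  qed
  \<comment> \<open>Half side 1/4 makes the boxes disjoint and keeps \<open>\<xi>\<close> close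
    enough to \<open>n\<close> for the quadratic estimate that follows.\<close>
  define B where "B = (\<lambda>n::int^'d. cbox (ivec n - (\<chi> i. 1/4)) (ivec n + (\<chi> i. 1/4)) :: (real^'d) set)"
  have B: "\<bar>\<xi> $ i - of_int (n $ i)\<bar> \<le> 1 / 4" if "\<xi> \<in> B n" for \<xi> n i
  proof -
    have "of_int (n $ i) - 1 / 4 \<le> \<xi> $ i" "\<xi> $ i \<le> of_int (n $ i) + 1 / 4"
      using that by (auto simp: B_def mem_box_cart dest!: spec[of _ i])
    then show ?thesis by linarith
  qed
  define e where "e = measure lborel (cbox (0 - (\<chi> i. 1/4)) (0 + (\<chi> i. 1/4)) :: (real^'d) set)"
  have e: "e > 0" and emB: "emeasure lebesgue (B n) = ennreal e" for n
  proof -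
    have "e = (\<Prod>i\<in>(UNIV::'d set). 1/2)"
      unfolding e_def by (subst content_cbox_cart) (auto simp: interval_eq_empty_cart)
    then show "e > 0" by simp
    have "measure lborel (B n) = e"
      unfolding B_def e_def by (subst (1 2) content_cbox_cart) (auto simp: interval_eq_empty_cart)
    moreover have "emeasure lborel (B n) = ennreal (measure lborel (B n))"
      using emeasure_lborel_cbox_finite by (intro emeasure_eq_ennreal_measure) (auto simp: B_def less_top)
    ultimately show "emeasure lebesgue (B n) = ennreal e"
      by (simp add: B_def)
  qed
  \<comment> \<open>Coordinatewise, with \<open>\<theta>\<close> the offset of \<open>\<xi>\<close>
    from \<open>n\<close> and \<open>k\<close> the difference of \<open>m\<close> and
    \<open>n\<close>: since |\<open>\<theta>\<close>| is at most 1/4, the mixed term 2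
    \<open>\<theta>\<close> k is at most k^2/2, which leaves k^2/2 for the decay in m - n.\<close>
  have dec: "exp (- 2 * \<alpha> * (norm (\<xi> - ivec m))\<^sup>2) \<le> exp (- 2 * \<alpha> * (norm (\<xi> - ivec n))\<^sup>2) * w (m - n)"
    if "\<xi> \<in> B n" for \<xi> m n
  proof -
    have "(\<xi> $ i - of_int (n $ i))\<^sup>2 + (of_int (m $ i - n $ i))\<^sup>2 / 2 \<le> (\<xi> $ i - of_int (m $ i))\<^sup>2" for i
    proof -
      define \<theta> where "\<theta> = \<xi> $ i - of_int (n $ i)"
      define k where "k = m $ i - n $ i"
      have "\<bar>k\<bar> \<le> k * k"
      proof (cases "k = 0")
        case False
        then have "1 * \<bar>k\<bar> \<le> \<bar>k\<bar> * \<bar>k\<bar>" by (intro mult_right_mono) linarith+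
        then show ?thesis by simp
      qed simp
      then have k: "\<bar>real_of_int k\<bar> \<le> of_int k * of_int k" by (metis of_int_abs of_int_le_iff of_int_mult)
      have "\<theta> * of_int k \<le> \<bar>\<theta>\<bar> * \<bar>of_int k\<bar>" by (metis abs_ge_self abs_mult)
      also have "\<dots> \<le> 1 / 4 * (of_int k * of_int k)"
        using B[OF that, of i] k by (intro mult_mono) (auto simp: \<theta>_def)
      finally have "\<theta>\<^sup>2 + (of_int k)\<^sup>2 / 2 \<le> (\<theta> - of_int k)\<^sup>2"
        by (simp add: power2_eq_square algebra_simps)
      then show ?thesis by (simp add: \<theta>_def k_def algebra_simps)
    qed
    then have "(\<Sum>i\<in>UNIV. (\<xi> $ i - of_int (n $ i))\<^sup>2 + (of_int (m $ i - n $ i))\<^sup>2 / 2) \<le> (\<Sum>i\<in>UNIV. (\<xi> $ i - of_int (m $ i))\<^sup>2)"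
      by (intro sum_mono)
    then have "(norm (\<xi> - ivec n))\<^sup>2 + (norm (ivec (m - n) :: real^'d))\<^sup>2 / 2 \<le> (norm (\<xi> - ivec m))\<^sup>2"
      by (simp add: norm_vec_sq sum.distrib sum_divide_distrib)
    then have "2 * \<alpha> * ((norm (\<xi> - ivec n))\<^sup>2 + (norm (ivec (m - n) :: real^'d))\<^sup>2 / 2) \<le> 2 * \<alpha> * (norm (\<xi> - ivec m))\<^sup>2"
      using \<alpha>(1) by (intro mult_left_mono) auto
    then have "- 2 * \<alpha> * (norm (\<xi> - ivec m))\<^sup>2 \<le> - 2 * \<alpha> * (norm (\<xi> - ivec n))\<^sup>2 + - \<alpha> * (norm (ivec (m - n) :: real^'d))\<^sup>2"
      by (simp add: distrib_left)
    then show ?thesis unfolding w_def mult_exp_exp by (subst exp_le_cancel_iff)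
  qed
  have low: "\<delta> \<le> exp (- 2 * \<alpha> * (norm (\<xi> - ivec n))\<^sup>2)" if "\<xi> \<in> B n" for \<xi> n
  proof -
    have "(norm (\<xi> - ivec n))\<^sup>2 \<le> (\<Sum>i\<in>(UNIV::'d set). 1)"
      unfolding norm_vec_sq
    proof (rule sum_mono)
      fix i
      show "((\<xi> - ivec n) $ i)\<^sup>2 \<le> 1"
        using power_mono[of "\<bar>\<xi> $ i - of_int (n $ i)\<bar>" 1 2] B[OF that, of i] by simp
    qed
    then show ?thesis using \<alpha>(1) by (simp add: \<delta>_def)
  qed
  define K0 where "K0 = 2 powr (r - 1) * \<delta> powr (- r)"
  have K0: "K0 > 0" using \<delta> by (simp add: K0_def)
  define K where "K = 2 * K0 / e"
  have "ennreal (\<Sum>n\<in>M. norm (c n) powr r)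
        \<le> ennreal K * (\<integral>\<^sup>+\<xi>. ennreal (norm (\<Sum>m\<in>M. exp (- pi * (norm (\<xi> - ivec m))\<^sup>2 / s) *\<^sub>R c m) powr r) \<partial>lebesgue)"
    if M: "finite M" for M :: "(int^'d) set" and c :: "int^'d \<Rightarrow> 'x"
  proof -
    define F where "F = (\<lambda>\<xi>. \<Sum>m\<in>M. exp (- 2 * \<alpha> * (norm (\<xi> - ivec m))\<^sup>2) *\<^sub>R c m)"
    have F_eq: "(\<Sum>m\<in>M. exp (- pi * (norm (\<xi> - ivec m))\<^sup>2 / s) *\<^sub>R c m) = F \<xi>" for \<xi>
    proof -
      have "- pi * x / s = - (pi / s) * x" for x by simp
      then have "- pi * x / s = - 2 * \<alpha> * x" for x unfolding s(2) by simp
      then show ?thesis unfolding F_def by metis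
    qed
    have "continuous_on UNIV (\<lambda>\<xi>. norm (F \<xi>))"
      unfolding F_def by (intro continuous_intros)
    from borel_measurable_lebesgue_continuous[OF this]
    have [measurable]: "(\<lambda>\<xi>. norm (F \<xi>) powr r) \<in> borel_measurable lebesgue"
      by measurable
    have [measurable]: "B n \<in> sets lebesgue" for n by (simp add: B_def)
    define a where "a = (\<lambda>n. norm (c n))"
    have pt: "a n powr r \<le> K0 * norm (F \<xi>) powr r + (\<Sum>m\<in>M - {n}. a m powr r * w (m - n))"
      if n: "n \<in> M" and \<xi>: "\<xi> \<in> B n" for n \<xi>
    proof -
      define G where "G = exp (- 2 * \<alpha> * (norm (\<xi> - ivec n))\<^sup>2)"
      have G: "G > 0" "\<delta> \<le> G" using low[OF \<xi>] by (auto simp: G_def)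
      have "G *\<^sub>R c n = F \<xi> - (\<Sum>m\<in>M - {n}. exp (- 2 * \<alpha> * (norm (\<xi> - ivec m))\<^sup>2) *\<^sub>R c m)"
        unfolding F_def G_def by (subst sum.remove[OF M n]) simp
      then have "norm (G *\<^sub>R c n) \<le> norm (F \<xi>) + norm (\<Sum>m\<in>M - {n}. exp (- 2 * \<alpha> * (norm (\<xi> - ivec m))\<^sup>2) *\<^sub>R c m)"
        by (simp add: norm_triangle_ineq4)
      then have "G * a n \<le> norm (F \<xi>) + norm (\<Sum>m\<in>M - {n}. exp (- 2 * \<alpha> * (norm (\<xi> - ivec m))\<^sup>2) *\<^sub>R c m)"
        using G by (simp add: a_def)
      also have "norm (\<Sum>m\<in>M - {n}. exp (- 2 * \<alpha> * (norm (\<xi> - ivec m))\<^sup>2) *\<^sub>R c m) \<le> (\<Sum>m\<in>M - {n}. (G * w (m - n)) * a m)"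
        using dec[OF \<xi>] by (intro order_trans[OF norm_sum] sum_mono) (auto intro!: mult_right_mono simp: a_def G_def)
      also have "\<dots> = G * (\<Sum>m\<in>M - {n}. a m * w (m - n))"
        by (simp add: sum_distrib_left mult_ac)
      finally have "a n \<le> norm (F \<xi>) / G + (\<Sum>m\<in>M - {n}. a m * w (m - n))"
        using G(1) by (simp add: field_simps)
      also have "norm (F \<xi>) / G \<le> norm (F \<xi>) / \<delta>"
        using G \<delta> by (intro divide_left_mono) auto
      finally have "a n powr r \<le> (norm (F \<xi>) / \<delta> + (\<Sum>m\<in>M - {n}. a m * w (m - n))) powr r"
        using r by (intro powr_mono2) (auto simp: a_def)
      also have "\<dots> \<le> 2 powr (r - 1) * ((norm (F \<xi>) / \<delta>) powr r + (\<Sum>m\<in>M - {n}. a m * w (m - n)) powr r)"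
        using r \<delta> less_imp_le[OF w0] by (intro powr_add_le sum_nonneg) (auto simp: a_def)
      \<comment> \<open>The weights off \<open>n\<close> have mass at most 1/2, and (1/2)^(r - 1)
        cancels the factor 2^(r - 1) of \<open>powr_add_le\<close>. The cross terms thus keep
        coefficient 1.\<close>
      also have "(\<Sum>m\<in>M - {n}. a m * w (m - n)) powr r \<le> (1/2) powr (r - 1) * (\<Sum>m\<in>M - {n}. a m powr r * w (m - n))"
        by (rule sum_power_mean) (use r M less_imp_le[OF w0] w_sum in \<open>auto simp: a_def\<close>)
      also have "2 powr (r - 1) * ((norm (F \<xi>) / \<delta>) powr r + (1/2) powr (r - 1) * (\<Sum>m\<in>M - {n}. a m powr r * w (m - n)))
         = K0 * norm (F \<xi>) powr r + (\<Sum>m\<in>M - {n}. a m powr r * w (m - n))"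
        using \<delta> by (simp add: K0_def powr_divide powr_minus_divide distrib_left)
      finally show ?thesis by simp
    qed
    show ?thesis
    proof (cases "(\<integral>\<^sup>+\<xi>. ennreal (norm (F \<xi>) powr r) \<partial>lebesgue) = top")
      case True
      have "K > 0" using K0 e by (simp add: K_def)
      then show ?thesis unfolding F_eq using True by (simp add: ennreal_mult_top)
    next
      case False
      define J where "J = (\<lambda>n. \<integral>\<^sup>+\<xi>. ennreal (norm (F \<xi>) powr r) * indicator (B n) \<xi> \<partial>lebesgue)"
      have disj: "(\<Sum>n\<in>M. indicator (B n) \<xi> :: ennreal) \<le> 1" for \<xi>
      proof -
        have "n = m" if "\<xi> \<in> B n" "\<xi> \<in> B m" for n m
        proof -
          have "\<bar>real_of_int (n $ i) - of_int (m $ i)\<bar> < 1" for i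
            using B[OF that(1), of i] B[OF that(2), of i] by linarith
          then have "\<bar>n $ i - m $ i\<bar> < 1" for i by (metis of_int_abs of_int_diff of_int_less_1_iff)
          then show ?thesis by (simp add: vec_eq_iff)
        qed
        then have "card {n \<in> M. \<xi> \<in> B n} \<le> 1" using M by (auto simp: card_le_Suc0_iff_eq)
        moreover have "(\<Sum>n\<in>M. indicator (B n) \<xi> :: ennreal) = of_nat (card {n \<in> M. \<xi> \<in> B n})"
          using M by (simp add: indicator_def of_bool_def sum.If_cases Int_def)
        ultimately show ?thesis by (metis of_nat_1 of_nat_le_iff of_nat_mono)
      qed
      have "(\<Sum>n\<in>M. J n) = (\<integral>\<^sup>+\<xi>. (\<Sum>n\<in>M. ennreal (norm (F \<xi>) powr r) * indicator (B n) \<xi>) \<partial>lebesgue)"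
        unfolding J_def by (subst nn_integral_sum) auto
      also have "\<dots> \<le> (\<integral>\<^sup>+\<xi>. ennreal (norm (F \<xi>) powr r) \<partial>lebesgue)"
        unfolding sum_distrib_left[symmetric]
        by (intro nn_integral_mono) (use mult_left_mono[OF disj] in fastforce)
      finally have J_le: "(\<Sum>n\<in>M. J n) \<le> (\<integral>\<^sup>+\<xi>. ennreal (norm (F \<xi>) powr r) \<partial>lebesgue)" .
      have J_n: "J n \<noteq> top" if "n \<in> M" for n
      proof -
        have "J n \<le> (\<Sum>n\<in>M. J n)" using M that by (intro member_le_sum) auto
        also note J_le
        finally show ?thesis using False by (auto simp: top_unique)
      qed
      have Jn: "J n = ennreal (enn2real (J n))" if "n \<in> M" for n
        using J_n[OF that] by (simp add: less_top)
      define A where "A = (\<Sum>n\<in>M. a n powr r)"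
      have A0: "A \<ge> 0" by (auto simp: A_def intro!: sum_nonneg)
      have each: "e * a n powr r \<le> K0 * enn2real (J n) + e * (\<Sum>m\<in>M - {n}. a m powr r * w (m - n))" if n: "n \<in> M" for n
      proof -
        define S where "S = (\<Sum>m\<in>M - {n}. a m powr r * w (m - n))"
        have S: "S \<ge> 0" using less_imp_le[OF w0] by (auto simp: S_def intro!: sum_nonneg)
        have "ennreal (e * a n powr r) = (\<integral>\<^sup>+\<xi>. ennreal (a n powr r) * indicator (B n) \<xi> \<partial>lebesgue)"
          using e by (subst nn_integral_cmult_indicator) (simp_all add: emB ennreal_mult mult.commute)
        also have "\<dots> \<le> (\<integral>\<^sup>+\<xi>. ennreal K0 * (ennreal (norm (F \<xi>) powr r) * indicator (B n) \<xi>) + ennreal S * indicator (B n) \<xi> \<partial>lebesgue)"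
        proof (rule nn_integral_mono)
          fix \<xi>
          show "ennreal (a n powr r) * indicator (B n) \<xi> \<le> ennreal K0 * (ennreal (norm (F \<xi>) powr r) * indicator (B n) \<xi>) + ennreal S * indicator (B n) \<xi>"
          proof (cases "\<xi> \<in> B n")
            case True
            have "ennreal (a n powr r) \<le> ennreal (K0 * norm (F \<xi>) powr r + S)"
              using pt[OF n True] unfolding S_def by (rule ennreal_leI)
            then show ?thesis using True K0 S by (simp add: ennreal_mult)
          qed simp
        qed
        also have "\<dots> = ennreal K0 * J n + ennreal S * ennreal e"
          unfolding J_def by (simp add: nn_integral_add nn_integral_cmult emB)
        also have "\<dots> = ennreal (K0 * enn2real (J n) + e * S)"
          using K0 S e by (subst Jn[OF n]) (simp add: mult.commute flip: ennreal_mult ennreal_plus)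
        finally show ?thesis using K0 S e unfolding S_def[symmetric] by (subst (asm) ennreal_le_iff) auto
      qed
      have "e * A = (\<Sum>n\<in>M. e * a n powr r)" by (simp add: A_def sum_distrib_left)
      also have "\<dots> \<le> (\<Sum>n\<in>M. K0 * enn2real (J n) + e * (\<Sum>m\<in>M - {n}. a m powr r * w (m - n)))"
        by (rule sum_mono) (rule each)
      also have "\<dots> = K0 * (\<Sum>n\<in>M. enn2real (J n)) + e * (\<Sum>n\<in>M. \<Sum>m\<in>M - {n}. a m powr r * w (m - n))"
        by (simp add: sum.distrib sum_distrib_left)
      also have "(\<Sum>n\<in>M. \<Sum>m\<in>M - {n}. a m powr r * w (m - n)) = (\<Sum>m\<in>M. \<Sum>n\<in>M - {m}. a m powr r * w (m - n))"
      proof -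
        have "(\<Sum>m\<in>M - {n}. h m) = (\<Sum>m\<in>M. if m = n then 0 else h m)" for h :: "_ \<Rightarrow> real" and n
          by (rule sum.mono_neutral_cong_left) (use M in auto)
        then show ?thesis
          by (simp only:) (subst sum.swap, auto intro!: sum.cong)
      qed
      \<comment> \<open>After the interchange the other marginal of the kernel is needed; it is at
        most 1/2 too, so the cross terms amount to at most half of the finite sum
        \<open>A\<close>.\<close>
      also have "(\<Sum>m\<in>M. \<Sum>n\<in>M - {m}. a m powr r * w (m - n)) \<le> (\<Sum>m\<in>M. a m powr r * (1/2))"
        unfolding sum_distrib_left[symmetric] by (intro sum_mono mult_left_mono w_sum M) auto
      also have "\<dots> = A / 2" by (simp add: A_def sum_divide_distrib)
      finally have "e * A \<le> 2 * K0 * (\<Sum>n\<in>M. enn2real (J n))" using e by (simp add: field_simps)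
      then have "A \<le> K * (\<Sum>n\<in>M. enn2real (J n))"
        using e by (simp add: K_def field_simps)
      then have "ennreal A \<le> ennreal K * ennreal (\<Sum>n\<in>M. enn2real (J n))"
        using K0 e by (subst ennreal_mult[symmetric]) (auto simp: K_def intro!: sum_nonneg ennreal_leI)
      also have "ennreal (\<Sum>n\<in>M. enn2real (J n)) = (\<Sum>n\<in>M. J n)"
        using Jn by (subst sum_ennreal[symmetric]) (auto intro!: sum.cong)
      also have "ennreal K * (\<Sum>n\<in>M. J n) \<le> ennreal K * (\<integral>\<^sup>+\<xi>. ennreal (norm (F \<xi>) powr r) \<partial>lebesgue)"
        by (intro mult_left_mono J_le) auto
      finally show ?thesis unfolding F_eq by (simp add: A_def a_def)
    qed
  qed
  moreover have "K > 0" using K0 e by (simp add: K_def)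
  ultimately show ?thesis using that s(1) by blast
qed

section \<open>Fourier coefficients of bounded functions\<close>

lemma strongly_integrable_torus_scaleC:
  fixes f :: "real^'d::finite \<Rightarrow> 'x::complex_banach"
  assumes f: "strongly_measurable torus f" and fin: "(\<integral>\<^sup>+x. ennreal (norm (f x)) \<partial>torus) < \<infinity>"
    and h: "h \<in> borel_measurable torus" "\<And>x. cmod (h x) \<le> b"
  shows "\<exists>v. has_strong_integral torus (\<lambda>x. h x *\<^sub>C f x) v"
proof (rule strongly_integrableI_bounded[OF complete_measure_torus])
  show "strongly_measurable torus (\<lambda>x. h x *\<^sub>C f x)"
    by (intro strongly_measurable_scaleC strongly_measurable_borel h f)
  have "0 \<le> b" using h(2)[of undefined] by (rule order_trans[OF norm_ge_zero])
  have [measurable]: "(\<lambda>x. norm (f x)) \<in> borel_measurable torus"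
    by (rule strongly_measurable_norm[OF complete_measure_torus f])
  have "(\<integral>\<^sup>+x. ennreal (norm (h x *\<^sub>C f x)) \<partial>torus) \<le> (\<integral>\<^sup>+x. ennreal b * ennreal (norm (f x)) \<partial>torus)"
    using h(2) \<open>0 \<le> b\<close>
    by (intro nn_integral_mono) (auto simp: norm_scaleC ennreal_mult[symmetric] intro!: ennreal_leI mult_right_mono)
  also have "\<dots> < \<infinity>" using fin by (simp add: nn_integral_cmult ennreal_mult_less_top)
  finally show "(\<integral>\<^sup>+x. ennreal (norm (h x *\<^sub>C f x)) \<partial>torus) < \<infinity>" .
qed

lemma borel_measurable_torus_continuous:
  fixes f :: "real^'d::finite \<Rightarrow> 'b::topological_space"
  shows "continuous_on UNIV f \<Longrightarrow> f \<in> borel_measurable torus"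
  unfolding torus_def by (intro measurable_restrict_space1 borel_measurable_lebesgue_continuous)

lemma borel_measurable_torus_character [measurable]: "character n \<in> borel_measurable torus"
  by (rule borel_measurable_torus_continuous) (rule continuous_character[OF continuous_on_id, simplified id_def])

lemma has_strong_integral_fourier_coeff:
  fixes f :: "real^'d::finite \<Rightarrow> 'x::complex_banach"
  assumes "strongly_measurable torus f" "(\<integral>\<^sup>+x. ennreal (norm (f x)) \<partial>torus) < \<infinity>"
  shows "has_strong_integral torus (\<lambda>x. character (- n) x *\<^sub>C f x) (fourier_coeff f n)"
proof -
  obtain v where v: "has_strong_integral torus (\<lambda>x. character (- n) x *\<^sub>C f x) v"
    using strongly_integrable_torus_scaleC[OF assms borel_measurable_torus_character, of "- n" 1] by auto
  then show ?thesis
    using strong_integral_eqI[OF complete_measure_torus v] by (simp add: fourier_coeff_character)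
qed

lemma norm_fourier_coeff_le:
  fixes f :: "real^'d::finite \<Rightarrow> 'x::complex_banach"
  assumes "strongly_measurable torus f" "(\<integral>\<^sup>+x. ennreal (norm (f x)) \<partial>torus) < \<infinity>"
  shows "ennreal (norm (fourier_coeff f n)) \<le> (\<integral>\<^sup>+x. ennreal (norm (f x)) \<partial>torus)"
  using has_strong_integral_norm_bound[OF complete_measure_torus has_strong_integral_fourier_coeff[OF assms]]
  by (simp add: norm_scaleC)

lemma fourier_coeff_add:
  fixes f g :: "real^'d::finite \<Rightarrow> 'x::complex_banach"
  assumes "strongly_measurable torus f" "(\<integral>\<^sup>+x. ennreal (norm (f x)) \<partial>torus) < \<infinity>"
    and "strongly_measurable torus g" "(\<integral>\<^sup>+x. ennreal (norm (g x)) \<partial>torus) < \<infinity>"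
  shows "fourier_coeff (\<lambda>x. f x + g x) n = fourier_coeff f n + fourier_coeff g n"
  using strong_integral_eqI[OF complete_measure_torus has_strong_integral_add[OF complete_measure_torus
    has_strong_integral_fourier_coeff[OF assms(1,2)] has_strong_integral_fourier_coeff[OF assms(3,4)]]]
  by (simp add: fourier_coeff_character scaleC_add_right)

text \<open>The Fejer kernel of a finite set \<open>J\<close> of frequencies is positive because, up to a factor, it is
  a squared modulus.\<close>

definition fejer :: "(int^'d::finite) set \<Rightarrow> real^'d \<Rightarrow> real" where
  "fejer J x = (cmod (\<Sum>j\<in>J. character j x))\<^sup>2 / card J"

lemma fejer_nonneg: "0 \<le> fejer J x"
  by (simp add: fejer_def)

lemma fejer_eq:
  "complex_of_real (fejer J x) = (\<Sum>(j, l)\<in>J \<times> J. character (j - l) x) / of_nat (card J)"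
proof -
  have "complex_of_real ((cmod (\<Sum>j\<in>J. character j x))\<^sup>2) = (\<Sum>j\<in>J. character j x) * (\<Sum>l\<in>J. character l (- x))"
    by (simp add: complex_norm_square cnj_sum cnj_character del: of_real_power)
  also have "\<dots> = (\<Sum>(j, l)\<in>J \<times> J. character j x * character l (- x))"
    by (simp add: sum_product sum.cartesian_product)
  also have "\<dots> = (\<Sum>(j, l)\<in>J \<times> J. character (j - l) x)"
    by (intro sum.cong) (auto simp: character_minus[symmetric] character_mult)
  finally show ?thesis by (simp add: fejer_def)
qed

lemma continuous_fejer: "continuous_on UNIV (\<lambda>x. fejer J (g x))" if "continuous_on UNIV g"
  unfolding fejer_def divide_inverse by (intro continuous_intros that)

text \<open>By orthogonality only the diagonal pairs survive, and there are \<open>card J\<close> of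
  them.\<close>

lemma nn_integral_fejer:
  assumes J: "finite J" "J \<noteq> {}"
  shows "(\<integral>\<^sup>+y. ennreal (fejer J (t - y)) \<partial>(torus :: (real^'d::finite) measure)) = 1"
proof -
  have "has_bochner_integral (torus :: (real^'d) measure)
     (\<lambda>y. (\<Sum>z\<in>J \<times> J. character (fst z - snd z) t * character (snd z - fst z) y) / of_nat (card J))
     ((\<Sum>z\<in>J \<times> J. character (fst z - snd z) t * (if snd z - fst z = 0 then 1 else 0)) / of_nat (card J))"
  proof (intro has_bochner_integral_divide_zero has_bochner_integral_sum)
    fix z
    show "has_bochner_integral (torus :: (real^'d) measure) (\<lambda>y. character (fst z - snd z) t * character (snd z - fst z) y)
       (character (fst z - snd z) t * (if snd z - fst z = 0 then 1 else 0))"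
      by (rule has_bochner_integral_mult_right) (rule has_bochner_integral_character)
  qed
  moreover have "(\<Sum>z\<in>J \<times> J. character (fst z - snd z) t * (if snd z - fst z = 0 then 1 else 0)) = of_nat (card J)"
  proof -
    have "(\<Sum>z\<in>J \<times> J. character (fst z - snd z) t * (if snd z - fst z = 0 then 1 else 0)) = (\<Sum>z\<in>J \<times> J. if snd z = fst z then 1 else 0)"
      by (intro sum.cong) auto
    also have "\<dots> = (\<Sum>j\<in>J. \<Sum>l\<in>J. if l = j then 1 else 0)"
      unfolding sum.cartesian_product split_beta ..
    also have "\<dots> = of_nat (card J)" using J by simp
    finally show ?thesis .
  qed
  moreover have "(\<Sum>z\<in>J \<times> J. character (fst z - snd z) t * character (snd z - fst z) y) / of_nat (card J) = of_real (fejer J (t - y))" for y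
  proof -
    have "character (j - l) t * character (l - j) y = character (j - l) (t - y)" for j l :: "int^'d"
      using character_add[of "j - l" t "- y"] character_minus[of "j - l" y] by simp
    then show ?thesis unfolding fejer_eq split_beta by simp
  qed
  ultimately have "has_bochner_integral (torus :: (real^'d) measure) (\<lambda>y. complex_of_real (fejer J (t - y))) 1"
    using J by simp
  from has_bochner_integral_Re[OF this] show ?thesis
    by (subst nn_integral_eq_integral) (auto simp: has_bochner_integral_iff fejer_nonneg)
qed

text \<open>The point is that the bound depends neither on \<open>J\<close> nor on \<open>y\<close>.
  In the expanded kernel the pair (j, l) contributes a phase times the Gaussian transform
  \<open>E (j - l)\<close>. For fixed j the sum over l is part of a lattice sum, and the
  normalisation of the kernel cancels the sum over j.\<close>

lemma nn_integral_fejer_gaussian: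
  fixes J :: "(int^'d::finite) set"
  assumes J: "finite J" "J \<noteq> {}" and s: "s > 0"
    and \<Gamma>: "\<And>N :: (int^'d) set. finite N \<Longrightarrow> (\<Sum>m\<in>N. exp (- (pi / s) * (norm (ivec m))\<^sup>2)) \<le> \<Gamma>"
  shows "(\<integral>\<^sup>+t. ennreal (fejer J (t - y) * exp (- pi * s * (norm t)\<^sup>2)) \<partial>lebesgue) \<le> ennreal (\<Gamma> / sqrt s ^ CARD('d))"
proof -
  define E where "E = (\<lambda>k::int^'d. exp (- pi * (norm (ivec k :: real^'d))\<^sup>2 / s) / sqrt s ^ CARD('d))"
  define S where "S = (\<Sum>(j, l)\<in>J \<times> J. character (- (j - l)) y * complex_of_real (E (j - l))) / of_nat (card J)"
  have E_nonneg: "0 \<le> E k" for k using s by (simp add: E_def)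
  have cardJ: "card J > 0" using J by (simp add: card_gt_0_iff)
  have "has_bochner_integral lebesgue
     (\<lambda>t::real^'d. (\<Sum>(j, l)\<in>J \<times> J. character (- (j - l)) y * (of_real (exp (- pi * s * (norm (t + 0))\<^sup>2)) * cis (2 * pi * (t \<bullet> ivec (j - l))))) / of_nat (card J)) S"
    unfolding S_def
  proof (intro has_bochner_integral_divide_zero has_bochner_integral_sum)
    fix z assume "z \<in> J \<times> J"
    have "has_bochner_integral lebesgue
      (\<lambda>t::real^'d. of_real (exp (- pi * s * (norm (t + 0))\<^sup>2)) * cis (2 * pi * (t \<bullet> ivec (fst z - snd z)))) (of_real (E (fst z - snd z)))"
      using has_bochner_integral_gaussian[OF s, of 0 "ivec (fst z - snd z)"] by (simp add: E_def)
    from has_bochner_integral_mult_right[OF this, of "character (- (fst z - snd z)) y"]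
    show "has_bochner_integral lebesgue (\<lambda>t::real^'d. case z of (j, l) \<Rightarrow> character (- (j - l)) y * (of_real (exp (- pi * s * (norm (t + 0))\<^sup>2)) * cis (2 * pi * (t \<bullet> ivec (j - l)))))
       (case z of (j, l) \<Rightarrow> character (- (j - l)) y * complex_of_real (E (j - l)))"
      by (simp only: split_beta)
  qed
  moreover have "(\<Sum>(j, l)\<in>J \<times> J. character (- (j - l)) y * (of_real (exp (- pi * s * (norm (t + 0))\<^sup>2)) * cis (2 * pi * (t \<bullet> ivec (j - l))))) / of_nat (card J)
     = of_real (fejer J (t - y) * exp (- pi * s * (norm t)\<^sup>2))" for t
  proof -
    have C0: "character (- (j - l)) y * (of_real (exp (- pi * s * (norm (t + 0))\<^sup>2)) * cis (2 * pi * (t \<bullet> ivec (j - l))))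
      = character (j - l) (t - y) * of_real (exp (- pi * s * (norm t)\<^sup>2))" for j l
    proof -
      have E0: "cis (2 * pi * (t \<bullet> ivec (j - l))) * character (- (j - l)) y = character (j - l) (t - y)"
        unfolding character_minus using character_add[of "j - l" t "- y"] by (simp add: character_def)
      then show ?thesis unfolding E0[symmetric] add_0_right by (simp only: mult_ac)
    qed
    show ?thesis unfolding of_real_mult fejer_eq split_beta C0 sum_distrib_right[symmetric] by simp
  qed
  ultimately have "has_bochner_integral lebesgue (\<lambda>t::real^'d. complex_of_real (fejer J (t - y) * exp (- pi * s * (norm t)\<^sup>2))) S"
    by simp
  from has_bochner_integral_Re[OF this]
  have re: "has_bochner_integral lebesgue (\<lambda>t::real^'d. fejer J (t - y) * exp (- pi * s * (norm t)\<^sup>2)) (Re S)"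
    by (simp only: Re_complex_of_real)
  have "Re S \<le> norm S" by (rule complex_Re_le_cmod)
  also have "norm S \<le> (\<Sum>(j, l)\<in>J \<times> J. E (j - l)) / card J"
  proof -
    have "norm (\<Sum>(j, l)\<in>J \<times> J. character (- (j - l)) y * complex_of_real (E (j - l))) \<le> (\<Sum>(j, l)\<in>J \<times> J. E (j - l))"
      by (rule sum_norm_le) (auto simp: norm_mult E_nonneg)
    then show ?thesis unfolding S_def by (simp add: norm_divide divide_right_mono)
  qed
  also have "\<dots> \<le> (\<Sum>j\<in>J. \<Gamma> / sqrt s ^ CARD('d)) / card J"
  proof (rule divide_right_mono)
    have "(\<Sum>l\<in>J. E (j - l)) \<le> \<Gamma> / sqrt s ^ CARD('d)" for j
    proof -
      have "(\<Sum>l\<in>J. E (j - l)) = (\<Sum>m\<in>(\<lambda>l. j - l) ` J. E m)"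
        by (subst sum.reindex) (auto simp: inj_on_def)
      also have "\<dots> = (\<Sum>m\<in>(\<lambda>l. j - l) ` J. exp (- (pi / s) * (norm (ivec m :: real^'d))\<^sup>2)) / sqrt s ^ CARD('d)"
        by (simp add: E_def sum_divide_distrib)
      also have "\<dots> \<le> \<Gamma> / sqrt s ^ CARD('d)"
        by (intro divide_right_mono \<Gamma>) (use J s in auto)
      finally show ?thesis .
    qed
    then show "(\<Sum>(j, l)\<in>J \<times> J. E (j - l)) \<le> (\<Sum>j\<in>J. \<Gamma> / sqrt s ^ CARD('d))"
      unfolding sum.cartesian_product[symmetric] by (rule sum_mono)
  qed simp
  also have "\<dots> = \<Gamma> / sqrt s ^ CARD('d)" using cardJ by simp
  finally have "Re S \<le> \<Gamma> / sqrt s ^ CARD('d)" .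
  moreover have "(\<integral>\<^sup>+t. ennreal (fejer J (t - y) * exp (- pi * s * (norm t)\<^sup>2)) \<partial>lebesgue) = ennreal (Re S)"
    using re by (subst nn_integral_eq_integral) (auto simp: has_bochner_integral_iff fejer_nonneg)
  ultimately show ?thesis by (simp add: ennreal_leI)
qed

text \<open>Written through Fourier coefficients rather than as a convolution, so that it is visibly
  a trigonometric polynomial and, times a Gaussian, an admissible test function.\<close>

definition fejer_mean :: "(int^'d::finite) set \<Rightarrow> (real^'d \<Rightarrow> 'x::complex_banach) \<Rightarrow> real^'d \<Rightarrow> 'x" where
  "fejer_mean J f t = (\<Sum>(j, l)\<in>J \<times> J. (character (j - l) t / of_nat (card J)) *\<^sub>C fourier_coeff f (j - l))"

text \<open>Inserting the integrals that define the coefficients gives the convolution form;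
  positivity of the kernel then lets the norm pass under the integral without loss.\<close>

lemma norm_fejer_mean_le:
  fixes f :: "real^'d::finite \<Rightarrow> 'x::complex_banach"
  assumes f: "strongly_measurable torus f" "(\<integral>\<^sup>+x. ennreal (norm (f x)) \<partial>torus) < \<infinity>"
  shows "ennreal (norm (fejer_mean J f t)) \<le> (\<integral>\<^sup>+y. ennreal (norm (f y) * fejer J (t - y)) \<partial>torus)"
proof -
  have "has_strong_integral torus (\<lambda>y. \<Sum>z\<in>J \<times> J. (character (fst z - snd z) t / of_nat (card J)) *\<^sub>C character (- (fst z - snd z)) y *\<^sub>C f y)
     (fejer_mean J f t)"
    unfolding fejer_mean_def split_beta
    by (rule has_strong_integral_sum[OF complete_measure_torus])
      (rule has_strong_integral_bounded_linear[OF complete_measure_torus has_strong_integral_fourier_coeff[OF f] scaleC.bounded_linear_right])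
  moreover have "(\<Sum>z\<in>J \<times> J. (character (fst z - snd z) t / of_nat (card J)) *\<^sub>C character (- (fst z - snd z)) y *\<^sub>C f y)
      = of_real (fejer J (t - y)) *\<^sub>C f y" for y
  proof -
    have k: "(character k t / of_nat (card J)) * character (- k) y = character k (t - y) / of_nat (card J)" for k :: "int^'d"
      unfolding character_minus using character_add[of k t "- y"] by simp
    show ?thesis
      unfolding fejer_eq split_beta sum_divide_distrib scaleC.sum_left scaleC_scaleC k ..
  qed
  ultimately have "has_strong_integral torus (\<lambda>y. of_real (fejer J (t - y)) *\<^sub>C f y) (fejer_mean J f t)"
    by simp
  from has_strong_integral_norm_bound[OF complete_measure_torus this] show ?thesis
    by (simp add: norm_scaleC fejer_nonneg mult.commute)
qed

text \<open>The kernel is a probability density in \<open>y\<close>, so the power mean inequality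
  bounds the p-th power of the mean by the mean of the p-th powers. Interchanging the integrals
  leaves the kernel integrated against the Gaussian, which is uniformly bounded.\<close>

lemma fejer_mean_powr_integral:
  fixes f :: "real^'d::finite \<Rightarrow> 'x::complex_banach"
  assumes p: "1 < p" and J: "finite J" "J \<noteq> {}" and s: "s > 0"
    and \<Gamma>: "\<And>N :: (int^'d) set. finite N \<Longrightarrow> (\<Sum>m\<in>N. exp (- (pi / s) * (norm (ivec m))\<^sup>2)) \<le> \<Gamma>"
    and f: "strongly_measurable torus f" and bdd: "\<And>x. norm (f x) \<le> b"
  shows "(\<integral>\<^sup>+t. ennreal (norm (fejer_mean J f t) powr p) * ennreal (exp (- pi * s * (norm t)\<^sup>2)) \<partial>lebesgue)
    \<le> ennreal (\<Gamma> / sqrt s ^ CARD('d)) * (\<integral>\<^sup>+x. ennreal (norm (f x) powr p) \<partial>torus)"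
proof -
  interpret prob_space "torus :: (real^'d) measure" by (rule prob_space_torus)
  have b: "b \<ge> 0" using bdd[of undefined] norm_ge_zero order_trans by blast
  have fm [measurable]: "(\<lambda>x. norm (f x)) \<in> borel_measurable torus"
    by (rule strongly_measurable_norm[OF complete_measure_torus f])
  have "(\<integral>\<^sup>+x. ennreal (norm (f x)) \<partial>torus) \<le> (\<integral>\<^sup>+x. ennreal b \<partial>(torus :: (real^'d) measure))"
    by (intro nn_integral_mono ennreal_leI bdd)
  also have "\<dots> < \<infinity>" by (simp add: emeasure_space_1)
  finally have fin: "(\<integral>\<^sup>+x. ennreal (norm (f x)) \<partial>torus) < \<infinity>" .
  have fejm [measurable]: "(\<lambda>y. fejer J (t - y)) \<in> borel_measurable torus" for t
    by (intro borel_measurable_torus_continuous continuous_fejer continuous_intros)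
  define T where "T = (\<lambda>t. \<integral>\<^sup>+y. ennreal (norm (f y) powr p * fejer J (t - y)) \<partial>torus)"
  have pt: "ennreal (norm (fejer_mean J f t) powr p) \<le> T t" for t
  proof -
    \<comment> \<open>Boundedness of \<open>f\<close> makes \<open>T t\<close> finite, so that it
      can be handled as a real number.\<close>
    have "T t \<le> (\<integral>\<^sup>+y. ennreal (b powr p) * ennreal (fejer J (t - y)) \<partial>torus)"
      unfolding T_def using p bdd
      by (intro nn_integral_mono) (auto intro!: ennreal_leI mult_right_mono powr_mono2 fejer_nonneg simp: ennreal_mult[symmetric] fejer_nonneg)
    also have "\<dots> = ennreal (b powr p)"
      by (simp add: nn_integral_cmult nn_integral_fejer[OF J])
    finally have "T t \<noteq> top" by (auto simp: top_unique)
    define u where "u = enn2real (T t)"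
    have u: "T t = ennreal u" "u \<ge> 0" using \<open>T t \<noteq> top\<close> by (auto simp: u_def less_top)
    have "ennreal (norm (fejer_mean J f t)) \<le> (\<integral>\<^sup>+y. ennreal (norm (f y) * fejer J (t - y)) \<partial>torus)"
      by (rule norm_fejer_mean_le[OF f fin])
    also have "\<dots> \<le> ennreal ((1 powr (p - 1) * u) powr (1 / p))"
      using u(1) u(2) by (intro nn_integral_power_mean p) (auto simp: fejer_nonneg nn_integral_fejer[OF J] T_def)
    finally have "norm (fejer_mean J f t) \<le> u powr (1 / p)" by simp
    then have "norm (fejer_mean J f t) powr p \<le> (u powr (1 / p)) powr p"
      using p by (intro powr_mono2) auto
    then show ?thesis using p u by (simp add: powr_powr ennreal_leI)
  qed
  \<comment> \<open>Fubini's theorem is applied with \<open>lborel\<close> in the first factor,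
    where joint measurability follows from continuity; nonnegative integrals do not change under the
    completion.\<close>
  interpret pair_sigma_finite "lborel :: (real^'d) measure" "torus :: (real^'d) measure" ..
  have m1 [measurable]: "(\<lambda>z. fejer J (fst z - snd z)) \<in> borel_measurable (lborel \<Otimes>\<^sub>M torus)"
  proof -
    have "(\<lambda>z::(real^'d) \<times> (real^'d). fejer J (fst z - snd z)) \<in> borel_measurable borel"
      by (intro borel_measurable_continuous_onI continuous_fejer continuous_intros)
    then have "(\<lambda>z::(real^'d) \<times> (real^'d). fejer J (fst z - snd z)) \<in> borel_measurable (borel \<Otimes>\<^sub>M borel)"
      by (simp add: borel_prod)
    moreover have "(\<lambda>z. z) \<in> (lborel \<Otimes>\<^sub>M (torus :: (real^'d) measure)) \<rightarrow>\<^sub>M (borel \<Otimes>\<^sub>M borel :: ((real^'d) \<times> (real^'d)) measure)"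
    proof -
      have 1: "(\<lambda>x. x) \<in> (lborel :: (real^'d) measure) \<rightarrow>\<^sub>M borel" by simp
      have 2: "(\<lambda>x. x) \<in> (torus :: (real^'d) measure) \<rightarrow>\<^sub>M borel"
        by (rule borel_measurable_torus_continuous) (rule continuous_on_id)
      have "(\<lambda>z. (fst z, snd z)) \<in> (lborel \<Otimes>\<^sub>M (torus :: (real^'d) measure)) \<rightarrow>\<^sub>M (borel \<Otimes>\<^sub>M borel :: ((real^'d) \<times> (real^'d)) measure)"
        by (intro measurable_Pair measurable_compose[OF measurable_fst 1] measurable_compose[OF measurable_snd 2])
      then show ?thesis by simp
    qed
    ultimately show ?thesis by (rule measurable_compose[rotated])
  qed
  have m2 [measurable]: "(\<lambda>t::real^'d. exp (- pi * s * (norm t)\<^sup>2)) \<in> borel_measurable borel"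
    by (intro borel_measurable_continuous_onI continuous_intros)
  have m3 [measurable]: "(\<lambda>t. fejer J (t - y)) \<in> borel_measurable borel" for y
    by (intro borel_measurable_continuous_onI continuous_fejer continuous_intros)
  have meas: "(\<lambda>(t, y). ennreal (norm (f y) powr p * fejer J (t - y)) * ennreal (exp (- pi * s * (norm t)\<^sup>2))) \<in> borel_measurable (lborel \<Otimes>\<^sub>M torus)"
    unfolding split_beta by measurable
  have "(\<integral>\<^sup>+t. ennreal (norm (fejer_mean J f t) powr p) * ennreal (exp (- pi * s * (norm t)\<^sup>2)) \<partial>lebesgue)
     \<le> (\<integral>\<^sup>+t. T t * ennreal (exp (- pi * s * (norm t)\<^sup>2)) \<partial>lborel)"
    unfolding nn_integral_completion by (intro nn_integral_mono mult_right_mono pt) auto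
  also have "\<dots> = (\<integral>\<^sup>+t. \<integral>\<^sup>+y. ennreal (norm (f y) powr p * fejer J (t - y)) * ennreal (exp (- pi * s * (norm t)\<^sup>2)) \<partial>torus \<partial>lborel)"
    unfolding T_def by (subst nn_integral_multc) auto
  also have "\<dots> = (\<integral>\<^sup>+y. \<integral>\<^sup>+t. ennreal (norm (f y) powr p * fejer J (t - y)) * ennreal (exp (- pi * s * (norm t)\<^sup>2)) \<partial>lborel \<partial>torus)"
    using Fubini[OF meas] by simp
  also have "\<dots> = (\<integral>\<^sup>+y. ennreal (norm (f y) powr p) * (\<integral>\<^sup>+t. ennreal (fejer J (t - y) * exp (- pi * s * (norm t)\<^sup>2)) \<partial>lborel) \<partial>torus)"
    by (subst nn_integral_cmult[symmetric]) (auto simp: ennreal_mult fejer_nonneg mult.assoc)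
  also have "\<dots> \<le> (\<integral>\<^sup>+y. ennreal (norm (f y) powr p) * ennreal (\<Gamma> / sqrt s ^ CARD('d)) \<partial>torus)"
    by (intro nn_integral_mono mult_left_mono nn_integral_fejer_gaussian[OF J s \<Gamma>, unfolded nn_integral_completion]) auto
  also have "\<dots> = ennreal (\<Gamma> / sqrt s ^ CARD('d)) * (\<integral>\<^sup>+x. ennreal (norm (f x) powr p) \<partial>torus)"
    by (subst nn_integral_multc) (auto simp: mult.commute)
  finally show ?thesis .
qed

text \<open>For \<open>l\<close> in the middle cube with coordinates in {L..<3L}, both
  \<open>l\<close> and \<open>l + n\<close> lie in \<open>J\<close>, and the middle cube contains
  the fraction 2^(-d) of the points of \<open>J\<close>. Hence the Fejer weight of every such
  frequency is at least 2^(-d).\<close>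

lemma card_difference_box:
  fixes n :: "int^'d::finite" and L :: int
  assumes "\<And>i. \<bar>n $ i\<bar> \<le> L"
  defines "J \<equiv> {m::int^'d. \<forall>i. m $ i \<in> {0..<4 * L}}"
  shows "card J \<le> 2 ^ CARD('d) * card {z \<in> J \<times> J. fst z - snd z = n}"
proof -
  have L: "L \<ge> 0" by (rule order_trans[OF abs_ge_zero assms(1)[of undefined]])
  have fin: "finite J" unfolding J_def by (rule finite_vec_box) simp
  let ?I = "{m::int^'d. \<forall>i. m $ i \<in> {L..<3 * L}}"
  have "(\<lambda>l. (l + n, l)) ` ?I \<subseteq> {z \<in> J \<times> J. fst z - snd z = n}"
  proof
    fix z assume "z \<in> (\<lambda>l. (l + n, l)) ` ?I"
    then obtain l where l: "z = (l + n, l)" "\<And>i. L \<le> l $ i" "\<And>i. l $ i < 3 * L" by auto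
    have n: "- L \<le> n $ i" "n $ i \<le> L" for i using assms(1)[of i] by linarith+
    have "0 \<le> l $ i + n $ i" "l $ i + n $ i < 4 * L" "0 \<le> l $ i" "l $ i < 4 * L" for i
      using l(2)[of i] l(3)[of i] n[of i] L by linarith+
    then show "z \<in> {z \<in> J \<times> J. fst z - snd z = n}" by (simp add: l(1) J_def)
  qed
  then have "card ((\<lambda>l. (l + n, l)) ` ?I) \<le> card {z \<in> J \<times> J. fst z - snd z = n}"
    using fin by (intro card_mono finite_subset[OF _ finite_cartesian_product[of J J]]) auto
  moreover have "card ((\<lambda>l. (l + n, l)) ` ?I) = card ?I"
    by (rule card_image) (auto simp: inj_on_def)
  moreover have "card ?I = nat (2 * L) ^ CARD('d)"
    by (subst card_vec_box) auto
  moreover have "card J = nat (4 * L) ^ CARD('d)"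
    unfolding J_def by (subst card_vec_box) auto
  moreover have "nat (4 * L) = 2 * nat (2 * L)" using L by (simp add: nat_mult_distrib)
  ultimately show ?thesis by (simp add: power_mult_distrib)
qed

text \<open>Fourier type is applied to a Fejer mean times a Gaussian. The p-th power integral of
  this function is controlled by that of \<open>f\<close>, whatever the set \<open>J\<close>, and
  sampling its transform near lattice points recovers the weighted coefficients. Enlarging
  \<open>J\<close> with \<open>N\<close> makes the weights on \<open>N\<close> bounded below, at no
  cost in the constant.\<close>

lemma fourier_type_torus:
  fixes D p :: real
  assumes p: "1 < p" and D: "0 < D"
    and type: "\<And>(f :: real^'d::finite \<Rightarrow> 'x::complex_banach) y. schwartz f \<Longrightarrow> 0 \<le> y \<Longrightarrow>
      (\<integral>\<^sup>+x. ennreal (norm (f x) powr p) \<partial>lebesgue) \<le> ennreal y \<Longrightarrow>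
      (\<integral>\<^sup>+x. ennreal (norm (fourier_transform f x) powr (p / (p - 1))) \<partial>lebesgue)
        \<le> ennreal (D * y powr (1 / (p - 1)))"
  obtains K where "0 < K" "\<And>(f :: real^'d \<Rightarrow> 'x) b y N. strongly_measurable torus f \<Longrightarrow> (\<And>x. norm (f x) \<le> b) \<Longrightarrow>
      0 \<le> y \<Longrightarrow> (\<integral>\<^sup>+x. ennreal (norm (f x) powr p) \<partial>torus) \<le> ennreal y \<Longrightarrow> finite N \<Longrightarrow>
      (\<Sum>n\<in>N. norm (fourier_coeff f n) powr (p / (p - 1))) \<le> K * y powr (1 / (p - 1))"
proof -
  define r where "r = p / (p - 1)"
  have r: "r > 1" using p by (simp add: r_def field_simps)
  obtain s K1 :: real where s: "s > 0" and K1: "K1 > 0"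
    "\<And>(M :: (int^'d) set) (c :: int^'d \<Rightarrow> 'x). finite M \<Longrightarrow> ennreal (\<Sum>n\<in>M. norm (c n) powr r)
        \<le> ennreal K1 * (\<integral>\<^sup>+\<xi>. ennreal (norm (\<Sum>m\<in>M. exp (- pi * (norm (\<xi> - ivec m))\<^sup>2 / s) *\<^sub>R c m) powr r) \<partial>lebesgue)"
    by (rule gaussian_sampling[OF r, where 'd='d and 'x='x]) blast
  \<comment> \<open>The p-th power of the Gaussian with parameter \<open>s\<close> is the one with
    parameter \<open>s * p\<close>.\<close>
  define sp where "sp = s * p"
  have sp: "sp > 0" using s p by (simp add: sp_def)
  obtain \<Gamma> where \<Gamma>: "\<Gamma> > 0" "\<And>N :: (int^'d) set. finite N \<Longrightarrow> (\<Sum>m\<in>N. exp (- (pi / sp) * (norm (ivec m))\<^sup>2)) \<le> \<Gamma>"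
    using lattice_gaussian_sum_bounded[of "pi / sp", where 'd='d] sp by (metis divide_pos_pos pi_gt_zero)
  define \<sigma> where "\<sigma> = sqrt s ^ CARD('d)"
  have \<sigma>: "\<sigma> > 0" using s by (simp add: \<sigma>_def)
  define G where "G = \<Gamma> / sqrt sp ^ CARD('d)"
  have G: "G > 0" using \<Gamma> sp by (simp add: G_def)
  define K where "K = (2 ^ CARD('d)) powr r * (K1 * (\<sigma> powr r * (D * G powr (1 / (p - 1)))))"
  have K: "K > 0" using K1 D \<sigma> G by (simp add: K_def)
  have bound: "(\<Sum>n\<in>N. norm (fourier_coeff f n) powr r) \<le> K * y powr (1 / (p - 1))"
    if f: "strongly_measurable torus f" and bdd: "\<And>x. norm (f x) \<le> b" and y: "0 \<le> y"
      "(\<integral>\<^sup>+x. ennreal (norm (f x) powr p) \<partial>torus) \<le> ennreal y" and N: "finite N"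
    for f :: "real^'d \<Rightarrow> 'x" and b y N
  proof -
    obtain L :: int where L: "L \<ge> 1" "\<And>n i. n \<in> N \<Longrightarrow> \<bar>n $ i\<bar> \<le> L"
      using finite_int_vec_bounded[OF N] by blast
    \<comment> \<open>Side \<open>4 * L\<close> is what \<open>card_difference_box\<close> needs to
      give the frequencies of \<open>N\<close> weight at least 2^(-d).\<close>
    define J where "J = {m::int^'d. \<forall>i. m $ i \<in> {0..<4 * L}}"
    have J: "finite J" unfolding J_def by (rule finite_vec_box) simp
    have "0 \<in> J" using L(1) by (simp add: J_def)
    then have J0: "J \<noteq> {}" by auto
    have cardJ: "card J > 0" using J J0 by (simp add: card_gt_0_iff)
    define M where "M = (\<lambda>z. fst z - snd z) ` (J \<times> J)"
    have M: "finite M" using J by (simp add: M_def)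
    \<comment> \<open>The Fejer weight of the frequency \<open>k\<close>: how often it occurs as a
      difference of elements of \<open>J\<close>, divided by \<open>card J\<close>.\<close>
    define \<omega> where "\<omega> = (\<lambda>k. real (card {z \<in> J \<times> J. fst z - snd z = k}) / card J)"
    define c where "c = (\<lambda>k. \<omega> k *\<^sub>R fourier_coeff f k)"
    have P: "fejer_mean J f t = (\<Sum>k\<in>M. character k t *\<^sub>C c k)" for t
    proof -
      have "fejer_mean J f t = (\<Sum>k\<in>M. \<Sum>z\<in>{z \<in> J \<times> J. fst z - snd z = k}. (character (fst z - snd z) t / of_nat (card J)) *\<^sub>C fourier_coeff f (fst z - snd z))"
        unfolding fejer_mean_def split_beta using J M by (intro sum.group[symmetric]) (auto simp: M_def)
      also have "\<dots> = (\<Sum>k\<in>M. \<Sum>z\<in>{z \<in> J \<times> J. fst z - snd z = k}. (character k t / of_nat (card J)) *\<^sub>C fourier_coeff f k)"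
        by (intro sum.cong) auto
      also have "\<dots> = (\<Sum>k\<in>M. character k t *\<^sub>C c k)"
      proof (rule sum.cong[OF refl])
        fix k
        have "real m *\<^sub>R (z / of_nat l) *\<^sub>C v = z *\<^sub>C (real m / real l) *\<^sub>R v" for m l z and v :: 'x
          by (simp add: scaleC_of_real[symmetric] scaleC_scaleC mult.commute)
        then show "(\<Sum>z\<in>{z \<in> J \<times> J. fst z - snd z = k}. (character k t / of_nat (card J)) *\<^sub>C fourier_coeff f k) = character k t *\<^sub>C c k"
          by (simp add: c_def \<omega>_def sum_constant_scaleR)
      qed
      finally show ?thesis .
    qed
    define g where "g = (\<lambda>t::real^'d. \<Sum>k\<in>M. (of_real (exp (- pi * s * (norm (t + 0))\<^sup>2)) * character k t) *\<^sub>C c k)"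
    have g: "schwartz g"
      unfolding g_def
    proof (rule schwartz_gauss_poly[OF gauss_poly_sum])
      fix k
      show "gauss_poly (pi * s) (\<lambda>t. (of_real (exp (- pi * s * (norm (t + 0))\<^sup>2)) * character k t) *\<^sub>C c k)"
        using gauss_poly_shifted[of "pi * s" 0 k "c k"] by (simp only: mult_minus_left)
    qed (use s in simp)
    have g_eq: "g t = exp (- pi * s * (norm t)\<^sup>2) *\<^sub>R fejer_mean J f t" for t
      unfolding g_def P scaleR_sum_right by (simp add: scaleC_of_real[symmetric] scaleC_scaleC)
    have "(\<integral>\<^sup>+t. ennreal (norm (g t) powr p) \<partial>lebesgue)
        = (\<integral>\<^sup>+t. ennreal (norm (fejer_mean J f t) powr p) * ennreal (exp (- pi * sp * (norm t)\<^sup>2)) \<partial>lebesgue)"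
    proof (rule nn_integral_cong)
      fix t :: "real^'d"
      have "exp (- pi * s * (norm t)\<^sup>2) powr p = exp (- pi * sp * (norm t)\<^sup>2)"
        by (simp add: powr_def sp_def)
      then have "norm (g t) powr p = norm (fejer_mean J f t) powr p * exp (- pi * sp * (norm t)\<^sup>2)"
        unfolding g_eq norm_scaleR by (simp add: powr_mult mult.commute)
      then show "ennreal (norm (g t) powr p) = ennreal (norm (fejer_mean J f t) powr p) * ennreal (exp (- pi * sp * (norm t)\<^sup>2))"
        by (simp add: ennreal_mult)
    qed
    also have "\<dots> \<le> ennreal G * (\<integral>\<^sup>+x. ennreal (norm (f x) powr p) \<partial>torus)"
      unfolding G_def by (rule fejer_mean_powr_integral[OF p J J0 sp \<Gamma>(2) f bdd])
    also have "\<dots> \<le> ennreal G * ennreal y" by (intro mult_left_mono y) simp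
    also have "\<dots> = ennreal (G * y)" using G y by (simp add: ennreal_mult)
    finally have gy: "(\<integral>\<^sup>+t. ennreal (norm (g t) powr p) \<partial>lebesgue) \<le> ennreal (G * y)" .
    have ghat: "norm (\<Sum>m\<in>M. exp (- pi * (norm (\<xi> - ivec m))\<^sup>2 / s) *\<^sub>R c m) = \<sigma> * norm (fourier_transform g \<xi>)" for \<xi>
    proof -
      have "fourier_transform g \<xi> = (\<Sum>k\<in>M. (cis (2 * pi * ((0::real^'d) \<bullet> (\<xi> - ivec k))) * of_real (exp (- pi * (norm (\<xi> - ivec k))\<^sup>2 / s) / \<sigma>)) *\<^sub>C c k)"
        unfolding g_def \<sigma>_def by (rule fourier_transform_gaussian_sum[OF s])
      also have "\<dots> = (\<Sum>k\<in>M. (1 / \<sigma>) *\<^sub>R exp (- pi * (norm (\<xi> - ivec k))\<^sup>2 / s) *\<^sub>R c k)"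
      proof (rule sum.cong[OF refl])
        fix k
        have "(cis (2 * pi * ((0::real^'d) \<bullet> (\<xi> - ivec k))) * of_real (e / \<sigma>)) *\<^sub>C v = (1 / \<sigma>) *\<^sub>R e *\<^sub>R v" for e and v :: 'x
          by (simp add: scaleC_of_real[symmetric] scaleC_scaleC)
        then show "(cis (2 * pi * ((0::real^'d) \<bullet> (\<xi> - ivec k))) * of_real (exp (- pi * (norm (\<xi> - ivec k))\<^sup>2 / s) / \<sigma>)) *\<^sub>C c k
          = (1 / \<sigma>) *\<^sub>R exp (- pi * (norm (\<xi> - ivec k))\<^sup>2 / s) *\<^sub>R c k" .
      qed
      also have "\<dots> = (1 / \<sigma>) *\<^sub>R (\<Sum>m\<in>M. exp (- pi * (norm (\<xi> - ivec m))\<^sup>2 / s) *\<^sub>R c m)"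
        by (rule scaleR_sum_right[symmetric])
      finally show ?thesis using \<sigma> by simp
    qed
    have "(\<integral>\<^sup>+\<xi>. ennreal ((\<sigma> * norm (fourier_transform g \<xi>)) powr r) \<partial>lebesgue)
        = ennreal (\<sigma> powr r) * (\<integral>\<^sup>+\<xi>. ennreal (norm (fourier_transform g \<xi>) powr r) \<partial>lebesgue)"
    proof (subst nn_integral_cmult[symmetric])
      have "norm (fourier_transform g \<xi>) = norm (\<Sum>m\<in>M. exp (- pi * (norm (\<xi> - ivec m))\<^sup>2 / s) *\<^sub>R c m) / \<sigma>" for \<xi>
        unfolding ghat using \<sigma> by simp
      moreover have "continuous_on UNIV (\<lambda>\<xi>::real^'d. norm (\<Sum>m\<in>M. exp (- pi * (norm (\<xi> - ivec m))\<^sup>2 / s) *\<^sub>R c m) / \<sigma>)"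
        using s \<sigma> by (intro continuous_intros) auto
      ultimately have "continuous_on UNIV (\<lambda>\<xi>. norm (fourier_transform g \<xi>))" by simp
      from borel_measurable_lebesgue_continuous[OF this]
      show "(\<lambda>\<xi>. ennreal (norm (fourier_transform g \<xi>) powr r)) \<in> borel_measurable lebesgue" by simp
    qed (use \<sigma> in \<open>simp add: powr_mult ennreal_mult\<close>)
    also have "\<dots> \<le> ennreal (\<sigma> powr r) * ennreal (D * (G * y) powr (1 / (p - 1)))"
      unfolding r_def by (intro mult_left_mono type g gy) (use G y in auto)
    finally have I: "(\<integral>\<^sup>+\<xi>. ennreal ((\<sigma> * norm (fourier_transform g \<xi>)) powr r) \<partial>lebesgue)
        \<le> ennreal (\<sigma> powr r) * ennreal (D * (G * y) powr (1 / (p - 1)))" .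
    have "ennreal (\<Sum>n\<in>M. norm (c n) powr r) \<le> ennreal K1 * (\<integral>\<^sup>+\<xi>. ennreal ((\<sigma> * norm (fourier_transform g \<xi>)) powr r) \<partial>lebesgue)"
      using K1(2)[OF M, of c] unfolding ghat .
    also have "\<dots> \<le> ennreal K1 * (ennreal (\<sigma> powr r) * ennreal (D * (G * y) powr (1 / (p - 1))))"
      by (rule mult_left_mono[OF I]) simp
    also have "\<dots> = ennreal (K1 * (\<sigma> powr r * (D * (G * y) powr (1 / (p - 1)))))"
      using K1(1) D by (simp add: ennreal_mult)
    finally have "ennreal (\<Sum>n\<in>M. norm (c n) powr r) \<le> ennreal (K1 * (\<sigma> powr r * (D * (G * y) powr (1 / (p - 1)))))" .
    then have cM: "(\<Sum>n\<in>M. norm (c n) powr r) \<le> K1 * (\<sigma> powr r * (D * (G * y) powr (1 / (p - 1))))"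
      using K1(1) D by (subst (asm) ennreal_le_iff) auto
    have wn: "1 \<le> 2 ^ CARD('d) * \<omega> n" if "n \<in> N" for n
    proof -
      have "card J \<le> 2 ^ CARD('d) * card {z \<in> J \<times> J. fst z - snd z = n}"
        unfolding J_def by (rule card_difference_box) (rule L(2)[OF that])
      then have "real (card J) \<le> real (2 ^ CARD('d) * card {z \<in> J \<times> J. fst z - snd z = n})"
        by (rule of_nat_mono)
      also have "\<dots> = 2 ^ CARD('d) * real (card {z \<in> J \<times> J. fst z - snd z = n})"
        by (simp only: of_nat_mult of_nat_power of_nat_numeral)
      finally have "real (card J) \<le> 2 ^ CARD('d) * real (card {z \<in> J \<times> J. fst z - snd z = n})" .
      then have "real (card J) / real (card J) \<le> 2 ^ CARD('d) * real (card {z \<in> J \<times> J. fst z - snd z = n}) / real (card J)"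
        by (rule divide_right_mono) simp
      then show ?thesis using cardJ unfolding \<omega>_def by simp
    qed
    have "N \<subseteq> M"
    proof
      fix n assume "n \<in> N"
      have "{z \<in> J \<times> J. fst z - snd z = n} \<noteq> {}"
      proof
        assume "{z \<in> J \<times> J. fst z - snd z = n} = {}"
        then have "\<omega> n = 0" unfolding \<omega>_def by (simp only: card.empty)
        with wn[OF \<open>n \<in> N\<close>] show False by simp
      qed
      then obtain z where "z \<in> J \<times> J" "fst z - snd z = n" by blast
      then show "n \<in> M" unfolding M_def by blast
    qed
    have "(\<Sum>n\<in>N. norm (fourier_coeff f n) powr r) \<le> (\<Sum>n\<in>N. (2 ^ CARD('d)) powr r * norm (c n) powr r)"
    proof (rule sum_mono)
      fix n assume n: "n \<in> N"
      have "1 * norm (fourier_coeff f n) \<le> (2 ^ CARD('d) * \<omega> n) * norm (fourier_coeff f n)"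
        by (intro mult_right_mono wn n) simp
      also have "\<dots> = 2 ^ CARD('d) * norm (c n)" by (simp add: c_def \<omega>_def)
      finally have "norm (fourier_coeff f n) powr r \<le> (2 ^ CARD('d) * norm (c n)) powr r"
        using r by (intro powr_mono2) auto
      then show "norm (fourier_coeff f n) powr r \<le> (2 ^ CARD('d)) powr r * norm (c n) powr r"
        by (simp add: powr_mult)
    qed
    also have "\<dots> \<le> (\<Sum>n\<in>M. (2 ^ CARD('d)) powr r * norm (c n) powr r)"
      by (intro sum_mono2 M \<open>N \<subseteq> M\<close>) auto
    also have "\<dots> \<le> (2 ^ CARD('d)) powr r * (K1 * (\<sigma> powr r * (D * (G * y) powr (1 / (p - 1)))))"
      unfolding sum_distrib_left[symmetric] by (intro mult_left_mono cM) simp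
    also have "\<dots> = K * y powr (1 / (p - 1))"
      using G y by (simp add: K_def powr_mult)
    finally show ?thesis .
  qed
  show ?thesis by (rule that[OF K]) (rule bound[unfolded r_def])
qed

section \<open>Dyadic sums\<close>

text \<open>Treats both signs of the exponent together: the lower bound on \<open>x\<close> serves
  nonnegative \<open>c\<close>, the upper bound negative \<open>c\<close>.\<close>

lemma powr_two_sided:
  fixes x y k c :: real
  assumes "0 < y" "1 \<le> k" "y / k \<le> x" "x \<le> k * y"
  shows "k powr (- \<bar>c\<bar>) * y powr c \<le> x powr c"
proof (cases "c \<ge> 0")
  case True
  have "k powr (- \<bar>c\<bar>) * y powr c = (y / k) powr c"
    using True assms by (simp add: powr_divide powr_minus_divide)
  also have "\<dots> \<le> x powr c" using True assms by (intro powr_mono2) auto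
  finally show ?thesis .
next
  case False
  have "0 < x" using assms by (meson divide_pos_pos less_le_trans zero_less_one)
  have "k powr (- \<bar>c\<bar>) * y powr c = (k * y) powr c"
    using False assms by (simp add: powr_mult)
  also have "\<dots> \<le> x powr c" using False assms \<open>0 < x\<close> by (intro powr_mono2') auto
  finally show ?thesis .
qed

text \<open>By the mean value theorem the summand is comparable to the increment of
  \<open>F\<close>, the factor \<open>2 powr \<bar>s\<bar>\<close> coming from the position of the
  intermediate point between 1 + i and 2 + i. The increments telescope: \<open>F\<close> decreases
  to be summed over a tail if s > 1, and increases to be summed over a head if s < 1.\<close>

lemma power_sum_bound:
  fixes s :: real
  assumes "s \<noteq> 1"
  obtains C where "C > 0" "\<And>(I::nat) A. finite A \<Longrightarrow> (s > 1 \<Longrightarrow> A \<subseteq> {I..}) \<Longrightarrow> (s < 1 \<Longrightarrow> A \<subseteq> {..I}) \<Longrightarrow>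
    (\<Sum>i\<in>A. (1 + real i) powr (- s)) \<le> C * (1 + real I) powr (1 - s)"
proof -
  define F where "F = (\<lambda>i::nat. (1 + real i) powr (1 - s))"
  define C where "C = 2 powr \<bar>s\<bar> / \<bar>1 - s\<bar>"
  have C: "C > 0" using assms by (simp add: C_def)
  have step: "(1 + real i) powr (- s) \<le> C * \<bar>F (Suc i) - F i\<bar>" for i
  proof -
    have "\<exists>z>1 + real i. z < 2 + real i \<and> (2 + real i) powr (1 - s) - (1 + real i) powr (1 - s) = (2 + real i - (1 + real i)) * ((1 - s) * z powr (- s))"
      by (rule MVT2) (use has_real_derivative_powr[of _ "1 - s"] in auto)
    then obtain z where z: "1 + real i < z" "z < 2 + real i"
      "(2 + real i) powr (1 - s) - (1 + real i) powr (1 - s) = (1 - s) * z powr (- s)" by auto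
    then have "\<bar>F (Suc i) - F i\<bar> = \<bar>1 - s\<bar> * z powr (- s)" by (simp add: F_def abs_mult)
    moreover have "2 powr (- \<bar>- s\<bar>) * (1 + real i) powr (- s) \<le> z powr (- s)"
      using z by (intro powr_two_sided) auto
    ultimately have "\<bar>1 - s\<bar> * (2 powr (- \<bar>- s\<bar>) * (1 + real i) powr (- s)) \<le> \<bar>F (Suc i) - F i\<bar>"
      by (simp add: mult_left_mono)
    then have "C * (\<bar>1 - s\<bar> * (2 powr (- \<bar>- s\<bar>) * (1 + real i) powr (- s))) \<le> C * \<bar>F (Suc i) - F i\<bar>"
      using C by (intro mult_left_mono) auto
    also have "C * (\<bar>1 - s\<bar> * (2 powr (- \<bar>- s\<bar>) * (1 + real i) powr (- s))) = (1 + real i) powr (- s)"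
      using assms by (simp add: C_def powr_minus_divide)
    finally show ?thesis .
  qed
  \<comment> \<open>The head telescopes to \<open>F (Suc I)\<close>; the extra factor brings it back
    to the argument \<open>1 + real I\<close>.\<close>
  define C' where "C' = C * 2 powr \<bar>1 - s\<bar>"
  have C': "C' > 0" using C by (simp add: C'_def)
  have bound: "(\<Sum>i\<in>A. (1 + real i) powr (- s)) \<le> C' * (1 + real I) powr (1 - s)"
    if A: "finite A" "s > 1 \<Longrightarrow> A \<subseteq> {I..}" "s < 1 \<Longrightarrow> A \<subseteq> {..I}" for I A
  proof (cases "s > 1")
    case True
    obtain J where J: "A \<subseteq> {..<J}" using A(1) finite_nat_iff_bounded by blast
    define J' where "J' = max I J"
    have sub: "A \<subseteq> {I..<J'}" using A(2)[OF True] J by (fastforce simp: J'_def)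
    have mono: "F (Suc i) \<le> F i" for i using True by (simp add: F_def powr_mono2')
    have "(\<Sum>i\<in>A. (1 + real i) powr (- s)) \<le> (\<Sum>i\<in>{I..<J'}. (1 + real i) powr (- s))"
      using sub by (intro sum_mono2) auto
    also have "\<dots> \<le> (\<Sum>i\<in>{I..<J'}. C * (F i - F (Suc i)))"
      using step mono by (intro sum_mono) (smt (verit))
    also have "\<dots> = C * (F I - F J')"
    proof -
      have "(\<Sum>i\<in>{I..<J'}. F i - F (Suc i)) = F I - F J'"
        using sum_Suc_diff'[of I J' "\<lambda>i. - F i"] by (simp add: J'_def)
      then show ?thesis by (simp flip: sum_distrib_left)
    qed
    also have "\<dots> \<le> C * F I" using C by (simp add: F_def)
    also have "\<dots> \<le> C' * F I"
      using C by (intro mult_right_mono) (auto simp: C'_def F_def ge_one_powr_ge_zero)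
    finally show ?thesis by (simp add: F_def)
  next
    case False
    then have s: "s < 1" using assms by simp
    have mono: "F i \<le> F (Suc i)" for i using s by (simp add: F_def powr_mono2)
    have "(\<Sum>i\<in>A. (1 + real i) powr (- s)) \<le> (\<Sum>i\<in>{0..<Suc I}. (1 + real i) powr (- s))"
      using A(3)[OF s] by (intro sum_mono2) auto
    also have "\<dots> \<le> (\<Sum>i\<in>{0..<Suc I}. C * (F (Suc i) - F i))"
      using step mono by (intro sum_mono) (smt (verit))
    also have "\<dots> = C * (F (Suc I) - F 0)"
      using sum_Suc_diff'[of 0 "Suc I" F] by (simp flip: sum_distrib_left)
    also have "\<dots> \<le> C * F (Suc I)" using C by (simp add: F_def)
    also have "F (Suc I) \<le> (2 * (1 + real I)) powr (1 - s)"
      unfolding F_def using s by (intro powr_mono2) auto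
    also have "C * (2 * (1 + real I)) powr (1 - s) = C' * (1 + real I) powr (1 - s)"
      using s by (subst powr_mult) (auto simp: C'_def)
    finally show ?thesis using C by simp
  qed
  show ?thesis by (rule that[OF C'], rule bound) auto
qed

text \<open>For finite \<open>q\<close> the bound \<open>R\<close> is on the \<open>q\<close>-th power of the norm.\<close>

definition lq_bounded :: "ennreal \<Rightarrow> real \<Rightarrow> (nat \<Rightarrow> real) \<Rightarrow> bool" where
  "lq_bounded q R y \<longleftrightarrow> (if q = top then \<forall>i. y i \<le> R else \<forall>n. (\<Sum>i<n. y i powr enn2real q) \<le> R)"

text \<open>Duality against the weight (1 + i)^(-c). With q' the conjugate exponent, the dual sum
  runs over (1 + i)^(-c q'), and 1 - c q' = q' e, so its root is of order (1 + I)^e over a tail or a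
  head according to the sign of \<open>e\<close>. For q = 1 the dual norm is a supremum, attained at
  \<open>I\<close> by monotonicity; for infinite q the weight itself is summed.\<close>

lemma hoelder_dyadic:
  fixes q :: ennreal and c R :: real
  assumes q: "1 \<le> q" and e: "e = 1 - enn2real (1 / q) - c" "e \<noteq> 0" and R: "R > 0"
  obtains C where "C > 0" "\<And>x (I::nat) A. (\<And>i. 0 \<le> x i) \<Longrightarrow> lq_bounded q R (\<lambda>i. (1 + real i) powr c * x i) \<Longrightarrow>
    finite A \<Longrightarrow> (e < 0 \<Longrightarrow> A \<subseteq> {I..}) \<Longrightarrow> (e > 0 \<Longrightarrow> A \<subseteq> {..I}) \<Longrightarrow> (\<Sum>i\<in>A. x i) \<le> C * (1 + real I) powr e"
proof (cases "q = top")
  case True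
  then have e': "e = 1 - c" using e by simp
  obtain C where C: "C > 0" "\<And>(I::nat) A. finite A \<Longrightarrow> (c > 1 \<Longrightarrow> A \<subseteq> {I..}) \<Longrightarrow> (c < 1 \<Longrightarrow> A \<subseteq> {..I}) \<Longrightarrow>
    (\<Sum>i\<in>A. (1 + real i) powr (- c)) \<le> C * (1 + real I) powr (1 - c)"
    by (rule power_sum_bound[of c]) (use e' e(2) in auto)
  have "(\<Sum>i\<in>A. x i) \<le> (R * C) * (1 + real I) powr e"
    if x: "\<And>i. 0 \<le> x i" "lq_bounded q R (\<lambda>i. (1 + real i) powr c * x i)"
      and A: "finite A" "e < 0 \<Longrightarrow> A \<subseteq> {I..}" "e > 0 \<Longrightarrow> A \<subseteq> {..I}" for x I A
  proof -
    have "x i \<le> R * (1 + real i) powr (- c)" for i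
    proof -
      have "(1 + real i) powr c * x i \<le> R" using x(2) True by (simp add: lq_bounded_def)
      then have "(1 + real i) powr c * x i * (1 + real i) powr (- c) \<le> R * (1 + real i) powr (- c)"
        by (rule mult_right_mono) simp
      moreover have "(1 + real i) powr c * (1 + real i) powr (- c) = 1" by (simp flip: powr_add)
      ultimately show ?thesis by (simp add: mult_ac)
    qed
    then have "(\<Sum>i\<in>A. x i) \<le> R * (\<Sum>i\<in>A. (1 + real i) powr (- c))"
      unfolding sum_distrib_left by (rule sum_mono)
    also have "\<dots> \<le> R * (C * (1 + real I) powr (1 - c))"
      using A R e' by (intro mult_left_mono C) auto
    finally show ?thesis by (simp add: e')
  qed
  then show ?thesis using C R by (intro that[of "R * C"]) auto
next
  case False
  define r where "r = enn2real q"
  have qr: "q = ennreal r" using False by (simp add: r_def less_top)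
  have r: "r \<ge> 1" using q by (simp add: qr)
  have e': "e = 1 - 1 / r - c"
    using e r by (simp add: qr divide_ennreal flip: ennreal_1)
  show ?thesis
  proof (cases "r = 1")
    case True
    have ec: "e = - c" using e' True by simp
    have "(\<Sum>i\<in>A. x i) \<le> R * (1 + real I) powr e"
      if x: "\<And>i. 0 \<le> x i" "lq_bounded q R (\<lambda>i. (1 + real i) powr c * x i)"
        and A: "finite A" "e < 0 \<Longrightarrow> A \<subseteq> {I..}" "e > 0 \<Longrightarrow> A \<subseteq> {..I}" for x I A
    proof -
      obtain n where n: "A \<subseteq> {..<n}" using A(1) finite_nat_iff_bounded by blast
      have "x i \<le> ((1 + real i) powr c * x i) * (1 + real I) powr e" if i: "i \<in> A" for i
      proof -
        have "(1 + real i) powr e \<le> (1 + real I) powr e"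
        proof (cases "e < 0")
          case True
          then show ?thesis using A(2) i by (intro powr_mono2') auto
        next
          case False
          then show ?thesis using A(3) i e(2) by (intro powr_mono2) auto
        qed
        then have "(1 + real i) powr c * x i * (1 + real i) powr e \<le> (1 + real i) powr c * x i * (1 + real I) powr e"
          using x(1) by (intro mult_left_mono) auto
        moreover have "(1 + real i) powr c * (1 + real i) powr e = 1" by (simp add: ec flip: powr_add)
        ultimately show ?thesis by (simp add: mult_ac)
      qed
      then have "(\<Sum>i\<in>A. x i) \<le> (\<Sum>i\<in>A. (1 + real i) powr c * x i) * (1 + real I) powr e"
        unfolding sum_distrib_right by (rule sum_mono)
      also have "(\<Sum>i\<in>A. (1 + real i) powr c * x i) \<le> (\<Sum>i<n. (1 + real i) powr c * x i)"
        using n x(1) by (intro sum_mono2) auto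
      also have "\<dots> \<le> R" using x False True by (simp add: lq_bounded_def r_def[symmetric])
      finally show ?thesis by (simp add: mult_right_mono)
    qed
    then show ?thesis using R by (intro that[of R]) auto
  next
    case r1: False
    define r' where "r' = r / (r - 1)"
    have r': "r > 1" "r' > 1" "1 / r + 1 / r' = 1"
      using r r1 by (auto simp: r'_def field_simps)
    define s where "s = c * r'"
    have s: "1 - s = r' * e"
    proof -
      have "1 - 1 / r = 1 / r'" using r'(3) by linarith
      then have h: "r' * (1 - 1 / r) = 1" using r'(2) by simp
      have "r' * e = r' * (1 - 1 / r) - c * r'" unfolding e' by (simp add: algebra_simps)
      then show ?thesis unfolding h s_def by simp
    qed
    obtain C where C: "C > 0" "\<And>(I::nat) A. finite A \<Longrightarrow> (s > 1 \<Longrightarrow> A \<subseteq> {I..}) \<Longrightarrow> (s < 1 \<Longrightarrow> A \<subseteq> {..I}) \<Longrightarrow>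
      (\<Sum>i\<in>A. (1 + real i) powr (- s)) \<le> C * (1 + real I) powr (1 - s)"
    proof (rule power_sum_bound[of s])
      show "s \<noteq> 1" using s e(2) r' by auto
    qed blast
    have "(\<Sum>i\<in>A. x i) \<le> (R + C) * (1 + real I) powr e"
      if x: "\<And>i. 0 \<le> x i" "lq_bounded q R (\<lambda>i. (1 + real i) powr c * x i)"
        and A: "finite A" "e < 0 \<Longrightarrow> A \<subseteq> {I..}" "e > 0 \<Longrightarrow> A \<subseteq> {..I}" for x I A
    proof -
      define L where "L = 1 + real I"
      have L: "L > 0" by (simp add: L_def)
      obtain n where n: "A \<subseteq> {..<n}" using A(1) finite_nat_iff_bounded by blast
      \<comment> \<open>Young's inequality with \<open>L powr e\<close> taken out. This scale makes
        both summed terms bounded: the first by \<open>R\<close>, the second by \<open>C\<close>,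
        because the power sum is of order \<open>L powr (1 - s)\<close>.\<close>
      have "x i \<le> L powr e * (((1 + real i) powr c * x i) powr r + (1 + real i) powr (- s) * L powr (- (1 - s)))" for i
      proof -
        have "((1 + real i) powr c * x i) * ((1 + real i) powr (- c) * L powr (- e))
           \<le> ((1 + real i) powr c * x i) powr r / r + ((1 + real i) powr (- c) * L powr (- e)) powr r' / r'"
          by (rule Youngs_inequality) (use r' x(1) in auto)
        also have "\<dots> \<le> ((1 + real i) powr c * x i) powr r + ((1 + real i) powr (- c) * L powr (- e)) powr r'"
        proof -
          have "z / k \<le> z" if "k > 1" "z \<ge> 0" for z k :: real
            using that frac_le[of z z 1 k] by simp
          then show ?thesis using r' by (intro add_mono) auto
        qed
        also have "((1 + real i) powr (- c) * L powr (- e)) powr r' = (1 + real i) powr (- s) * L powr (- (1 - s))"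
          unfolding s by (simp add: powr_mult powr_powr s_def mult.commute)
        finally have *: "((1 + real i) powr c * x i) * ((1 + real i) powr (- c) * L powr (- e))
           \<le> ((1 + real i) powr c * x i) powr r + (1 + real i) powr (- s) * L powr (- (1 - s))" .
        have 1: "(1 + real i) powr c * (1 + real i) powr (- c) = 1" "L powr e * L powr (- e) = 1"
          using L by (auto simp flip: powr_add)
        have "L powr e * (((1 + real i) powr c * x i) * ((1 + real i) powr (- c) * L powr (- e))) = x i * (((1 + real i) powr c * (1 + real i) powr (- c)) * (L powr e * L powr (- e)))"
          by (simp only: mult_ac)
        also have "\<dots> = x i" unfolding 1 by simp
        finally have X: "L powr e * (((1 + real i) powr c * x i) * ((1 + real i) powr (- c) * L powr (- e))) = x i" .
        show ?thesis using mult_left_mono[OF *, of "L powr e"] unfolding X by simp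
      qed
      then have "(\<Sum>i\<in>A. x i) \<le> L powr e * ((\<Sum>i\<in>A. ((1 + real i) powr c * x i) powr r) + (\<Sum>i\<in>A. (1 + real i) powr (- s)) * L powr (- (1 - s)))"
        unfolding sum_distrib_right sum.distrib[symmetric] sum_distrib_left by (rule sum_mono)
      also have "\<dots> \<le> L powr e * (R + (C * L powr (1 - s)) * L powr (- (1 - s)))"
      proof (intro mult_left_mono add_mono mult_right_mono)
        have "(\<Sum>i\<in>A. ((1 + real i) powr c * x i) powr r) \<le> (\<Sum>i<n. ((1 + real i) powr c * x i) powr r)"
          using n by (intro sum_mono2) auto
        also have "\<dots> \<le> R" using x False by (simp add: lq_bounded_def r_def)
        finally show "(\<Sum>i\<in>A. ((1 + real i) powr c * x i) powr r) \<le> R" .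
        have "s > 1 \<Longrightarrow> e < 0" "s < 1 \<Longrightarrow> e > 0"
          using s r' by (smt (verit) mult_nonneg_nonneg mult_nonneg_nonpos)+
        then show "(\<Sum>i\<in>A. (1 + real i) powr (- s)) \<le> C * L powr (1 - s)"
          unfolding L_def using A by (intro C) auto
      qed auto
      also have "(C * L powr (1 - s)) * L powr (- (1 - s)) = C"
        using L by (simp add: mult.assoc flip: powr_add)
      finally show ?thesis by (simp add: L_def mult.commute)
    qed
    then show ?thesis using C R by (intro that[of "R + C"]) auto
  qed
qed

section \<open>Geometric sums with power weights\<close>

lemma summable_geometric_powr:
  fixes \<epsilon> \<gamma> :: real
  assumes "\<epsilon> > 0"
  shows "summable (\<lambda>k::nat. 2 powr (- (\<epsilon> * real k)) * (1 + real k) powr \<gamma>)"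
proof (rule summable_comparison_test_bigo)
  show "summable (\<lambda>k::nat. norm ((2 powr (- \<epsilon> / 2)) ^ k :: real))"
    using assms by (simp add: summable_geometric_iff powr_less_one)
  show "(\<lambda>k::nat. 2 powr (- (\<epsilon> * real k)) * (1 + real k) powr \<gamma>) \<in> O(\<lambda>k. (2 powr (- \<epsilon> / 2)) ^ k)"
    using assms by real_asymp
qed

text \<open>The end term dominates. At distance k from \<open>I\<close>, the ratio of 1 + i to 1 + I
  lies between 1/(1 + k) and 1 + k, so the ratio of the terms is at most \<open>h k\<close>, and
  \<open>h\<close> is summable for either sign of \<open>\<gamma>\<close>.\<close>

lemma geometric_sum_bound:
  fixes \<epsilon> \<gamma> :: real
  assumes "\<epsilon> > 0"
  obtains C where "C > 0"
    "\<And>I::nat. (\<Sum>i\<le>I. 2 powr (\<epsilon> * real i) * (1 + real i) powr \<gamma>) \<le> C * (2 powr (\<epsilon> * real I) * (1 + real I) powr \<gamma>)"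
    "\<And>I J::nat. (\<Sum>i=I..<J. 2 powr (- (\<epsilon> * real i)) * (1 + real i) powr \<gamma>) \<le> C * (2 powr (- (\<epsilon> * real I)) * (1 + real I) powr \<gamma>)"
proof -
  define h where "h = (\<lambda>k::nat. 2 powr (- (\<epsilon> * real k)) * (1 + real k) powr \<bar>\<gamma>\<bar>)"
  have sm: "summable h" unfolding h_def by (rule summable_geometric_powr[OF assms])
  have h0: "0 \<le> h k" for k by (simp add: h_def)
  define C where "C = (\<Sum>k. h k) + 1"
  have C: "C > 0" using suminf_nonneg[OF sm h0] by (simp add: C_def)
  have fin: "(\<Sum>k\<in>A. h k) \<le> C" if "finite A" for A
    using sum_le_suminf[OF sm that] h0 by (simp add: C_def add_increasing2)
  have ratio: "(1 + real i) powr \<gamma> \<le> (1 + real I) powr \<gamma> * (1 + real k) powr \<bar>\<gamma>\<bar>"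
    if "I = i + k \<or> i = I + k" for i I k
  proof -
    have "(1 + real k) powr (- \<bar>\<gamma>\<bar>) * (1 + real i) powr \<gamma> \<le> (1 + real I) powr \<gamma>"
      using that by (intro powr_two_sided) (auto simp: field_simps)
    then have "(1 + real k) powr \<bar>\<gamma>\<bar> * ((1 + real k) powr (- \<bar>\<gamma>\<bar>) * (1 + real i) powr \<gamma>) \<le> (1 + real k) powr \<bar>\<gamma>\<bar> * (1 + real I) powr \<gamma>"
      by (rule mult_left_mono) simp
    also have "(1 + real k) powr \<bar>\<gamma>\<bar> * ((1 + real k) powr (- \<bar>\<gamma>\<bar>) * (1 + real i) powr \<gamma>) = (1 + real i) powr \<gamma>"
      unfolding mult.assoc[symmetric] powr_add[symmetric] by simp
    finally show ?thesis by (simp only: mult.commute)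
  qed
  have "(\<Sum>i\<le>I. 2 powr (\<epsilon> * real i) * (1 + real i) powr \<gamma>) \<le> C * (2 powr (\<epsilon> * real I) * (1 + real I) powr \<gamma>)" for I :: nat
  proof -
    have "2 powr (\<epsilon> * real i) * (1 + real i) powr \<gamma> \<le> h (I - i) * (2 powr (\<epsilon> * real I) * (1 + real I) powr \<gamma>)" if "i \<le> I" for i
    proof -
      have "2 powr (\<epsilon> * real i) = 2 powr (\<epsilon> * real I) * 2 powr (- (\<epsilon> * real (I - i)))"
        using that by (simp add: algebra_simps of_nat_diff flip: powr_add)
      moreover have "(1 + real i) powr \<gamma> \<le> (1 + real I) powr \<gamma> * (1 + real (I - i)) powr \<bar>\<gamma>\<bar>"
        by (rule ratio) (use that in auto)
      then have "2 powr (\<epsilon> * real i) * (1 + real i) powr \<gamma> \<le> 2 powr (\<epsilon> * real i) * ((1 + real I) powr \<gamma> * (1 + real (I - i)) powr \<bar>\<gamma>\<bar>)"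
        by (rule mult_left_mono) simp
      ultimately show ?thesis by (simp add: h_def mult_ac)
    qed
    then have "(\<Sum>i\<le>I. 2 powr (\<epsilon> * real i) * (1 + real i) powr \<gamma>) \<le> (\<Sum>i\<le>I. h (I - i)) * (2 powr (\<epsilon> * real I) * (1 + real I) powr \<gamma>)"
      unfolding sum_distrib_right by (intro sum_mono) auto
    also have "(\<Sum>i\<le>I. h (I - i)) = (\<Sum>k\<le>I. h k)"
      by (rule sum.reindex_bij_witness[of _ "\<lambda>k. I - k" "\<lambda>k. I - k"]) auto
    also have "\<dots> * (2 powr (\<epsilon> * real I) * (1 + real I) powr \<gamma>) \<le> C * (2 powr (\<epsilon> * real I) * (1 + real I) powr \<gamma>)"
      by (intro mult_right_mono fin) auto
    finally show ?thesis .
  qed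
  moreover have "(\<Sum>i=I..<J. 2 powr (- (\<epsilon> * real i)) * (1 + real i) powr \<gamma>) \<le> C * (2 powr (- (\<epsilon> * real I)) * (1 + real I) powr \<gamma>)" for I J :: nat
  proof -
    have "2 powr (- (\<epsilon> * real i)) * (1 + real i) powr \<gamma> \<le> h (i - I) * (2 powr (- (\<epsilon> * real I)) * (1 + real I) powr \<gamma>)" if "I \<le> i" for i
    proof -
      have "2 powr (- (\<epsilon> * real i)) = 2 powr (- (\<epsilon> * real I)) * 2 powr (- (\<epsilon> * real (i - I)))"
        using that by (simp add: algebra_simps of_nat_diff flip: powr_add)
      moreover have "(1 + real i) powr \<gamma> \<le> (1 + real I) powr \<gamma> * (1 + real (i - I)) powr \<bar>\<gamma>\<bar>"
        by (rule ratio) (use that in auto)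
      then have "2 powr (- (\<epsilon> * real i)) * (1 + real i) powr \<gamma> \<le> 2 powr (- (\<epsilon> * real i)) * ((1 + real I) powr \<gamma> * (1 + real (i - I)) powr \<bar>\<gamma>\<bar>)"
        by (rule mult_left_mono) simp
      ultimately show ?thesis by (simp add: h_def mult_ac)
    qed
    then have "(\<Sum>i=I..<J. 2 powr (- (\<epsilon> * real i)) * (1 + real i) powr \<gamma>) \<le> (\<Sum>i=I..<J. h (i - I)) * (2 powr (- (\<epsilon> * real I)) * (1 + real I) powr \<gamma>)"
      unfolding sum_distrib_right by (intro sum_mono) auto
    also have "(\<Sum>i=I..<J. h (i - I)) = (\<Sum>k<J - I. h k)"
      by (rule sum.reindex_bij_witness[of _ "\<lambda>k. k + I" "\<lambda>k. k - I"]) auto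
    also have "\<dots> * (2 powr (- (\<epsilon> * real I)) * (1 + real I) powr \<gamma>) \<le> C * (2 powr (- (\<epsilon> * real I)) * (1 + real I) powr \<gamma>)"
      by (intro mult_right_mono fin) auto
    finally show ?thesis .
  qed
  ultimately show ?thesis using C that by blast
qed

section \<open>Rearrangements\<close>

lemma decr_rearr_antimono:
  assumes "s \<le> t"
  shows "decr_rearr M f t \<le> decr_rearr M f s"
  unfolding decr_rearr_def
  by (rule Inf_superset_mono) (use order_trans[OF _ ennreal_leI[OF assms]] in auto)

text \<open>The infimum in the definition is attained: the sets where the norm exceeds d + 1/(n + 1)
  have measure at most \<open>t\<close> and increase to the set where it exceeds \<open>d\<close>,
  so continuity from below applies.\<close>

lemma emeasure_above_decr_rearr:
  assumes [measurable]: "(\<lambda>x. norm (f x)) \<in> borel_measurable M"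
  shows "emeasure M {x \<in> space M. decr_rearr M f t < ennreal (norm (f x))} \<le> ennreal t"
proof (cases "decr_rearr M f t = top")
  case True
  then show ?thesis by simp
next
  case False
  define d where "d = enn2real (decr_rearr M f t)"
  have d: "decr_rearr M f t = ennreal d" "d \<ge> 0" using False by (auto simp: d_def less_top)
  define A where "A = (\<lambda>n::nat. {x \<in> space M. d + 1 / (real n + 1) < norm (f x)})"
  have eq: "{x \<in> space M. decr_rearr M f t < ennreal (norm (f x))} = (\<Union>n. A n)"
  proof -
    have "(d < y) = (\<exists>n::nat. d + 1 / (real n + 1) < y)" for y
    proof
      assume "d < y"
      then obtain n :: nat where "1 / real (Suc n) < y - d" by (metis diff_gt_0_iff_gt nat_approx_posE)
      then show "\<exists>n::nat. d + 1 / (real n + 1) < y" by (intro exI[of _ n]) (simp add: add.commute)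
    next
      assume "\<exists>n::nat. d + 1 / (real n + 1) < y"
      then obtain n :: nat where "d + 1 / (real n + 1) < y" by blast
      moreover have "0 < 1 / (real n + 1)" by simp
      ultimately show "d < y" by linarith
    qed
    then show ?thesis using d by (auto simp: A_def ennreal_less_iff)
  qed
  have Am: "range A \<subseteq> sets M" by (auto simp: A_def)
  have inc: "incseq A"
  proof (rule incseq_SucI)
    fix n
    have "1 / (real (Suc n) + 1) \<le> 1 / (real n + 1)" by (simp add: frac_le)
    then show "A n \<subseteq> A (Suc n)" by (auto simp: A_def)
  qed
  have "emeasure M (A n) \<le> ennreal t" for n
  proof -
    have "decr_rearr M f t < ennreal (d + 1 / (real n + 1))"
      using d by (simp add: ennreal_less_iff)
    then obtain s where s: "emeasure M {x \<in> space M. s < ennreal (norm (f x))} \<le> ennreal t" "s < ennreal (d + 1 / (real n + 1))"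
      unfolding decr_rearr_def Inf_less_iff by blast
    have "A n \<subseteq> {x \<in> space M. s < ennreal (norm (f x))}"
      using s(2) by (auto simp: A_def intro: less_le_trans[OF _ ennreal_leI])
    then have "emeasure M (A n) \<le> emeasure M {x \<in> space M. s < ennreal (norm (f x))}"
      by (rule emeasure_mono) measurable
    then show ?thesis using s(1) by (rule order_trans)
  qed
  then show ?thesis unfolding eq SUP_emeasure_incseq[OF Am inc, symmetric] by (rule SUP_least)
qed

section \<open>From Lorentz--Zygmund norms to dyadic sequences\<close>

lemma epowr_mono: "x \<le> y \<Longrightarrow> 0 \<le> p \<Longrightarrow> epowr x p \<le> epowr y p"
  by (auto simp: epowr_def top_unique less_top intro!: ennreal_leI powr_mono2 enn2real_mono)

lemma epowr_le_imp:
  assumes "epowr x (1 / p) \<le> ennreal y" "p > 0" "y \<ge> 0"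
  shows "x \<le> ennreal (y powr p)"
proof -
  have x: "x \<noteq> top" using assms(1) by (auto simp: epowr_def top_unique)
  define u where "u = enn2real x"
  have u: "x = ennreal u" "u \<ge> 0" using x by (auto simp: u_def less_top)
  have "u powr (1 / p) \<le> y" using assms u by (simp add: epowr_def)
  then have "(u powr (1 / p)) powr p \<le> y powr p" using assms by (intro powr_mono2) auto
  then show ?thesis using u assms by (simp add: powr_powr ennreal_leI)
qed

lemma epowr_ennreal: "0 \<le> x \<Longrightarrow> epowr (ennreal x) p = ennreal (x powr p)"
  by (simp add: epowr_def)

lemma lq_bounded_of_epowr:
  fixes a :: "nat \<Rightarrow> ennreal"
  assumes q: "1 \<le> q" and R: "0 \<le> R"
    and top: "q = top \<Longrightarrow> \<forall>i. a i \<le> ennreal R"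
    and fin: "q \<noteq> top \<Longrightarrow> \<forall>n. (\<Sum>i<n. epowr (a i) (enn2real q)) \<le> ennreal R"
  shows "a i \<noteq> top" "lq_bounded q R (\<lambda>i. enn2real (a i))"
proof -
  show nt: "a i \<noteq> top" for i
  proof (cases "q = top")
    case True
    then show ?thesis using top by (metis ennreal_neq_top top_unique)
  next
    case False
    have "epowr (a i) (enn2real q) \<le> (\<Sum>i<Suc i. epowr (a i) (enn2real q))"
      by (intro member_le_sum) auto
    also have "\<dots> \<le> ennreal R" using fin False by blast
    finally show ?thesis by (auto simp: epowr_def top_unique)
  qed
  have a: "a i = ennreal (enn2real (a i))" for i using nt[of i] by (simp add: less_top)
  show "lq_bounded q R (\<lambda>i. enn2real (a i))"
  proof (cases "q = top")
    case True
    then show ?thesis using top R a by (metis (no_types, lifting) enn2real_leI lq_bounded_def)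
  next
    case False
    have "(\<Sum>i<n. enn2real (a i) powr enn2real q) \<le> R" for n
    proof -
      have "ennreal (\<Sum>i<n. enn2real (a i) powr enn2real q) = (\<Sum>i<n. epowr (a i) (enn2real q))"
        unfolding sum_ennreal[symmetric, OF powr_ge_zero] by (intro sum.cong refl) (metis a enn2real_nonneg epowr_ennreal)
      also have "\<dots> \<le> ennreal R" using fin False by blast
      finally show ?thesis using R by simp
    qed
    then show ?thesis using False by (simp add: lq_bounded_def)
  qed
qed

lemma lq_bounded_scale:
  assumes "lq_bounded q R (\<lambda>i. k * y i)" "k > 0" "\<And>i. 0 \<le> y i"
  shows "lq_bounded q (if q = top then R / k else R / k powr enn2real q) y"
proof (cases "q = top")
  case True
  then show ?thesis using assms by (simp add: lq_bounded_def field_simps)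
next
  case False
  have "(\<Sum>i<n. y i powr enn2real q) \<le> R / k powr enn2real q" for n
  proof -
    have "(\<Sum>i<n. (k * y i) powr enn2real q) \<le> R" using assms(1) False by (simp add: lq_bounded_def)
    also have "(\<Sum>i<n. (k * y i) powr enn2real q) = k powr enn2real q * (\<Sum>i<n. y i powr enn2real q)"
      using assms by (simp add: powr_mult sum_distrib_left)
    finally show ?thesis using assms(2) by (simp add: field_simps)
  qed
  then show ?thesis using False by (simp add: lq_bounded_def)
qed

text \<open>Common last step of both discretisations. The factor \<open>u i\<close> is the dyadic
  scale, 2^(-(i + 1)) for functions and 2^i for sequences, and \<open>\<kappa>\<close> is the loss
  in comparing the weight of the norm with its dyadic value.\<close>

lemma lq_bounded_dyadic:
  fixes m :: "nat \<Rightarrow> ennreal"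
  assumes q: "1 \<le> q" and R: "0 \<le> R" and \<kappa>: "\<kappa> > 0" and u: "\<And>i. u i > 0"
    and top: "q = top \<Longrightarrow> \<forall>i. ennreal (\<kappa> * ((1 + real i) powr c * u i)) * m i \<le> ennreal R"
    and fin: "q \<noteq> top \<Longrightarrow> \<forall>n. (\<Sum>i<n. epowr (ennreal (\<kappa> * ((1 + real i) powr c * u i)) * m i) (enn2real q)) \<le> ennreal R"
  shows "m i \<noteq> top"
    and "lq_bounded q (if q = top then R / \<kappa> else R / \<kappa> powr enn2real q) (\<lambda>i. (1 + real i) powr c * (u i * enn2real (m i)))"
proof -
  let ?a = "\<lambda>i. ennreal (\<kappa> * ((1 + real i) powr c * u i)) * m i"
  have a: "?a i \<noteq> top" for i by (rule lq_bounded_of_epowr[OF q R top fin])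
  have pos: "\<kappa> * ((1 + real i) powr c * u i) > 0" for i using \<kappa> u by simp
  show "m i \<noteq> top" using a[of i] pos[of i] by (auto simp: ennreal_mult_eq_top_iff)
  have "lq_bounded q R (\<lambda>i. enn2real (?a i))"
    by (rule lq_bounded_of_epowr[OF q R top fin])
  also have "(\<lambda>i. enn2real (?a i)) = (\<lambda>i. \<kappa> * ((1 + real i) powr c * (u i * enn2real (m i))))"
    using pos by (auto simp: enn2real_mult fun_eq_iff less_imp_le)
  finally show "lq_bounded q (if q = top then R / \<kappa> else R / \<kappa> powr enn2real q) (\<lambda>i. (1 + real i) powr c * (u i * enn2real (m i)))"
    by (rule lq_bounded_scale[OF _ \<kappa>]) (use u in \<open>auto intro!: mult_nonneg_nonneg simp: less_imp_le\<close>)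
qed

lemma sum_disjoint_indicator_le:
  fixes g :: "nat \<Rightarrow> ennreal"
  assumes "finite S" and disj: "\<And>i j. x \<in> A i \<Longrightarrow> x \<in> A j \<Longrightarrow> i = j"
    and le: "\<And>i. i \<in> S \<Longrightarrow> x \<in> A i \<Longrightarrow> g i \<le> F"
  shows "(\<Sum>i\<in>S. g i * indicator (A i) x) \<le> F"
proof (cases "\<exists>i\<in>S. x \<in> A i")
  case True
  then obtain i where i: "i \<in> S" "x \<in> A i" by blast
  have "(\<Sum>j\<in>S. g j * indicator (A j) x) = (\<Sum>j\<in>{i}. g j * indicator (A j) x)"
    by (rule sum.mono_neutral_right) (use assms(1) i disj in \<open>auto simp: indicator_def\<close>)
  then show ?thesis using le[OF i] i by simp
next
  case False
  then have "(\<Sum>j\<in>S. g j * indicator (A j) x) = 0" by (intro sum.neutral) auto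
  then show ?thesis by simp
qed

lemma ln_2_bounds: "1 / 2 \<le> ln (2::real)" "ln (2::real) \<le> 1"
  using ln2_ge_two_thirds ln_2_less_1 by auto

text \<open>On the block between t_i/2 and t_i the rearrangement is at least its value at t_i, the
  weight is comparable to its dyadic value, and the measure dt/t has mass at least 1/2. The blocks
  are disjoint, so their contributions add up to at most the norm integral.\<close>

lemma L1_log_norm_dyadic:
  fixes c \<rho> :: real
  assumes q: "1 \<le> q" and \<rho>: "\<rho> > 0"
  obtains R where "R > 0" "\<And>f :: real^'d::finite \<Rightarrow> 'x::real_normed_vector. L1_log_norm q c f \<le> ennreal \<rho> \<Longrightarrow>
    (\<forall>i. decr_rearr torus f ((1/2) ^ Suc i) \<noteq> top) \<and>
    lq_bounded q R (\<lambda>i. (1 + real i) powr c * ((1/2) ^ Suc i * enn2real (decr_rearr torus f ((1/2) ^ Suc i))))"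
proof -
  \<comment> \<open>The 4 compares 1 + |ln x| with 1 + i on the block, in whichever direction the
    sign of \<open>c\<close> requires; the 2 compares \<open>x\<close> with t_i.\<close>
  define \<kappa> where "\<kappa> = 4 powr (- \<bar>c\<bar>) / 2"
  have \<kappa>: "\<kappa> > 0" by (simp add: \<kappa>_def)
  define t where "t = (\<lambda>i. (1/2::real) ^ Suc i)"
  have t: "0 < t i" "t i < 1" "t (Suc i) = t i / 2" for i by (auto simp: t_def power_less_one_iff simp del: power_Suc) (simp add: t_def)
  have tmono: "t j \<le> t i / 2" if "i < j" for i j
  proof -
    have "t j \<le> t (Suc i)" using that unfolding t_def by (intro power_decreasing) auto
    then show ?thesis by (simp add: t(3))
  qed
  have weight: "\<kappa> * ((1 + real i) powr c * t i) \<le> x * (1 + \<bar>ln x\<bar>) powr c" if x: "t i / 2 \<le> x" "x \<le> t i" for x i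
  proof -
    have lnt: "ln (t i) = - (real (Suc i) * ln 2)"
      unfolding t_def by (subst ln_realpow) (auto simp: ln_div)
    have x0: "0 < x" using t(1)[of i] x by linarith
    have "ln x \<le> ln (t i)" using x x0 t(1) by simp
    moreover have "ln (t i / 2) \<le> ln x" using x x0 t(1)[of i] by (subst ln_le_cancel_iff) auto
    then have "ln (t i) - ln 2 \<le> ln x" using t(1)[of i] by (simp add: ln_div)
    ultimately have lx: "real (Suc i) * ln 2 \<le> - ln x" "- ln x \<le> (real (Suc i) + 1) * ln 2"
      unfolding lnt by (auto simp: algebra_simps)
    have a1: "real (Suc i) * (1/2) \<le> real (Suc i) * ln 2" by (rule mult_left_mono[OF ln_2_bounds(1)]) simp
    have a2: "(real (Suc i) + 1) * ln 2 \<le> (real (Suc i) + 1) * 1" by (rule mult_left_mono[OF ln_2_bounds(2)]) simp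
    have m: "real (Suc i) * (1/2) \<le> - ln x" "- ln x \<le> real (Suc i) + 1"
      using order_trans[OF a1 lx(1)] order_trans[OF lx(2) a2] by simp_all
    have "0 \<le> real (Suc i) * (1/2)" by simp
    then have "\<bar>ln x\<bar> = - ln x" using m(1) by linarith
    then have b: "(1 + real i) / 4 \<le> 1 + \<bar>ln x\<bar>" "1 + \<bar>ln x\<bar> \<le> 4 * (1 + real i)"
      using m by (auto simp: field_simps)
    have "4 powr (- \<bar>c\<bar>) * (1 + real i) powr c \<le> (1 + \<bar>ln x\<bar>) powr c"
      by (rule powr_two_sided) (use b in auto)
    then have "(t i / 2) * (4 powr (- \<bar>c\<bar>) * (1 + real i) powr c) \<le> x * (1 + \<bar>ln x\<bar>) powr c"
      using x x0 by (intro mult_mono) auto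
    then show ?thesis by (simp add: \<kappa>_def mult_ac)
  qed
  \<comment> \<open>The factor 2 undoes the mass 1/2 of each block.\<close>
  define R0 where "R0 = (if q = top then \<rho> else 2 * \<rho> powr enn2real q)"
  have R0: "R0 > 0" using \<rho> by (simp add: R0_def)
  define R where "R = (if q = top then R0 / \<kappa> else R0 / \<kappa> powr enn2real q)"
  have "(\<forall>i. decr_rearr torus f (t i) \<noteq> top) \<and> lq_bounded q R (\<lambda>i. (1 + real i) powr c * (t i * enn2real (decr_rearr torus f (t i))))"
    if f: "L1_log_norm q c f \<le> ennreal \<rho>" for f :: "real^'d \<Rightarrow> 'x"
  proof -
    define m where "m = (\<lambda>i. decr_rearr torus f (t i))"
    define w where "w = (\<lambda>x. ennreal (x * (1 + \<bar>ln x\<bar>) powr c) * decr_rearr torus f x)"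
    have aw: "ennreal (\<kappa> * ((1 + real i) powr c * t i)) * m i \<le> w x" if x: "t i / 2 \<le> x" "x \<le> t i" for x i
      unfolding w_def m_def by (intro mult_mono ennreal_leI weight[OF x] decr_rearr_antimono x) auto
    have top: "\<forall>i. ennreal (\<kappa> * ((1 + real i) powr c * t i)) * m i \<le> ennreal R0" if "q = top"
    proof
      fix i
      have "ennreal (\<kappa> * ((1 + real i) powr c * t i)) * m i \<le> w (t i)" using t(1)[of i] by (intro aw) auto
      also have "\<dots> \<le> (SUP x\<in>{0<..<1}. w x)" by (intro SUP_upper) (use t in auto)
      also have "\<dots> \<le> ennreal R0" using f that unfolding L1_log_norm_def Let_def w_def[symmetric] by (simp add: R0_def)
      finally show "ennreal (\<kappa> * ((1 + real i) powr c * t i)) * m i \<le> ennreal R0" .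
    qed
    have fin: "\<forall>n. (\<Sum>i<n. epowr (ennreal (\<kappa> * ((1 + real i) powr c * t i)) * m i) (enn2real q)) \<le> ennreal R0" if nt: "q \<noteq> top"
    proof
      fix n
      define r where "r = enn2real q"
      have qr: "q = ennreal r" using nt by (simp add: r_def less_top)
      have r: "r \<ge> 1" using q by (simp add: qr)
      define a where "a = (\<lambda>i. epowr (ennreal (\<kappa> * ((1 + real i) powr c * t i)) * m i) r)"
      define A where "A = (\<lambda>i. {t i / 2<..<t i})"
      define I where "I = (\<integral>\<^sup>+x\<in>{0<..<1}. epowr (w x) r * ennreal (1 / x) \<partial>lborel)"
      have "epowr I (1 / r) \<le> ennreal \<rho>"
        using f nt unfolding L1_log_norm_def Let_def w_def[symmetric] I_def r_def by simp
      then have I: "I \<le> ennreal (\<rho> powr r)" by (rule epowr_le_imp) (use r \<rho> in auto)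
      have "(\<integral>\<^sup>+x. (\<Sum>i<n. (a i * ennreal (1 / t i)) * indicator (A i) x) \<partial>lborel) \<le> I"
        unfolding I_def
      proof (rule nn_integral_mono)
        fix x :: real
        show "(\<Sum>i<n. (a i * ennreal (1 / t i)) * indicator (A i) x) \<le> epowr (w x) r * ennreal (1 / x) * indicator {0<..<1} x"
        proof (rule sum_disjoint_indicator_le)
          fix i j assume "x \<in> A i" "x \<in> A j"
          then show "i = j" using tmono[of i j] tmono[of j i] by (cases i j rule: linorder_cases) (auto simp: A_def)
        next
          fix i assume "x \<in> A i"
          then have x: "t i / 2 < x" "x < t i" by (auto simp: A_def)
          have x0: "0 < x" "x < 1" using x t(1)[of i] t(2)[of i] by linarith+
          have "a i \<le> epowr (w x) r" unfolding a_def using x r by (intro epowr_mono aw) auto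
          moreover have "ennreal (1 / t i) \<le> ennreal (1 / x)" using x x0 by (intro ennreal_leI) (auto simp: frac_le)
          ultimately show "a i * ennreal (1 / t i) \<le> epowr (w x) r * ennreal (1 / x) * indicator {0<..<1} x"
            using x0 by (simp add: mult_mono)
        qed simp
      qed
      moreover have "(\<integral>\<^sup>+x. (\<Sum>i<n. (a i * ennreal (1 / t i)) * indicator (A i) x) \<partial>lborel) = (\<Sum>i<n. a i * ennreal (1 / 2))"
      proof -
        have "(\<integral>\<^sup>+x. (a i * ennreal (1 / t i)) * indicator (A i) x \<partial>lborel) = a i * ennreal (1 / 2)" for i
        proof -
          have "(\<integral>\<^sup>+x. (a i * ennreal (1 / t i)) * indicator (A i) x \<partial>lborel) = a i * (ennreal (1 / t i) * ennreal (t i / 2))"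
            using t(1)[of i] by (subst nn_integral_cmult_indicator) (auto simp: A_def mult.assoc)
          also have "ennreal (1 / t i) * ennreal (t i / 2) = ennreal (1 / 2)"
            using t(1)[of i] by (subst ennreal_mult[symmetric]) auto
          finally show ?thesis .
        qed
        then show ?thesis by (subst nn_integral_sum) (auto simp: A_def)
      qed
      ultimately have "(\<Sum>i<n. a i) * ennreal (1 / 2) \<le> ennreal (\<rho> powr r)"
        using I by (simp add: sum_distrib_right)
      then have "ennreal 2 * ((\<Sum>i<n. a i) * ennreal (1 / 2)) \<le> ennreal 2 * ennreal (\<rho> powr r)"
        by (rule mult_left_mono) simp
      also have "ennreal 2 * ((\<Sum>i<n. a i) * ennreal (1 / 2)) = (\<Sum>i<n. a i) * (ennreal 2 * ennreal (1 / 2))"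
        by (simp only: mult_ac)
      also have "ennreal 2 * ennreal (1 / 2) = 1" by (subst ennreal_mult[symmetric]) auto
      also have "ennreal 2 * ennreal (\<rho> powr r) = ennreal R0"
        using nt by (subst ennreal_mult[symmetric]) (auto simp: R0_def r_def)
      finally show "(\<Sum>i<n. epowr (ennreal (\<kappa> * ((1 + real i) powr c * t i)) * m i) (enn2real q)) \<le> ennreal R0"
        by (simp add: a_def r_def)
    qed
    show ?thesis
      using lq_bounded_dyadic[where u=t and m=m, OF q less_imp_le[OF R0] \<kappa> t(1) top fin]
      by (simp add: R_def m_def)
  qed
  moreover have "R > 0" using R0 \<kappa> by (simp add: R_def)
  ultimately show ?thesis using that unfolding t_def by blast
qed

text \<open>The terms in block \<open>i\<close> are compared with the rearrangement just beyond the
  block, at index \<open>2 ^ Suc i - 1\<close>. Indices are counted from 0, so the value at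
  \<open>2 ^ i - 1\<close> is the term of rank 2^i. The dyadic value with index 0 lies beyond no
  block and is bounded by the first term alone.\<close>

lemma l1_log_norm_dyadic:
  fixes c \<rho> :: real
  assumes q: "1 \<le> q" and \<rho>: "\<rho> > 0"
  obtains R where "R > 0" "\<And>f :: int^'d::finite \<Rightarrow> 'x::real_normed_vector. l1_log_norm q c f \<le> ennreal \<rho> \<Longrightarrow>
    (\<forall>i. decr_rearr (count_space UNIV) f (real (2 ^ i - 1)) \<noteq> top) \<and>
    lq_bounded q R (\<lambda>i. (1 + real i) powr c * (2 ^ i * enn2real (decr_rearr (count_space UNIV) f (real (2 ^ i - 1)))))"
proof -
  define \<kappa> where "\<kappa> = 4 powr (- \<bar>c\<bar>) / 2"
  have \<kappa>: "\<kappa> > 0" by (simp add: \<kappa>_def)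
  have \<kappa>1: "\<kappa> \<le> 1" using powr_mono[of "- \<bar>c\<bar>" 0 4] by (simp add: \<kappa>_def)
  have weight: "\<kappa> * ((1 + real (Suc i)) powr c * 2 ^ Suc i) \<le> real (Suc j) * (1 + ln (real (Suc j))) powr c"
    if j: "2 ^ i \<le> Suc j" "Suc j < 2 ^ Suc i" for i j
  proof -
    have j': "2 ^ i \<le> real (Suc j)" "real (Suc j) \<le> 2 ^ Suc i"
      using j by (metis of_nat_le_iff of_nat_numeral of_nat_power, metis less_imp_le of_nat_le_iff of_nat_numeral of_nat_power)
    have "ln (2 ^ i) \<le> ln (real (Suc j))" using j' by (subst ln_le_cancel_iff) auto
    then have l1: "real i * ln 2 \<le> ln (real (Suc j))" by (simp add: ln_realpow)
    have "ln (real (Suc j)) \<le> ln (2 ^ Suc i)" using j' by (subst ln_le_cancel_iff) auto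
    then have l2: "ln (real (Suc j)) \<le> real (Suc i) * ln 2" by (simp add: ln_realpow del: power_Suc)
    have a1: "real i * (1/2) \<le> real i * ln 2" by (rule mult_left_mono[OF ln_2_bounds(1)]) simp
    have a2: "real (Suc i) * ln 2 \<le> real (Suc i) * 1" by (rule mult_left_mono[OF ln_2_bounds(2)]) simp
    have "4 powr (- \<bar>c\<bar>) * (1 + real (Suc i)) powr c \<le> (1 + ln (real (Suc j))) powr c"
      by (rule powr_two_sided) (use order_trans[OF a1 l1] order_trans[OF l2 a2] in auto)
    then have "(2 ^ Suc i / 2) * (4 powr (- \<bar>c\<bar>) * (1 + real (Suc i)) powr c) \<le> real (Suc j) * (1 + ln (real (Suc j))) powr c"
      using j' by (intro mult_mono) auto
    then show ?thesis by (simp add: \<kappa>_def mult_ac)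
  qed
  \<comment> \<open>The 3 is 2 + 1: the blocks have mass at least 1/2, as for functions, and the
    first term is counted once more for the dyadic index 0.\<close>
  define R0 where "R0 = (if q = top then \<rho> else 3 * \<rho> powr enn2real q)"
  have R0: "R0 > 0" using \<rho> by (simp add: R0_def)
  define R where "R = (if q = top then R0 / \<kappa> else R0 / \<kappa> powr enn2real q)"
  have "(\<forall>i. decr_rearr (count_space UNIV) f (real (2 ^ i - 1)) \<noteq> top) \<and>
    lq_bounded q R (\<lambda>i. (1 + real i) powr c * (2 ^ i * enn2real (decr_rearr (count_space UNIV) f (real (2 ^ i - 1)))))"
    if f: "l1_log_norm q c f \<le> ennreal \<rho>" for f :: "int^'d \<Rightarrow> 'x"
  proof -
    define D where "D = (\<lambda>j::nat. decr_rearr (count_space UNIV) f (real j))"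
    define w where "w = (\<lambda>j::nat. ennreal (real (Suc j) * (1 + ln (real (Suc j))) powr c) * D j)"
    define a where "a = (\<lambda>i. ennreal (\<kappa> * ((1 + real i) powr c * 2 ^ i)) * D (2 ^ i - 1))"
    have aw: "a (Suc i) \<le> w j" if j: "2 ^ i \<le> Suc j" "Suc j < 2 ^ Suc i" for i j
    proof -
      have "j \<le> 2 ^ Suc i - 1" using j(2) by simp
      then have "D (2 ^ Suc i - 1) \<le> D j" unfolding D_def by (intro decr_rearr_antimono of_nat_mono)
      then show ?thesis
        unfolding a_def w_def by (rule mult_mono[OF ennreal_leI[OF weight[OF j]]]) auto
    qed
    have a0: "a 0 \<le> w 0"
    proof -
      have "ennreal \<kappa> * D 0 \<le> 1 * D 0" using \<kappa>1 by (intro mult_right_mono) (auto simp flip: ennreal_1)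
      then show ?thesis by (simp add: a_def w_def)
    qed
    have top: "\<forall>i. a i \<le> ennreal R0" if "q = top"
    proof
      fix i
      have "\<exists>j. a i \<le> w j"
      proof (cases i)
        case 0
        then show ?thesis using a0 by auto
      next
        case (Suc k)
        then show ?thesis using aw[of k "2 ^ k - 1"] by auto
      qed
      then obtain j where "a i \<le> w j" by blast
      also have "\<dots> \<le> (SUP j. w j)" by (rule SUP_upper) simp
      also have "\<dots> \<le> ennreal R0"
        using f that unfolding l1_log_norm_def Let_def w_def D_def by (simp add: R0_def)
      finally show "a i \<le> ennreal R0" .
    qed
    have fin: "\<forall>n. (\<Sum>i<n. epowr (a i) (enn2real q)) \<le> ennreal R0" if nt: "q \<noteq> top"
    proof
      fix n
      define r where "r = enn2real q"
      have qr: "q = ennreal r" using nt by (simp add: r_def less_top)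
      have r: "r \<ge> 1" using q by (simp add: qr)
      define g where "g = (\<lambda>j. epowr (w j) r * ennreal (1 / real (Suc j)))"
      have "epowr (\<Sum>j. g j) (1 / r) \<le> ennreal \<rho>"
        using f nt unfolding l1_log_norm_def Let_def w_def D_def g_def r_def by simp
      then have I: "(\<Sum>j. g j) \<le> ennreal (\<rho> powr r)" by (rule epowr_le_imp) (use r \<rho> in auto)
      have fin_le: "(\<Sum>j\<in>A. g j) \<le> ennreal (\<rho> powr r)" if "finite A" for A
        by (rule order_trans[OF sum_le_suminf I]) (use that in auto)
      \<comment> \<open>2^i indices, each with 1/(j + 1) at least 2^(-(i + 1)), hence the mass
        1/2.\<close>
      define B where "B = (\<lambda>i. {2 ^ i - 1..<2 ^ Suc i - 1 :: nat})"
      have half: "epowr (a (Suc i)) r * ennreal (1 / 2) \<le> (\<Sum>j\<in>B i. g j)" for i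
      proof -
        have "epowr (a (Suc i)) r * ennreal (1 / 2) = of_nat (card (B i)) * (epowr (a (Suc i)) r * ennreal (1 / 2 ^ Suc i))"
        proof -
          have "card (B i) = 2 ^ i" by (simp add: B_def)
          then have "of_nat (card (B i)) = ennreal (2 ^ i)"
            unfolding ennreal_of_nat_eq_real_of_nat by simp
          then have "of_nat (card (B i)) * ennreal (1 / 2 ^ Suc i) = ennreal (2 ^ i * (1 / 2 ^ Suc i))"
            by (simp only: ennreal_mult'' zero_le_divide_1_iff zero_le_power zero_le_numeral)
          also have "2 ^ i * (1 / 2 ^ Suc i) = (1 / 2 :: real)" by simp
          finally have "of_nat (card (B i)) * ennreal (1 / 2 ^ Suc i) = ennreal (1 / 2)" .
          then show ?thesis by (metis mult.left_commute)
        qed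
        also have "\<dots> = (\<Sum>j\<in>B i. epowr (a (Suc i)) r * ennreal (1 / 2 ^ Suc i))" by simp
        also have "\<dots> \<le> (\<Sum>j\<in>B i. g j)"
        proof (rule sum_mono)
          fix j assume "j \<in> B i"
          then have j: "2 ^ i \<le> Suc j" "Suc j < 2 ^ Suc i" by (auto simp: B_def)
          have "real (Suc j) \<le> 2 ^ Suc i" using j(2) by (metis less_imp_le of_nat_le_iff of_nat_numeral of_nat_power)
          then have "ennreal (1 / 2 ^ Suc i) \<le> ennreal (1 / real (Suc j))" by (intro ennreal_leI) (simp add: frac_le del: of_nat_Suc)
          moreover have "epowr (a (Suc i)) r \<le> epowr (w j) r" using r by (intro epowr_mono aw j) auto
          ultimately show "epowr (a (Suc i)) r * ennreal (1 / 2 ^ Suc i) \<le> g j" unfolding g_def by (intro mult_mono) auto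
        qed
        finally show ?thesis .
      qed
      have "(\<Sum>i<n. epowr (a (Suc i)) r) * ennreal (1 / 2) \<le> (\<Sum>i<n. \<Sum>j\<in>B i. g j)"
        unfolding sum_distrib_right by (intro sum_mono half)
      also have "\<dots> = (\<Sum>j\<in>(\<Union>i<n. B i). g j)"
      proof (rule sum.UNION_disjoint[symmetric])
        show "\<forall>i\<in>{..<n}. \<forall>j\<in>{..<n}. i \<noteq> j \<longrightarrow> B i \<inter> B j = {}"
        proof (intro ballI impI)
          fix i j :: nat assume "i \<noteq> j"
          have "B i \<inter> B j = {}" if "i < j" for i j :: nat
          proof -
            have "(2::nat) ^ Suc i \<le> 2 ^ j" using that by (intro power_increasing) auto
            then show ?thesis by (auto simp: B_def)
          qed
          with \<open>i \<noteq> j\<close> show "B i \<inter> B j = {}" by (metis Int_commute nat_neq_iff)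
        qed
      qed (auto simp: B_def)
      also have "\<dots> \<le> ennreal (\<rho> powr r)" by (rule fin_le) (auto simp: B_def)
      finally have "(\<Sum>i<n. epowr (a (Suc i)) r) * ennreal (1 / 2) \<le> ennreal (\<rho> powr r)" .
      then have "ennreal 2 * ((\<Sum>i<n. epowr (a (Suc i)) r) * ennreal (1 / 2)) \<le> ennreal 2 * ennreal (\<rho> powr r)"
        by (rule mult_left_mono) simp
      also have "ennreal 2 * ((\<Sum>i<n. epowr (a (Suc i)) r) * ennreal (1 / 2)) = (\<Sum>i<n. epowr (a (Suc i)) r) * (ennreal 2 * ennreal (1 / 2))"
        by (simp only: mult_ac)
      also have "ennreal 2 * ennreal (1 / 2) = 1" by (subst ennreal_mult[symmetric]) auto
      finally have tail: "(\<Sum>i<n. epowr (a (Suc i)) r) \<le> ennreal 2 * ennreal (\<rho> powr r)" by simp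
      have "epowr (a 0) r \<le> g 0" unfolding g_def using r epowr_mono[OF a0, of r] by simp
      also have "g 0 \<le> ennreal (\<rho> powr r)" using fin_le[of "{0}"] by simp
      finally have head: "epowr (a 0) r \<le> ennreal (\<rho> powr r)" .
      have "(\<Sum>i<n. epowr (a i) r) \<le> (\<Sum>i<Suc n. epowr (a i) r)" by simp
      also have "\<dots> = epowr (a 0) r + (\<Sum>i<n. epowr (a (Suc i)) r)" by (rule sum.lessThan_Suc_shift)
      also have "\<dots> \<le> ennreal (\<rho> powr r) + ennreal 2 * ennreal (\<rho> powr r)" by (intro add_mono head tail)
      also have "\<dots> = ennreal R0"
        using nt by (subst ennreal_mult[symmetric], simp, simp, subst ennreal_plus[symmetric]) (auto simp: R0_def r_def)
      finally show "(\<Sum>i<n. epowr (a i) (enn2real q)) \<le> ennreal R0" by (simp add: r_def)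
    qed
    show ?thesis
      using lq_bounded_dyadic[where u="\<lambda>i. 2 ^ i" and m="\<lambda>i. D (2 ^ i - 1)", OF q less_imp_le[OF R0] \<kappa> _ top[unfolded a_def] fin[unfolded a_def]]
      by (simp add: R_def D_def)
  qed
  moreover have "R > 0" using R0 \<kappa> by (simp add: R_def)
  ultimately show ?thesis using that by blast
qed

section \<open>Fourier coefficients of functions in Lorentz--Zygmund spaces\<close>

lemma ennreal_term_le_suminf: "u k \<le> (\<Sum>k. u k :: ennreal)"
  using sum_le_suminf[of u "{k}"] by simp

text \<open>Both integrals are taken over the layers between consecutive values m_i and m_(i+1).
  There the norm is at most m_(i+1), on a set of measure at most 2^(-(i + 1)). Above the cut the
  resulting sum is a tail of the Hoelder estimate. Below it, the same estimate bounds each single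
  m_i, and the p-th powers form a sum dominated by the last layer.\<close>

lemma rearrangement_truncation:
  fixes f :: "'a \<Rightarrow> 'x::real_normed_vector" and m :: "nat \<Rightarrow> real" and e C :: real
  assumes prob: "prob_space M" and [measurable]: "(\<lambda>x. norm (f x)) \<in> borel_measurable M"
    and m0: "\<And>i. 0 \<le> m i" and mono: "\<And>i j. i \<le> j \<Longrightarrow> m i \<le> m j"
    and distr: "\<And>i. emeasure M {x \<in> space M. m i < norm (f x)} \<le> ennreal ((1/2) ^ Suc i)"
    and C: "C > 0" and e: "e < 0"
    and tail: "\<And>I A. finite A \<Longrightarrow> A \<subseteq> {I..} \<Longrightarrow> (\<Sum>i\<in>A. (1/2) ^ Suc i * m i) \<le> C * (1 + real I) powr e"
    and p: "1 < p"
    and G: "\<And>I::nat. (\<Sum>i\<le>I. 2 powr ((p - 1) * real i) * (1 + real i) powr (e * p)) \<le> G * (2 powr ((p - 1) * real I) * (1 + real I) powr (e * p))"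
  shows "(\<integral>\<^sup>+x. ennreal (if m I < norm (f x) then norm (f x) else 0) \<partial>M) \<le> ennreal (2 * C * (1 + real I) powr e)"
    and "(\<integral>\<^sup>+x. ennreal (if m I < norm (f x) then 0 else norm (f x) powr p) \<partial>M)
      \<le> ennreal ((2 * C) powr p * G * (2 powr ((p - 1) * real I) * (1 + real I) powr (e * p)))"
proof -
  interpret prob_space M by fact
  define E where "E = (\<lambda>i. {x \<in> space M. m i < norm (f x)})"
  have E [measurable]: "E i \<in> sets M" for i by (simp add: E_def)
  have Ed: "emeasure M (E i) \<le> ennreal ((1/2) ^ Suc i)" for i unfolding E_def by (rule distr)
  have least: "\<exists>j. m j < norm (f x) \<and> norm (f x) \<le> m (Suc j) \<and> k \<le> j" if "m k < norm (f x)" "norm (f x) \<le> m l" for x k l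
  proof -
    define j where "j = (LEAST j. norm (f x) \<le> m j)"
    have j: "norm (f x) \<le> m j" unfolding j_def using that(2) by (rule LeastI)
    have kj: "k < j" using that(1) j mono[of j k] by (cases "k < j") auto
    then obtain i where i: "j = Suc i" by (cases j) auto
    have "\<not> norm (f x) \<le> m i" using not_less_Least[of i "\<lambda>j. norm (f x) \<le> m j"] i j_def by auto
    then show ?thesis using j i kj by (intro exI[of _ i]) auto
  qed
  show "(\<integral>\<^sup>+x. ennreal (if m I < norm (f x) then norm (f x) else 0) \<partial>M) \<le> ennreal (2 * C * (1 + real I) powr e)"
  proof -
    \<comment> \<open>The norm exceeds all the values m_i only on a null set, so almost every point
      above the cut lies in some layer.\<close>
    have "emeasure M (\<Inter>i. E i) \<le> ennreal ((1/2) ^ Suc i)" for i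
      by (rule order_trans[OF emeasure_mono Ed[of i]]) auto
    moreover have "(\<lambda>i. ennreal ((1/2) ^ Suc i)) \<longlonglongrightarrow> ennreal 0"
      by (intro tendsto_ennrealI LIMSEQ_Suc LIMSEQ_power_zero) simp
    ultimately have "emeasure M (\<Inter>i. E i) \<le> ennreal 0"
      by (intro LIMSEQ_le_const) auto
    then have "(\<Inter>i. E i) \<in> null_sets M" by (intro null_setsI) auto
    then have ae: "AE x in M. \<exists>i. norm (f x) \<le> m i"
      by (rule AE_I') (auto simp: E_def not_le)
    have "(\<integral>\<^sup>+x. ennreal (if m I < norm (f x) then norm (f x) else 0) \<partial>M)
      \<le> (\<integral>\<^sup>+x. (\<Sum>k. ennreal (m (I + k + 1)) * indicator (E (I + k)) x) \<partial>M)"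
    proof (rule nn_integral_mono_AE)
      show "AE x in M. ennreal (if m I < norm (f x) then norm (f x) else 0) \<le> (\<Sum>k. ennreal (m (I + k + 1)) * indicator (E (I + k)) x)"
        using ae AE_space
      proof eventually_elim
        case (elim x)
        show ?case
        proof (cases "m I < norm (f x)")
          case True
          with elim obtain j where j: "m j < norm (f x)" "norm (f x) \<le> m (Suc j)" "I \<le> j"
            using least by blast
          have "ennreal (norm (f x)) \<le> ennreal (m (I + (j - I) + 1)) * indicator (E (I + (j - I))) x"
            using j elim(2) by (simp add: E_def ennreal_leI)
          also have "\<dots> \<le> (\<Sum>k. ennreal (m (I + k + 1)) * indicator (E (I + k)) x)"
            by (rule ennreal_term_le_suminf[of "\<lambda>k. ennreal (m (I + k + 1)) * indicator (E (I + k)) x"])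
          finally show ?thesis using True by simp
        qed simp
      qed
    qed
    also have "\<dots> = (\<Sum>k. ennreal (m (I + k + 1)) * emeasure M (E (I + k)))"
      by (subst nn_integral_suminf) (auto simp: nn_integral_cmult_indicator)
    also have "\<dots> \<le> ennreal (2 * C * (1 + real I) powr e)"
    proof (rule suminf_le_const)
      fix n
      have "(\<Sum>k<n. ennreal (m (I + k + 1)) * emeasure M (E (I + k))) \<le> (\<Sum>k<n. ennreal (m (I + k + 1) * (1/2) ^ Suc (I + k)))"
        using m0 by (intro sum_mono) (auto simp: ennreal_mult simp del: power_Suc intro!: mult_left_mono Ed)
      also have "\<dots> = ennreal (\<Sum>k<n. m (I + k + 1) * (1/2) ^ Suc (I + k))"
        using m0 by (intro sum_ennreal) (auto intro!: mult_nonneg_nonneg)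
      \<comment> \<open>Shifting the index by one, since the layer pairs m_(i+1) with the measure
        belonging to m_i, costs the factor 2.\<close>
      also have "(\<Sum>k<n. m (I + k + 1) * (1/2) ^ Suc (I + k)) = 2 * (\<Sum>i\<in>(\<lambda>k. I + k + 1) ` {..<n}. (1/2) ^ Suc i * m i)"
        by (subst sum.reindex) (auto simp: inj_on_def sum_distrib_left mult_ac)
      also have "ennreal \<dots> \<le> ennreal (2 * (C * (1 + real I) powr e))"
        by (intro ennreal_leI mult_left_mono tail) auto
      finally show "(\<Sum>k<n. ennreal (m (I + k + 1)) * emeasure M (E (I + k))) \<le> ennreal (2 * C * (1 + real I) powr e)"
        by (simp add: mult.assoc)
    qed simp
    finally show ?thesis .
  qed
  show "(\<integral>\<^sup>+x. ennreal (if m I < norm (f x) then 0 else norm (f x) powr p) \<partial>M)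
      \<le> ennreal ((2 * C) powr p * G * (2 powr ((p - 1) * real I) * (1 + real I) powr (e * p)))"
  proof -
    \<comment> \<open>A tail sum with a single term bounds the value itself.\<close>
    have mi: "m i \<le> 2 * C * (2 ^ i * (1 + real i) powr e)" for i
    proof -
      have "(1/2) ^ Suc i * m i \<le> C * (1 + real i) powr e" using tail[of "{i}" i] by simp
      then have "2 ^ Suc i * ((1/2) ^ Suc i * m i) \<le> 2 ^ Suc i * (C * (1 + real i) powr e)" by (rule mult_left_mono) simp
      also have "2 ^ Suc i * ((1/2) ^ Suc i * m i) = m i"
        unfolding mult.assoc[symmetric] power_mult_distrib[symmetric] by simp
      finally show ?thesis by (simp add: mult_ac)
    qed
    have mp: "m i powr p * (1/2) ^ i \<le> (2 * C) powr p * (2 powr ((p - 1) * real i) * (1 + real i) powr (e * p))" for i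
    proof -
      have "m i powr p \<le> (2 * C * (2 ^ i * (1 + real i) powr e)) powr p"
        using p m0 mi by (intro powr_mono2) auto
      also have "\<dots> = (2 * C) powr p * (2 powr (p * real i) * (1 + real i) powr (e * p))"
        using C by (simp add: powr_mult powr_powr mult.commute flip: powr_realpow)
      finally have "m i powr p * (1/2) ^ i \<le> (2 * C) powr p * (2 powr (p * real i) * (1 + real i) powr (e * p)) * (1/2) ^ i"
        by (rule mult_right_mono) simp
      also have "(2 * C) powr p * (2 powr (p * real i) * (1 + real i) powr (e * p)) * (1/2) ^ i
        = (2 * C) powr p * ((2 powr (p * real i) * (1/2) ^ i) * (1 + real i) powr (e * p))"
        by (simp only: mult_ac)
      also have "2 powr (p * real i) * (1/2) ^ i = 2 powr ((p - 1) * real i)"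
      proof -
        have "(1/2) ^ i = (2::real) powr (- real i)"
          by (simp add: powr_minus powr_realpow power_one_over inverse_eq_divide)
        then show ?thesis by (simp add: algebra_simps flip: powr_add)
      qed
      finally show ?thesis .
    qed
    have "(\<integral>\<^sup>+x. ennreal (if m I < norm (f x) then 0 else norm (f x) powr p) \<partial>M)
      \<le> (\<integral>\<^sup>+x. ennreal (m 0 powr p) + (\<Sum>i<I. ennreal (m (Suc i) powr p) * indicator (E i) x) \<partial>M)"
    proof (rule nn_integral_mono)
      fix x assume x: "x \<in> space M"
      show "ennreal (if m I < norm (f x) then 0 else norm (f x) powr p) \<le> ennreal (m 0 powr p) + (\<Sum>i<I. ennreal (m (Suc i) powr p) * indicator (E i) x)"
      proof (cases "norm (f x) \<le> m 0 \<or> m I < norm (f x)")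
        case True
        then have "(if m I < norm (f x) then 0 else norm (f x) powr p) \<le> m 0 powr p"
          using p by (auto intro: powr_mono2)
        from add_increasing2[OF zero_le ennreal_leI[OF this]] show ?thesis .
      next
        case False
        then obtain j where j: "m j < norm (f x)" "norm (f x) \<le> m (Suc j)"
          using least[of 0 x I] by auto
        have "j < I" using j(1) False mono[of I j] by (cases "j < I") auto
        have "ennreal (norm (f x) powr p) \<le> ennreal (m (Suc j) powr p) * indicator (E j) x"
          using j x p by (auto simp: E_def intro!: ennreal_leI powr_mono2)
        also have "\<dots> \<le> (\<Sum>i<I. ennreal (m (Suc i) powr p) * indicator (E i) x)"
          using \<open>j < I\<close> by (intro member_le_sum) auto
        finally show ?thesis using False by (simp add: add_increasing)
      qed
    qed
    also have "\<dots> = ennreal (m 0 powr p) + (\<Sum>i<I. ennreal (m (Suc i) powr p) * emeasure M (E i))"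
      by (subst nn_integral_add, measurable, subst nn_integral_sum, measurable)
        (simp add: nn_integral_cmult_indicator emeasure_space_1 del: sum_mult_indicator)
    \<comment> \<open>The bottom layer has total mass 1, written as \<open>(1/2) ^ 0\<close> so that
      it becomes the term with index 0 of the sum.\<close>
    also have "\<dots> \<le> ennreal (m 0 powr p * (1/2) ^ 0) + (\<Sum>i<I. ennreal (m (Suc i) powr p * (1/2) ^ Suc i))"
      by (intro add_mono sum_mono) (auto simp: ennreal_mult simp del: power_Suc intro!: mult_left_mono Ed)
    also have "\<dots> = (\<Sum>i<Suc I. ennreal (m i powr p * (1/2) ^ i))"
      by (rule sum.lessThan_Suc_shift[symmetric])
    also have "\<dots> = ennreal (\<Sum>i\<le>I. m i powr p * (1/2) ^ i)"
      unfolding lessThan_Suc_atMost by (rule sum_ennreal) simp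
    also have "\<dots> \<le> ennreal ((2 * C) powr p * (\<Sum>i\<le>I. 2 powr ((p - 1) * real i) * (1 + real i) powr (e * p)))"
      unfolding sum_distrib_left by (intro ennreal_leI sum_mono mp)
    also have "\<dots> \<le> ennreal ((2 * C) powr p * (G * (2 powr ((p - 1) * real I) * (1 + real I) powr (e * p))))"
      by (intro ennreal_leI mult_left_mono G) simp
    finally show ?thesis by (simp add: mult.assoc)
  qed
qed

text \<open>The superlevel set \<open>E I\<close> has at most 2^I elements, and off
  \<open>E I\<close> the exponential is at most 4^(-(I + 1)); the factor ln 4 in the exponent is
  there to beat this count. The layers contribute in total the sum of 2^(I + 1) 4^(-(I + 1)), which
  is 1, and \<open>E 0\<close> has at most one element with a term at most 1.\<close>

lemma exp_sum_bound:
  fixes g :: "'a \<Rightarrow> real"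
  assumes B: "B > 0" and \<beta>: "\<beta> > 0" and g: "\<And>n. 0 \<le> g n"
    and card: "\<And>I N. finite N \<Longrightarrow> (\<And>n. n \<in> N \<Longrightarrow> B * (1 + real I) powr (- \<beta>) < g n) \<Longrightarrow> real (card N) \<le> 2 ^ I"
  shows "(\<integral>\<^sup>+n. (if g n = 0 then 0 else ennreal (exp (- (ln 4 * B powr (1 / \<beta>)) * g n powr (- 1 / \<beta>)))) \<partial>count_space UNIV) \<le> ennreal 2"
proof -
  define E where "E = (\<lambda>I::nat. {n. B * (1 + real I) powr (- \<beta>) < g n})"
  define a where "a = ln 4 * B powr (1 / \<beta>)"
  have E: "emeasure (count_space UNIV) (E I) \<le> ennreal (2 ^ I)" for I
  proof -
    have fin: "finite (E I)"
    proof (rule ccontr)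
      assume "infinite (E I)"
      then obtain N where N: "N \<subseteq> E I" "finite N" "card N = Suc (2 ^ I)"
        using infinite_arbitrarily_large by blast
      then have "real (card N) \<le> 2 ^ I" by (intro card) (auto simp: E_def)
      then show False using N(3) by simp
    qed
    have "real (card (E I)) \<le> 2 ^ I" using fin by (intro card) (auto simp: E_def)
    then show ?thesis using fin by (simp add: emeasure_count_space ennreal_of_nat_eq_real_of_nat ennreal_leI)
  qed
  have "(\<integral>\<^sup>+n. (if g n = 0 then 0 else ennreal (exp (- a * g n powr (- 1 / \<beta>)))) \<partial>count_space UNIV)
    \<le> (\<integral>\<^sup>+n. indicator (E 0) n + (\<Sum>I. ennreal ((1/4) ^ Suc I) * indicator (E (Suc I)) n) \<partial>count_space UNIV)"
  proof (rule nn_integral_mono)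
    fix n
    show "(if g n = 0 then 0 else ennreal (exp (- a * g n powr (- 1 / \<beta>)))) \<le> indicator (E 0) n + (\<Sum>I. ennreal ((1/4) ^ Suc I) * indicator (E (Suc I)) n)"
    proof (cases "g n = 0 \<or> n \<in> E 0")
      case True
      have "exp (- a * g n powr (- 1 / \<beta>)) \<le> 1" by (simp add: a_def)
      then have "ennreal (exp (- a * g n powr (- 1 / \<beta>))) \<le> 1" by (simp flip: ennreal_1)
      then show ?thesis using True by (auto intro: add_increasing2)
    next
      case False
      then have gpos: "g n > 0" using g[of n] by simp
      have "(\<lambda>I::nat. B * (1 + real I) powr (- \<beta>)) \<longlonglongrightarrow> 0" using \<beta> by real_asymp
      then have "\<forall>\<^sub>F I in sequentially. B * (1 + real I) powr (- \<beta>) < g n"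
        using gpos by (rule order_tendstoD)
      then have ex: "\<exists>I. n \<in> E I" by (auto simp: E_def eventually_sequentially)
      define J where "J = (LEAST I. n \<in> E I)"
      have J: "n \<in> E J" unfolding J_def using ex by (rule LeastI_ex)
      obtain I where I: "J = Suc I" using J False by (cases J) auto
      have "n \<notin> E I" using not_less_Least[of I "\<lambda>I. n \<in> E I"] I J_def by auto
      then have le: "g n \<le> B * (1 + real I) powr (- \<beta>)" by (simp add: E_def)
      have "(B * (1 + real I) powr (- \<beta>)) powr (- 1 / \<beta>) \<le> g n powr (- 1 / \<beta>)"
        using gpos le \<beta> by (intro powr_mono2') auto
      also have "(B * (1 + real I) powr (- \<beta>)) powr (- 1 / \<beta>) = B powr (- 1 / \<beta>) * (1 + real I)"
        using B \<beta> by (simp add: powr_mult powr_powr)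
      finally have "a * (B powr (- 1 / \<beta>) * (1 + real I)) \<le> a * g n powr (- 1 / \<beta>)"
        by (intro mult_left_mono) (auto simp: a_def)
      also have "a * (B powr (- 1 / \<beta>) * (1 + real I)) = ln 4 * (1 + real I)"
        using B by (simp add: a_def powr_minus_divide)
      finally have "exp (- a * g n powr (- 1 / \<beta>)) \<le> exp (- (ln 4 * (1 + real I)))" by simp
      also have "\<dots> = (1/4) ^ Suc I"
      proof -
        have "exp (- (ln 4 * (1 + real I))) = exp (real (Suc I) * ln (1/4))" by (simp add: ln_div algebra_simps)
        also have "\<dots> = exp (ln (1/4)) ^ Suc I" by (rule exp_of_nat_mult)
        finally show ?thesis by simp
      qed
      finally have "ennreal (exp (- a * g n powr (- 1 / \<beta>))) \<le> ennreal ((1/4) ^ Suc I) * indicator (E (Suc I)) n"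
        using J I by (simp add: ennreal_leI)
      also have "\<dots> \<le> (\<Sum>I. ennreal ((1/4) ^ Suc I) * indicator (E (Suc I)) n)"
        by (rule ennreal_term_le_suminf[of "\<lambda>I. ennreal ((1/4) ^ Suc I) * indicator (E (Suc I)) n"])
      finally show ?thesis using False by (simp add: add_increasing)
    qed
  qed
  also have "\<dots> = emeasure (count_space UNIV) (E 0) + (\<Sum>I. ennreal ((1/4) ^ Suc I) * emeasure (count_space UNIV) (E (Suc I)))"
    by (subst nn_integral_add, simp, simp, subst nn_integral_suminf) (simp_all add: nn_integral_cmult_indicator)
  also have "\<dots> \<le> ennreal 1 + (\<Sum>I. ennreal ((1/2) ^ Suc I))"
  proof (intro add_mono suminf_le)
    show "emeasure (count_space UNIV) (E 0) \<le> ennreal 1" using E[of 0] by simp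
    fix I
    have "ennreal ((1/4) ^ Suc I) * emeasure (count_space UNIV) (E (Suc I)) \<le> ennreal ((1/4) ^ Suc I) * ennreal (2 ^ Suc I)"
      by (intro mult_left_mono E) simp
    also have "\<dots> = ennreal ((1/2) ^ Suc I)"
      by (subst ennreal_mult[symmetric], simp, simp, subst power_mult_distrib[symmetric]) simp
    finally show "ennreal ((1/4) ^ Suc I) * emeasure (count_space UNIV) (E (Suc I)) \<le> ennreal ((1/2) ^ Suc I)" .
  qed auto
  also have "(\<Sum>I. ennreal ((1/2) ^ Suc I)) = ennreal 1"
    using power_half_series by (intro suminf_ennreal_eq) auto
  also have "ennreal 1 + ennreal 1 = ennreal 2" by (simp flip: ennreal_plus)
  finally show ?thesis unfolding a_def .
qed

lemma decr_rearr_finite_distribution: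
  assumes "(\<lambda>x. norm (f x)) \<in> borel_measurable M" "decr_rearr M f t \<noteq> top"
  shows "emeasure M {x \<in> space M. enn2real (decr_rearr M f t) < norm (f x)} \<le> ennreal t"
proof -
  have "decr_rearr M f t = ennreal (enn2real (decr_rearr M f t))" using assms(2) by (simp add: less_top)
  then have "(decr_rearr M f t < ennreal y) = (enn2real (decr_rearr M f t) < y)" for y
    by (metis enn2real_nonneg ennreal_less_iff)
  then show ?thesis using emeasure_above_decr_rearr[OF assms(1), of t] by simp
qed

text \<open>It suffices to count the coefficients above
  \<open>B * (1 + real I) powr (- \<beta>)\<close>. The large part \<open>f1\<close> of the function
  accounts for at most \<open>2 * C\<close> of the factor \<open>B\<close>, so at these frequencies
  the coefficients of the bounded part \<open>f2\<close> are at least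
  \<open>B2 * (1 + real I) powr (- \<beta>)\<close>, and the type inequality limits their
  number.\<close>

lemma fourier_coeff_exp_sum:
  fixes q :: ennreal and b \<rho> K :: real
  assumes p: "1 < p" and K: "0 < K"
    and type: "\<And>(f :: real^'d::finite \<Rightarrow> 'x::complex_banach) b y N. strongly_measurable torus f \<Longrightarrow> (\<And>x. norm (f x) \<le> b) \<Longrightarrow>
      0 \<le> y \<Longrightarrow> (\<integral>\<^sup>+x. ennreal (norm (f x) powr p) \<partial>torus) \<le> ennreal y \<Longrightarrow> finite N \<Longrightarrow>
      (\<Sum>n\<in>N. norm (fourier_coeff f n) powr (p / (p - 1))) \<le> K * y powr (1 / (p - 1))"
    and q: "1 \<le> q" and b: "b + enn2real (1 / q) > 0" and \<rho>: "\<rho> > 0"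
  obtains a where "a > 0" "\<And>f :: real^'d \<Rightarrow> 'x. strongly_measurable torus f \<Longrightarrow> L1_log_norm q (b + 1) f \<le> ennreal \<rho> \<Longrightarrow>
    (\<integral>\<^sup>+n. (if fourier_coeff f n = 0 then 0
                   else ennreal (exp (- a * norm (fourier_coeff f n) powr (- 1 / (b + enn2real (1 / q))))))
               \<partial>count_space UNIV) \<le> ennreal 2"
proof -
  define \<beta> where "\<beta> = b + enn2real (1 / q)"
  have \<beta>: "\<beta> > 0" using b by (simp add: \<beta>_def)
  have e: "- \<beta> = 1 - enn2real (1 / q) - (b + 1)" by (simp add: \<beta>_def)
  define r where "r = p / (p - 1)"
  have r: "r > 0" using p by (simp add: r_def)
  obtain R where R: "R > 0" "\<And>f :: real^'d \<Rightarrow> 'x. L1_log_norm q (b + 1) f \<le> ennreal \<rho> \<Longrightarrow>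
    (\<forall>i. decr_rearr torus f ((1/2) ^ Suc i) \<noteq> top) \<and>
    lq_bounded q R (\<lambda>i. (1 + real i) powr (b + 1) * ((1/2) ^ Suc i * enn2real (decr_rearr torus f ((1/2) ^ Suc i))))"
    by (rule L1_log_norm_dyadic[OF q \<rho>, where 'd='d and 'x='x]) blast
  obtain C where C: "C > 0" "\<And>x (I::nat) A. (\<And>i. 0 \<le> x i) \<Longrightarrow> lq_bounded q R (\<lambda>i. (1 + real i) powr (b + 1) * x i) \<Longrightarrow>
    finite A \<Longrightarrow> (- \<beta> < 0 \<Longrightarrow> A \<subseteq> {I..}) \<Longrightarrow> (- \<beta> > 0 \<Longrightarrow> A \<subseteq> {..I}) \<Longrightarrow> (\<Sum>i\<in>A. x i) \<le> C * (1 + real I) powr (- \<beta>)"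
    by (rule hoelder_dyadic[OF q e _ R(1)]) (use \<beta> in auto)
  obtain G where G: "G > 0" "\<And>I::nat. (\<Sum>i\<le>I. 2 powr ((p - 1) * real i) * (1 + real i) powr (- \<beta> * p)) \<le> G * (2 powr ((p - 1) * real I) * (1 + real I) powr (- \<beta> * p))"
    by (rule geometric_sum_bound[of "p - 1" "- \<beta> * p"]) (use p in auto)
  define C2 where "C2 = (2 * C) powr p * G"
  have C2: "C2 > 0" using C G by (simp add: C2_def)
  \<comment> \<open>Its r-th power equals the constant of the type estimate for \<open>f2\<close>,
    so the count comes out as exactly 2^I.\<close>
  define B2 where "B2 = (K * C2 powr (1 / (p - 1))) powr (1 / r)"
  have B2: "B2 > 0" "B2 powr r = K * C2 powr (1 / (p - 1))" using K C2 r by (auto simp: B2_def powr_powr)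
  define B where "B = 2 * C + B2"
  have B: "B > 0" using C B2 by (simp add: B_def)
  have bound: "(\<integral>\<^sup>+n. (if norm (fourier_coeff f n) = 0 then 0
                   else ennreal (exp (- (ln 4 * B powr (1 / \<beta>)) * norm (fourier_coeff f n) powr (- 1 / \<beta>)))) \<partial>count_space UNIV) \<le> ennreal 2"
    if f: "strongly_measurable torus f" and norm: "L1_log_norm q (b + 1) f \<le> ennreal \<rho>" for f :: "real^'d \<Rightarrow> 'x"
  proof (rule exp_sum_bound[OF B \<beta> norm_ge_zero])
    fix I :: nat and N
    assume N: "finite N" "\<And>n. n \<in> N \<Longrightarrow> B * (1 + real I) powr (- \<beta>) < norm (fourier_coeff f n)"
    have fm [measurable]: "(\<lambda>x. norm (f x)) \<in> borel_measurable torus"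
      by (rule strongly_measurable_norm[OF complete_measure_torus f])
    define m where "m = (\<lambda>i. enn2real (decr_rearr torus f ((1/2) ^ Suc i)))"
    have dr: "decr_rearr torus f ((1/2) ^ Suc i) \<noteq> top" for i using R(2)[OF norm] by blast
    have lq: "lq_bounded q R (\<lambda>i. (1 + real i) powr (b + 1) * ((1/2) ^ Suc i * m i))"
      using R(2)[OF norm] by (simp add: m_def)
    have m0: "0 \<le> m i" for i by (simp add: m_def)
    have mono: "m i \<le> m j" if "i \<le> j" for i j
      unfolding m_def
    proof (rule enn2real_mono)
      show "decr_rearr torus f ((1 / 2) ^ Suc i) \<le> decr_rearr torus f ((1 / 2) ^ Suc j)"
        using that by (intro decr_rearr_antimono power_decreasing) auto
      show "decr_rearr torus f ((1 / 2) ^ Suc j) < top" using dr[of j] by (simp add: less_top)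
    qed
    have distr: "emeasure torus {x \<in> space torus. m i < norm (f x)} \<le> ennreal ((1/2) ^ Suc i)" for i
      unfolding m_def by (rule decr_rearr_finite_distribution[OF fm dr])
    have tail: "(\<Sum>i\<in>A. (1/2) ^ Suc i * m i) \<le> C * (1 + real I) powr (- \<beta>)" if "finite A" "A \<subseteq> {I..}" for I A
      by (rule C(2)[OF _ lq]) (use m0 that \<beta> in \<open>auto intro!: mult_nonneg_nonneg\<close>)
    have neg: "- \<beta> < 0" using \<beta> by simp
    have split: "(\<integral>\<^sup>+x. ennreal (if m I < norm (f x) then norm (f x) else 0) \<partial>torus) \<le> ennreal (2 * C * (1 + real I) powr (- \<beta>))"
      "(\<integral>\<^sup>+x. ennreal (if m I < norm (f x) then 0 else norm (f x) powr p) \<partial>torus)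
        \<le> ennreal ((2 * C) powr p * G * (2 powr ((p - 1) * real I) * (1 + real I) powr (- \<beta> * p)))"
      by (rule rearrangement_truncation[where m=m and p=p and e="- \<beta>" and G=G and C=C, OF prob_space_torus fm],
          (erule (1) tail | rule m0 distr C(1) neg p G(2) | erule mono)+)+
    define f1 where "f1 = (\<lambda>x. if m I < norm (f x) then f x else 0)"
    define f2 where "f2 = (\<lambda>x. if m I < norm (f x) then 0 else f x)"
    have Es: "{x \<in> space torus. m I < norm (f x)} \<in> sets torus" "{x \<in> space torus. \<not> m I < norm (f x)} \<in> sets torus"
      by auto
    \<comment> \<open>The truncations are defined on the whole space, so that the bound on
      \<open>f2\<close> holds everywhere, whereas the measurable level sets lie inside the cube. The
      two versions agree on the cube, which is all that matters for measurability.\<close>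
    have aeq: "strongly_measurable torus g \<Longrightarrow> (\<And>x. x \<in> space torus \<Longrightarrow> g x = h x) \<Longrightarrow> strongly_measurable torus h" for g h :: "real^'d \<Rightarrow> 'x"
      unfolding strongly_measurable_def by (elim exE conjE, intro exI conjI, assumption) (auto elim!: AE_mp intro!: AE_I2)
    have f1: "strongly_measurable torus f1"
      by (rule aeq[OF strongly_measurable_indicator[OF f Es(1)]]) (auto simp: f1_def)
    have f2: "strongly_measurable torus f2"
      by (rule aeq[OF strongly_measurable_indicator[OF f Es(2)]]) (auto simp: f2_def)
    have f2b: "norm (f2 x) \<le> m I" for x using m0 by (auto simp: f2_def)
    have int1: "(\<integral>\<^sup>+x. ennreal (norm (f1 x)) \<partial>torus) \<le> ennreal (2 * C * (1 + real I) powr (- \<beta>))"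
    proof -
      have "norm (f1 x) = (if m I < norm (f x) then norm (f x) else 0)" for x by (simp add: f1_def)
      then show ?thesis using split(1) by simp
    qed
    define y where "y = C2 * (2 powr ((p - 1) * real I) * (1 + real I) powr (- \<beta> * p))"
    have y: "y \<ge> 0" using C2 by (simp add: y_def)
    have int2: "(\<integral>\<^sup>+x. ennreal (norm (f2 x) powr p) \<partial>torus) \<le> ennreal y"
    proof -
      have "norm (f2 x) powr p = (if m I < norm (f x) then 0 else norm (f x) powr p)" for x by (simp add: f2_def)
      then show ?thesis using split(2) by (simp add: y_def C2_def)
    qed
    interpret prob_space "torus :: (real^'d) measure" by (rule prob_space_torus)
    have fin1: "(\<integral>\<^sup>+x. ennreal (norm (f1 x)) \<partial>torus) < \<infinity>" using int1 by (rule le_less_trans) simp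
    have fin2: "(\<integral>\<^sup>+x. ennreal (norm (f2 x)) \<partial>torus) < \<infinity>"
    proof -
      have "(\<integral>\<^sup>+x. ennreal (norm (f2 x)) \<partial>torus) \<le> (\<integral>\<^sup>+x. ennreal (m I) \<partial>(torus :: (real^'d) measure))"
        by (intro nn_integral_mono ennreal_leI f2b)
      also have "\<dots> < \<infinity>" by (simp add: emeasure_space_1)
      finally show ?thesis .
    qed
    have fe: "fourier_coeff f n = fourier_coeff f1 n + fourier_coeff f2 n" for n
    proof -
      have "f = (\<lambda>x. f1 x + f2 x)" by (auto simp: f1_def f2_def)
      then show ?thesis using fourier_coeff_add[OF f1 fin1 f2 fin2, of n] by simp
    qed
    have "B2 * (1 + real I) powr (- \<beta>) \<le> norm (fourier_coeff f2 n)" if "n \<in> N" for n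
    proof -
      have "ennreal (norm (fourier_coeff f1 n)) \<le> ennreal (2 * C * (1 + real I) powr (- \<beta>))"
        using norm_fourier_coeff_le[OF f1 fin1] int1 by (rule order_trans)
      then have "norm (fourier_coeff f1 n) \<le> 2 * C * (1 + real I) powr (- \<beta>)" using C(1) by simp
      moreover have "B * (1 + real I) powr (- \<beta>) < norm (fourier_coeff f n)" by (rule N(2)[OF that])
      moreover have "norm (fourier_coeff f n) \<le> norm (fourier_coeff f1 n) + norm (fourier_coeff f2 n)"
        unfolding fe by (rule norm_triangle_ineq)
      ultimately show ?thesis by (simp add: B_def distrib_right)
    qed
    then have "(\<Sum>n\<in>N. (B2 * (1 + real I) powr (- \<beta>)) powr r) \<le> (\<Sum>n\<in>N. norm (fourier_coeff f2 n) powr r)"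
      using r B2 by (intro sum_mono powr_mono2) auto
    also have "\<dots> \<le> K * y powr (1 / (p - 1))"
      unfolding r_def by (rule type[OF f2 f2b y int2 N(1)])
    \<comment> \<open>The root 1/(p - 1) turns 2^((p - 1) I) into 2^I and the exponent p into r,
      matching the power on the left-hand side.\<close>
    also have "y powr (1 / (p - 1)) = C2 powr (1 / (p - 1)) * (2 ^ I * ((1 + real I) powr (- \<beta>)) powr r)"
    proof -
      have "(2 powr ((p - 1) * real I)) powr (1 / (p - 1)) = 2 ^ I"
        using p by (simp add: powr_powr powr_realpow)
      moreover have "((1 + real I) powr (- \<beta> * p)) powr (1 / (p - 1)) = ((1 + real I) powr (- \<beta>)) powr r"
        by (simp add: powr_powr r_def)
      ultimately show ?thesis using C2 by (simp add: y_def powr_mult)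
    qed
    also have "K * (C2 powr (1 / (p - 1)) * (2 ^ I * ((1 + real I) powr (- \<beta>)) powr r)) = 2 ^ I * (B2 * (1 + real I) powr (- \<beta>)) powr r"
      using B2 by (simp add: powr_mult mult_ac)
    finally have "real (card N) * (B2 * (1 + real I) powr (- \<beta>)) powr r \<le> 2 ^ I * (B2 * (1 + real I) powr (- \<beta>)) powr r" by simp
    moreover have "0 < (B2 * (1 + real I) powr (- \<beta>)) powr r" using B2 by simp
    ultimately show "real (card N) \<le> 2 ^ I" by simp
  qed
  show ?thesis
  proof (rule that[of "ln 4 * B powr (1 / \<beta>)"])
    show "ln 4 * B powr (1 / \<beta>) > 0" using B by simp
  next
    fix f :: "real^'d \<Rightarrow> 'x"
    assume "strongly_measurable torus f" "L1_log_norm q (b + 1) f \<le> ennreal \<rho>"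
    from bound[OF this]
    show "(\<integral>\<^sup>+n. (if fourier_coeff f n = 0 then 0
                   else ennreal (exp (- (ln 4 * B powr (1 / \<beta>)) * norm (fourier_coeff f n) powr (- 1 / (b + enn2real (1 / q))))))
               \<partial>count_space UNIV) \<le> ennreal 2"
      unfolding \<beta>_def norm_eq_zero .
  qed
qed

section \<open>Fourier series of sequences in Lorentz--Zygmund spaces\<close>

text \<open>Each point is charged to one layer in which its value is at most \<open>w i\<close>, and
  layer \<open>i\<close> is charged at most \<open>k i\<close> times.\<close>

lemma layer_sum_bound:
  fixes h :: "'a \<Rightarrow> real" and w k :: "nat \<Rightarrow> real"
  assumes T: "finite T" and A: "finite A" and S: "\<And>i. finite (S i)" "\<And>i. real (card (S i)) \<le> k i"
    and w: "\<And>i. 0 \<le> w i" and cover: "\<And>n. n \<in> T \<Longrightarrow> \<exists>i\<in>A. n \<in> S i \<and> h n \<le> w i"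
  shows "(\<Sum>n\<in>T. h n) \<le> (\<Sum>i\<in>A. w i * k i)"
proof -
  have "h n \<le> (\<Sum>i\<in>A. if n \<in> S i then w i else 0)" if n: "n \<in> T" for n
  proof -
    obtain i where i: "i \<in> A" "n \<in> S i" "h n \<le> w i" using cover[OF n] by blast
    have "(if n \<in> S i then w i else 0) \<le> (\<Sum>i\<in>A. if n \<in> S i then w i else 0)"
      by (rule member_le_sum[OF i(1) _ A]) (use w in auto)
    then show ?thesis using i by simp
  qed
  then have "(\<Sum>n\<in>T. h n) \<le> (\<Sum>n\<in>T. \<Sum>i\<in>A. if n \<in> S i then w i else 0)" by (rule sum_mono)
  also have "\<dots> = (\<Sum>i\<in>A. \<Sum>n\<in>T. if n \<in> S i then w i else 0)" by (rule sum.swap)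
  also have "\<dots> \<le> (\<Sum>i\<in>A. w i * k i)"
  proof (rule sum_mono)
    fix i
    have "(\<Sum>n\<in>T. if n \<in> S i then w i else 0) = w i * real (card (T \<inter> S i))"
      using T by (simp add: sum.If_cases mult.commute Int_def)
    also have "\<dots> \<le> w i * k i"
    proof (rule mult_left_mono[OF _ w])
      have "card (T \<inter> S i) \<le> card (S i)" by (rule card_mono[OF S(1)]) auto
      then show "real (card (T \<inter> S i)) \<le> k i" using S(2)[of i] by linarith
    qed
    finally show "(\<Sum>n\<in>T. if n \<in> S i then w i else 0) \<le> w i * k i" .
  qed
  finally show ?thesis .
qed

text \<open>The mirror image of the function case: the values z_i decrease, the level sets grow and
  have fewer than 2^i elements. The large terms are now an initial segment of layers, estimated by a
  head sum, and the p-th powers beyond the cut form a geometrically decreasing sum dominated by its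
  first layer.\<close>

lemma sequence_truncation:
  fixes c :: "'a \<Rightarrow> 'x::real_normed_vector" and z :: "nat \<Rightarrow> real"
  assumes z0: "\<And>i. 0 \<le> z i" and mono: "\<And>i j. i \<le> j \<Longrightarrow> z j \<le> z i"
    and distr: "\<And>i. emeasure (count_space UNIV) {n. z i < norm (c n)} \<le> ennreal (real (2 ^ i - 1))"
    and C: "C > 0" and \<beta>: "\<beta> > 0"
    and head: "\<And>I A. finite A \<Longrightarrow> A \<subseteq> {..I} \<Longrightarrow> (\<Sum>i\<in>A. 2 ^ i * z i) \<le> C * (1 + real I) powr \<beta>"
    and p: "1 < p"
    and G: "\<And>I J::nat. (\<Sum>i=I..<J. 2 powr (- ((p - 1) * real i)) * (1 + real i) powr (\<beta> * p)) \<le> G * (2 powr (- ((p - 1) * real I)) * (1 + real I) powr (\<beta> * p))"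
  shows "finite {n. z I < norm (c n)}"
    and "(\<Sum>n\<in>{n. z I < norm (c n)}. norm (c n)) \<le> 2 * C * (1 + real I) powr \<beta>"
    and "I \<le> J \<Longrightarrow> (\<Sum>n\<in>{n. z J < norm (c n)} - {n. z I < norm (c n)}. norm (c n) powr p)
      \<le> 2 * C powr p * G * (2 powr (- ((p - 1) * real I)) * (1 + real I) powr (\<beta> * p))"
    and "c n \<noteq> 0 \<Longrightarrow> \<forall>\<^sub>F I in sequentially. n \<in> {n. z I < norm (c n)}"
proof -
  define S where "S = (\<lambda>i. {n. z i < norm (c n)})"
  have fin: "finite (S i)" for i
    using distr[of i] unfolding S_def[symmetric] by (rule_tac ccontr) (simp add: S_def emeasure_count_space_infinite top_unique)
  then show "finite {n. z I < norm (c n)}" by (simp add: S_def)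
  have cardS: "real (card (S i)) \<le> real (2 ^ i - 1)" for i
    using distr[of i] fin[of i] by (simp add: S_def emeasure_count_space ennreal_of_nat_eq_real_of_nat del: of_nat_diff)
  \<comment> \<open>Since 2^0 - 1 = 0, no term exceeds z_0; thus the layers from index 0 on cover
    each level set.\<close>
  have S0: "S 0 = {}" using cardS[of 0] fin[of 0] by simp
  have card2: "real (card (S (Suc i))) \<le> 2 * 2 ^ i" for i
  proof -
    have "real (2 ^ Suc i - 1) \<le> real (2 ^ Suc i)" by (rule of_nat_mono) simp
    also have "\<dots> = 2 * 2 ^ i" by simp
    finally show ?thesis using cardS[of "Suc i"] by linarith
  qed
  have layer: "\<exists>i. I \<le> i \<and> i < J \<and> n \<in> S (Suc i) \<and> norm (c n) \<le> z i" if "n \<in> S J" "n \<notin> S I" for n I J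
  proof -
    define j where "j = (LEAST j. n \<in> S j)"
    have j: "n \<in> S j" unfolding j_def using that(1) by (rule LeastI)
    have "j \<le> J" unfolding j_def using that(1) by (rule Least_le)
    have "I < j"
    proof (rule ccontr)
      assume "\<not> I < j"
      then have "z I \<le> z j" using mono[of j I] by simp
      then show False using j that(2) by (simp add: S_def)
    qed
    then obtain i where i: "j = Suc i" by (cases j) auto
    have "n \<notin> S i" using not_less_Least[of i "\<lambda>j. n \<in> S j"] i j_def by auto
    then show ?thesis using j i \<open>I < j\<close> \<open>j \<le> J\<close> by (intro exI[of _ i]) (auto simp: S_def)
  qed
  show "(\<Sum>n\<in>{n. z I < norm (c n)}. norm (c n)) \<le> 2 * C * (1 + real I) powr \<beta>"
  proof -
    have "(\<Sum>n\<in>S I. norm (c n)) \<le> (\<Sum>i\<in>{..<I}. z i * (2 * 2 ^ i))"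
    proof (rule layer_sum_bound[where S="\<lambda>i. S (Suc i)"])
      fix n assume "n \<in> S I"
      then show "\<exists>i\<in>{..<I}. n \<in> S (Suc i) \<and> norm (c n) \<le> z i" using layer[of n I 0] S0 by auto
    qed (use fin card2 z0 in auto)
    also have "\<dots> = 2 * (\<Sum>i\<in>{..<I}. 2 ^ i * z i)" by (simp add: sum_distrib_left mult_ac)
    also have "\<dots> \<le> 2 * (C * (1 + real I) powr \<beta>)" by (intro mult_left_mono head) auto
    finally show ?thesis by (simp add: S_def)
  qed
  have zi: "z i \<le> C * (2 powr (- real i) * (1 + real i) powr \<beta>)" for i
  proof -
    have "2 ^ i * z i \<le> C * (1 + real i) powr \<beta>" using head[of "{i}" i] by simp
    then have "2 powr (- real i) * (2 ^ i * z i) \<le> 2 powr (- real i) * (C * (1 + real i) powr \<beta>)" by (rule mult_left_mono) simp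
    also have "2 powr (- real i) * (2 ^ i * z i) = z i"
      by (simp add: powr_minus powr_realpow)
    finally show ?thesis by (simp add: mult_ac)
  qed
  show "(\<Sum>n\<in>{n. z J < norm (c n)} - {n. z I < norm (c n)}. norm (c n) powr p)
      \<le> 2 * C powr p * G * (2 powr (- ((p - 1) * real I)) * (1 + real I) powr (\<beta> * p))" if "I \<le> J"
  proof -
    have "(\<Sum>n\<in>S J - S I. norm (c n) powr p) \<le> (\<Sum>i\<in>{I..<J}. z i powr p * (2 * 2 ^ i))"
    proof (rule layer_sum_bound[where S="\<lambda>i. S (Suc i)"])
      fix n assume "n \<in> S J - S I"
      then obtain i where "I \<le> i" "i < J" "n \<in> S (Suc i)" "norm (c n) \<le> z i" using layer[of n J I] by auto
      then show "\<exists>i\<in>{I..<J}. n \<in> S (Suc i) \<and> norm (c n) powr p \<le> z i powr p"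
        using p by (intro bexI[of _ i]) (auto intro: powr_mono2)
    qed (use fin card2 in auto)
    also have "\<dots> \<le> (\<Sum>i=I..<J. 2 * C powr p * (2 powr (- ((p - 1) * real i)) * (1 + real i) powr (\<beta> * p)))"
    proof (rule sum_mono)
      fix i
      have "z i powr p \<le> (C * (2 powr (- real i) * (1 + real i) powr \<beta>)) powr p"
        using z0 zi p by (intro powr_mono2) auto
      also have "\<dots> = C powr p * (2 powr (- (p * real i)) * (1 + real i) powr (\<beta> * p))"
        using C by (simp add: powr_mult powr_powr mult.commute)
      finally have "z i powr p * (2 * 2 ^ i) \<le> C powr p * (2 powr (- (p * real i)) * (1 + real i) powr (\<beta> * p)) * (2 * 2 ^ i)"
        by (rule mult_right_mono) simp
      also have "\<dots> = 2 * C powr p * ((2 powr (- (p * real i)) * 2 ^ i) * (1 + real i) powr (\<beta> * p))"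
        by (simp only: mult_ac)
      also have "2 powr (- (p * real i)) * 2 ^ i = 2 powr (- ((p - 1) * real i))"
        by (simp add: algebra_simps flip: powr_add powr_realpow)
      finally show "z i powr p * (2 * 2 ^ i) \<le> 2 * C powr p * (2 powr (- ((p - 1) * real i)) * (1 + real i) powr (\<beta> * p))" .
    qed
    also have "\<dots> \<le> 2 * C powr p * (G * (2 powr (- ((p - 1) * real I)) * (1 + real I) powr (\<beta> * p)))"
      unfolding sum_distrib_left[symmetric] by (intro mult_left_mono G) simp
    finally show ?thesis by (simp add: S_def mult.assoc)
  qed
  show "\<forall>\<^sub>F I in sequentially. n \<in> {n. z I < norm (c n)}" if "c n \<noteq> 0"
  proof -
    \<comment> \<open>The bound on z_i tends to 0, so every nonzero term is selected from some level
      on.\<close>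
    have "(\<lambda>i::nat. C * (2 powr (- real i) * (1 + real i) powr \<beta>)) \<longlonglongrightarrow> 0" using C by real_asymp
    then have "\<forall>\<^sub>F i in sequentially. C * (2 powr (- real i) * (1 + real i) powr \<beta>) < norm (c n)"
      by (rule order_tendstoD) (use that in simp)
    then show ?thesis by eventually_elim (use zi in \<open>auto intro: le_less_trans\<close>)
  qed
qed

text \<open>The base 3/2 is chosen so that its product with the tail ratio 1/2 is 3/4 < 1. A point
  of \<open>E I\<close> whose first admissible level is I + 1 has exponential at most (3/2)^(I + 2),
  so the layers contribute at most D (9/4) times the sum of (3/4)^I, which is 9 D; points admissible
  at level 0 contribute at most 3/2.\<close>

lemma exp_integral_bound:
  fixes h :: "'a \<Rightarrow> real"
  assumes M: "prob_space M" and h[measurable]: "h \<in> borel_measurable M" and h0: "\<And>x. 0 \<le> h x"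
    and B: "B > 0" and \<beta>: "\<beta> > 0" and D: "D \<ge> 0"
    and distr: "\<And>I::nat. emeasure M {x \<in> space M. B * (1 + real I) powr \<beta> < h x} \<le> ennreal (D * (1/2) ^ I)"
  shows "(\<integral>\<^sup>+x. ennreal (exp (ln (3/2) * B powr (- 1 / \<beta>) * h x powr (1 / \<beta>))) \<partial>M) \<le> ennreal (3/2 + 9 * D)"
proof -
  interpret prob_space M by fact
  define a where "a = ln (3/2) * B powr (- 1 / \<beta>)"
  have a: "a > 0" using B by (simp add: a_def)
  define E where "E = (\<lambda>I::nat. {x \<in> space M. B * (1 + real I) powr \<beta> < h x})"
  have bound: "exp (a * h x powr (1 / \<beta>)) \<le> (3/2) ^ Suc I" if "h x \<le> B * (1 + real I) powr \<beta>" for x and I :: nat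
  proof -
    have "h x powr (1 / \<beta>) \<le> (B * (1 + real I) powr \<beta>) powr (1 / \<beta>)"
      using that h0 \<beta> by (intro powr_mono2) auto
    also have "\<dots> = B powr (1 / \<beta>) * (1 + real I)" using B \<beta> by (simp add: powr_mult powr_powr)
    finally have "a * h x powr (1 / \<beta>) \<le> a * (B powr (1 / \<beta>) * (1 + real I))"
      using a by (intro mult_left_mono) auto
    also have "\<dots> = real (Suc I) * ln (3/2)" using B by (simp add: a_def powr_minus_divide)
    finally have "exp (a * h x powr (1 / \<beta>)) \<le> exp (real (Suc I) * ln (3/2))" by simp
    also have "\<dots> = exp (ln (3/2)) ^ Suc I" by (rule exp_of_nat_mult)
    finally show ?thesis by simp
  qed
  have "(\<integral>\<^sup>+x. ennreal (exp (a * h x powr (1 / \<beta>))) \<partial>M)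
    \<le> (\<integral>\<^sup>+x. ennreal (3/2) + (\<Sum>I. ennreal ((3/2) ^ Suc (Suc I)) * indicator (E I) x) \<partial>M)"
  proof (rule nn_integral_mono)
    fix x assume x: "x \<in> space M"
    show "ennreal (exp (a * h x powr (1 / \<beta>))) \<le> ennreal (3/2) + (\<Sum>I. ennreal ((3/2) ^ Suc (Suc I)) * indicator (E I) x)"
    proof (cases "h x \<le> B * (1 + real 0) powr \<beta>")
      case True
      from bound[OF this] have "exp (a * h x powr (1 / \<beta>)) \<le> 3/2" by simp
      from add_increasing2[OF zero_le ennreal_leI[OF this]] show ?thesis .
    next
      case False
      have "filterlim (\<lambda>I::nat. B * (1 + real I) powr \<beta>) at_top sequentially" using B \<beta> by real_asymp
      then have "\<forall>\<^sub>F I in sequentially. h x \<le> B * (1 + real I) powr \<beta>" by (simp add: filterlim_at_top)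
      then have ex: "\<exists>I::nat. h x \<le> B * (1 + real I) powr \<beta>" by (auto simp: eventually_sequentially)
      define J where "J = (LEAST I::nat. h x \<le> B * (1 + real I) powr \<beta>)"
      have J: "h x \<le> B * (1 + real J) powr \<beta>" unfolding J_def using ex by (rule LeastI_ex)
      obtain I where I: "J = Suc I" using J False by (cases J) auto
      have "\<not> h x \<le> B * (1 + real I) powr \<beta>"
        using not_less_Least[of I "\<lambda>I. h x \<le> B * (1 + real I) powr \<beta>"] I J_def by auto
      then have "x \<in> E I" using x by (simp add: E_def)
      then have "ennreal (exp (a * h x powr (1 / \<beta>))) \<le> ennreal ((3/2) ^ Suc (Suc I)) * indicator (E I) x"
        using ennreal_leI[OF bound[OF J]] by (simp add: I)
      also have "\<dots> \<le> (\<Sum>I. ennreal ((3/2) ^ Suc (Suc I)) * indicator (E I) x)"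
        by (rule ennreal_term_le_suminf[of "\<lambda>I. ennreal ((3/2) ^ Suc (Suc I)) * indicator (E I) x"])
      finally show ?thesis by (rule add_increasing[OF zero_le])
    qed
  qed
  also have "\<dots> = ennreal (3/2) + (\<Sum>I. ennreal ((3/2) ^ Suc (Suc I)) * emeasure M (E I))"
    by (subst nn_integral_add, simp, simp add: E_def, subst nn_integral_suminf)
      (simp_all add: E_def nn_integral_cmult_indicator emeasure_space_1 del: power_Suc)
  also have "\<dots> \<le> ennreal (3/2) + (\<Sum>I. ennreal (D * 9/4 * (3/4) ^ I))"
  proof (intro add_mono suminf_le order_refl)
    fix I
    have "ennreal ((3/2) ^ Suc (Suc I)) * emeasure M (E I) \<le> ennreal ((3/2) ^ Suc (Suc I)) * ennreal (D * (1/2) ^ I)"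
      unfolding E_def by (intro mult_left_mono distr) simp
    also have "\<dots> = ennreal ((3/2) ^ Suc (Suc I) * (D * (1/2) ^ I))" using D by (intro ennreal_mult[symmetric]) auto
    also have "(3/2) ^ Suc (Suc I) * (D * (1/2) ^ I) = D * 9/4 * ((3/2) ^ I * (1/2) ^ I)" by simp
    also have "(3/2::real) ^ I * (1/2) ^ I = (3/4) ^ I" by (simp flip: power_mult_distrib)
    finally show "ennreal ((3/2) ^ Suc (Suc I)) * emeasure M (E I) \<le> ennreal (D * 9/4 * (3/4) ^ I)" .
  qed auto
  also have "(\<Sum>I. ennreal (D * 9/4 * (3/4) ^ I)) = ennreal (9 * D)"
  proof (rule suminf_ennreal_eq)
    have "(\<lambda>I. D * 9/4 * (3/4) ^ I) sums (D * 9/4 * (1 / (1 - 3/4)))"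
      by (intro sums_mult geometric_sums) simp
    then show "(\<lambda>I. D * 9/4 * (3/4) ^ I) sums (9 * D)" by simp
  qed (use D in auto)
  also have "ennreal (3/2) + ennreal (9 * D) = ennreal (3/2 + 9 * D)" using D by (simp flip: ennreal_plus)
  finally show ?thesis unfolding a_def .
qed

section \<open>Construction of a function with prescribed coefficients\<close>

lemma trig_poly_strong_integral:
  fixes c :: "int^'d::finite \<Rightarrow> 'x::complex_banach"
  assumes S: "finite S"
  shows "has_strong_integral torus (\<lambda>t. character (- n) t *\<^sub>C (\<Sum>m\<in>S. character m t *\<^sub>C c m)) (if n \<in> S then c n else 0)"
proof -
  have "has_strong_integral torus (\<lambda>t. \<Sum>m\<in>S. character (- n + m) t *\<^sub>C c m) (\<Sum>m\<in>S. (if - n + m = 0 then 1 else 0) *\<^sub>C c m)"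
    by (rule has_strong_integral_sum[OF complete_measure_torus])
      (rule has_strong_integral_complex[OF complete_measure_torus has_bochner_integral_character])
  also have "(\<lambda>t. \<Sum>m\<in>S. character (- n + m) t *\<^sub>C c m) = (\<lambda>t. character (- n) t *\<^sub>C (\<Sum>m\<in>S. character m t *\<^sub>C c m))"
    by (simp only: scaleC.sum_right scaleC_scaleC character_mult)
  also have "(\<Sum>m\<in>S. (if - n + m = 0 then 1 else 0) *\<^sub>C c m) = (\<Sum>m\<in>S. if m = n then c m else 0)"
    by (intro sum.cong) (auto simp: scaleC.zero_left)
  also have "\<dots> = (if n \<in> S then c n else 0)" using S by simp
  finally show ?thesis .
qed

text \<open>The rapidly convergent partial sums \<open>P\<close> converge almost everywhere because their increments
  are absolutely summable in the mean; Fatou's lemma then gives the rate of convergence.\<close>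

lemma almost_everywhere_limit:
  fixes P :: "nat \<Rightarrow> 'a \<Rightarrow> 'x::banach" and \<kappa> :: "nat \<Rightarrow> real"
  assumes M: "prob_space M" "complete_measure M" and r: "r > 1"
    and [measurable]: "\<And>I J. (\<lambda>x. norm (P J x - P I x)) \<in> borel_measurable M"
    and \<kappa>0: "\<And>I. 0 \<le> \<kappa> I" and sm: "summable (\<lambda>I. \<kappa> I powr (1 / r))"
    and cauchy: "\<And>I J. I \<le> J \<Longrightarrow> (\<integral>\<^sup>+x. ennreal (norm (P J x - P I x) powr r) \<partial>M) \<le> ennreal (\<kappa> I)"
  obtains f where "AE x in M. (\<lambda>I. P I x) \<longlonglongrightarrow> f x"
    "\<And>I. (\<lambda>x. norm (f x - P I x)) \<in> borel_measurable M"
    "\<And>I. (\<integral>\<^sup>+x. ennreal (norm (f x - P I x) powr r) \<partial>M) \<le> ennreal (\<kappa> I)"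
    "(\<lambda>I. \<integral>\<^sup>+x. ennreal (norm (f x - P I x)) \<partial>M) \<longlonglongrightarrow> 0"
proof -
  interpret prob_space M by (rule M(1))
  \<comment> \<open>On a probability space the mean is bounded by the r-th power mean; this converts
    all bounds from exponent \<open>r\<close> to exponent 1.\<close>
  have L1: "(\<integral>\<^sup>+x. ennreal (u x) \<partial>M) \<le> ennreal (k powr (1 / r))"
    if "u \<in> borel_measurable M" "\<And>x. 0 \<le> u x" "0 \<le> k" "(\<integral>\<^sup>+x. ennreal (u x powr r) \<partial>M) \<le> ennreal k" for u k
    using nn_integral_power_mean[OF r, of u M "\<lambda>_. 1" 1 k] that by (simp add: emeasure_space_1)
  define f where "f = (\<lambda>x. lim (\<lambda>I. P I x))"
  have "(\<Sum>I. \<integral>\<^sup>+x. ennreal (norm (P (Suc I) x - P I x)) \<partial>M) \<le> (\<Sum>I. ennreal (\<kappa> I powr (1 / r)))"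
    by (intro suminf_le L1 cauchy \<kappa>0) auto
  also have "\<dots> = ennreal (\<Sum>I. \<kappa> I powr (1 / r))"
    by (rule suminf_ennreal_eq) (auto intro: summable_sums[OF sm])
  finally have "(\<Sum>I. \<integral>\<^sup>+x. ennreal (norm (P (Suc I) x - P I x)) \<partial>M) < \<infinity>"
    by (rule le_less_trans) simp
  then have "AE x in M. summable (\<lambda>I. norm (P (Suc I) x - P I x))"
    by (intro AE_summable_of_summable_integrals) auto
  then have lim: "AE x in M. (\<lambda>I. P I x) \<longlonglongrightarrow> f x"
  proof eventually_elim
    case (elim x)
    then have "summable (\<lambda>I. P (Suc I) x - P I x)" by (rule summable_norm_cancel)
    then obtain l where "(\<lambda>n. \<Sum>I<n. P (Suc I) x - P I x) \<longlonglongrightarrow> l" by (auto simp: summable_def sums_def)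
    then have "(\<lambda>n. P n x - P 0 x) \<longlonglongrightarrow> l" unfolding sum_lessThan_telescope[of "\<lambda>n. P n x"] .
    then have "(\<lambda>n. P n x - P 0 x + P 0 x) \<longlonglongrightarrow> l + P 0 x" by (intro tendsto_add tendsto_const)
    then have "convergent (\<lambda>n. P n x)" by (auto simp: convergent_def)
    then show ?case by (simp add: f_def convergent_LIMSEQ_iff)
  qed
  have fm: "(\<lambda>x. norm (f x - P I x)) \<in> borel_measurable M" for I
  proof -
    have "AE x in M. norm (f x - P I x) = lim (\<lambda>J. norm (P J x - P I x))"
      using lim by eventually_elim (intro limI[symmetric] tendsto_norm tendsto_diff tendsto_const)
    from measurable_AE_eq[OF M(2) _ this, of borel] show ?thesis by simp
  qed
  have rate: "(\<integral>\<^sup>+x. ennreal (norm (f x - P I x) powr r) \<partial>M) \<le> ennreal (\<kappa> I)" for I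
  proof -
    have "(\<integral>\<^sup>+x. ennreal (norm (f x - P I x) powr r) \<partial>M) = (\<integral>\<^sup>+x. liminf (\<lambda>J. ennreal (norm (P J x - P I x) powr r)) \<partial>M)"
    proof (rule nn_integral_cong_AE)
      show "AE x in M. ennreal (norm (f x - P I x) powr r) = liminf (\<lambda>J. ennreal (norm (P J x - P I x) powr r))"
        using lim
      proof eventually_elim
        case (elim x)
        have "(\<lambda>J. ennreal (norm (P J x - P I x) powr r)) \<longlonglongrightarrow> ennreal (norm (f x - P I x) powr r)"
          by (intro tendsto_ennrealI tendsto_powr' tendsto_norm tendsto_diff elim tendsto_const) (use r in auto)
        from lim_imp_Liminf[OF _ this] show ?case by simp
      qed
    qed
    also have "\<dots> \<le> liminf (\<lambda>J. \<integral>\<^sup>+x. ennreal (norm (P J x - P I x) powr r) \<partial>M)"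
      by (rule nn_integral_liminf) simp
    \<comment> \<open>The bound holds only for \<open>J\<close> at least \<open>I\<close>, that is
      eventually, which suffices for the limit superior.\<close>
    also have "\<dots> \<le> limsup (\<lambda>J. \<integral>\<^sup>+x. ennreal (norm (P J x - P I x) powr r) \<partial>M)"
      by (rule Liminf_le_Limsup) simp
    also have "\<dots> \<le> ennreal (\<kappa> I)"
      by (intro Limsup_bounded eventually_sequentiallyI[of I] cauchy)
    finally show ?thesis .
  qed
  have "(\<lambda>I. \<integral>\<^sup>+x. ennreal (norm (f x - P I x)) \<partial>M) \<longlonglongrightarrow> 0"
  proof (rule tendsto_sandwich[OF _ _ tendsto_const])
    show "\<forall>\<^sub>F I in sequentially. (\<integral>\<^sup>+x. ennreal (norm (f x - P I x)) \<partial>M) \<le> ennreal (\<kappa> I powr (1 / r))"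
      by (intro always_eventually allI L1 fm \<kappa>0 rate) auto
    have "(\<lambda>I. ennreal (\<kappa> I powr (1 / r))) \<longlonglongrightarrow> ennreal 0"
      by (intro tendsto_ennrealI summable_LIMSEQ_zero sm)
    then show "(\<lambda>I. ennreal (\<kappa> I powr (1 / r))) \<longlonglongrightarrow> 0" by simp
  qed auto
  with lim fm rate show ?thesis by (rule that)
qed

text \<open>Let \<open>P I\<close> be the partial sum over the terms above the level
  \<open>z I\<close>. Its norm is at most \<open>2 * C * (1 + real I) powr \<beta>\<close>
  everywhere, by summing norms, and its distance to the limit \<open>f\<close> has r-th power
  integral at most \<open>\<kappa> I\<close>, by Fourier type. Where \<open>f\<close> exceeds
  \<open>B * (1 + real I) powr \<beta>\<close> the remainder exceeds
  \<open>(1 + real I) powr \<beta>\<close>, so Chebyshev's inequality bounds the measure of this set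
  by \<open>D * (1/2) ^ I\<close>.\<close>

lemma fourier_series_exp_integrable:
  fixes q :: ennreal and b \<rho> K :: real
  assumes p: "1 < p" and K: "0 < K"
    and type: "\<And>(N :: (int^'d::finite) set) (c :: int^'d \<Rightarrow> 'x::complex_banach). finite N \<Longrightarrow>
      (\<integral>\<^sup>+x. ennreal (norm (\<Sum>n\<in>N. character n x *\<^sub>C c n) powr (p / (p - 1))) \<partial>torus)
        \<le> ennreal (K * (\<Sum>n\<in>N. norm (c n) powr p) powr (1 / (p - 1)))"
    and q: "1 \<le> q" and b: "b + enn2real (1 / q) < 0" and \<rho>: "\<rho> > 0"
  obtains a A where "a > 0" "A > 0" "\<And>c :: int^'d \<Rightarrow> 'x. l1_log_norm q (b + 1) c \<le> ennreal \<rho> \<Longrightarrow>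
    \<exists>f :: real^'d \<Rightarrow> 'x. strongly_integrable torus f \<and> (\<forall>n. fourier_coeff f n = c n) \<and>
      (\<integral>\<^sup>+t. ennreal (exp (a * norm (f t) powr (- 1 / (b + enn2real (1 / q))))) \<partial>torus) \<le> ennreal A"
proof -
  define \<beta> where "\<beta> = - (b + enn2real (1 / q))"
  have \<beta>: "\<beta> > 0" using b by (simp add: \<beta>_def)
  have "- 1 / u = 1 / (- u)" for u :: real by simp
  then have \<beta>': "- 1 / (b + enn2real (1 / q)) = 1 / \<beta>" unfolding \<beta>_def .
  have e: "\<beta> = 1 - enn2real (1 / q) - (b + 1)" by (simp add: \<beta>_def)
  define r where "r = p / (p - 1)"
  have r: "r > 1" using p by (simp add: r_def field_simps)
  obtain R where R: "R > 0" "\<And>c :: int^'d \<Rightarrow> 'x. l1_log_norm q (b + 1) c \<le> ennreal \<rho> \<Longrightarrow>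
    (\<forall>i. decr_rearr (count_space UNIV) c (real (2 ^ i - 1)) \<noteq> top) \<and>
    lq_bounded q R (\<lambda>i. (1 + real i) powr (b + 1) * (2 ^ i * enn2real (decr_rearr (count_space UNIV) c (real (2 ^ i - 1)))))"
    by (rule l1_log_norm_dyadic[OF q \<rho>, where 'd='d and 'x='x]) blast
  obtain C where C: "C > 0" "\<And>x (I::nat) A. (\<And>i. 0 \<le> x i) \<Longrightarrow> lq_bounded q R (\<lambda>i. (1 + real i) powr (b + 1) * x i) \<Longrightarrow>
    finite A \<Longrightarrow> (\<beta> < 0 \<Longrightarrow> A \<subseteq> {I..}) \<Longrightarrow> (\<beta> > 0 \<Longrightarrow> A \<subseteq> {..I}) \<Longrightarrow> (\<Sum>i\<in>A. x i) \<le> C * (1 + real I) powr \<beta>"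
    by (rule hoelder_dyadic[OF q e _ R(1)]) (use \<beta> in auto)
  obtain G where G: "G > 0" "\<And>I J::nat. (\<Sum>i=I..<J. 2 powr (- ((p - 1) * real i)) * (1 + real i) powr (\<beta> * p)) \<le> G * (2 powr (- ((p - 1) * real I)) * (1 + real I) powr (\<beta> * p))"
    by (rule geometric_sum_bound[of "p - 1" "\<beta> * p"]) (use p in auto)
  define C3 where "C3 = 2 * C powr p * G"
  have C3: "C3 > 0" using C G by (simp add: C3_def)
  define D where "D = K * C3 powr (1 / (p - 1))"
  have D: "D > 0" using K C3 by (simp add: D_def)
  \<comment> \<open>The type bound for the remainder after level \<open>I\<close>; its power of 1 +
    I is exactly the one that Chebyshev's inequality divides out again.\<close>
  define \<kappa> where "\<kappa> = (\<lambda>I::nat. D * ((1/2) ^ I * ((1 + real I) powr \<beta>) powr r))"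
  have \<kappa>0: "0 \<le> \<kappa> I" for I using D by (simp add: \<kappa>_def)
  have \<kappa>_eq: "K * (C3 * (2 powr (- ((p - 1) * real I)) * (1 + real I) powr (\<beta> * p))) powr (1 / (p - 1)) = \<kappa> I" for I
  proof -
    have "(2 powr (- ((p - 1) * real I))) powr (1 / (p - 1)) = (1/2) ^ I"
    proof -
      have "- ((p - 1) * real I) * (1 / (p - 1)) = - real I" using p by simp
      then have "(2 powr (- ((p - 1) * real I))) powr (1 / (p - 1)) = 2 powr (- real I)" by (simp only: powr_powr)
      then show ?thesis by (simp add: powr_minus powr_realpow power_one_over inverse_eq_divide)
    qed
    moreover have "((1 + real I) powr (\<beta> * p)) powr (1 / (p - 1)) = ((1 + real I) powr \<beta>) powr r"
      by (simp add: powr_powr r_def)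
    ultimately show ?thesis using C3 by (simp add: \<kappa>_def D_def powr_mult)
  qed
  \<comment> \<open>The factor 2^(-I/r) beats any power of 1 + I, so the increments of the partial
    sums are summable in the mean.\<close>
  have sm: "summable (\<lambda>I. \<kappa> I powr (1 / r))"
  proof -
    have "\<kappa> I powr (1 / r) = D powr (1 / r) * (2 powr (- (1 / r * real I)) * (1 + real I) powr \<beta>)" for I
    proof -
      have "((1/2) ^ I) = (2::real) powr (- real I)"
        by (simp add: powr_minus powr_realpow power_one_over inverse_eq_divide)
      then have "((1/2) ^ I) powr (1 / r) = (2::real) powr (- (1 / r * real I))" by (simp add: powr_powr)
      then show ?thesis using D r by (simp add: \<kappa>_def powr_mult powr_powr)
    qed
    then show ?thesis using summable_mult[OF summable_geometric_powr[of "1 / r" \<beta>]] r by simp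
  qed
  \<comment> \<open>\<open>2 * C\<close> for the partial sum and 1 for the remainder.\<close>
  define B where "B = 2 * C + 1"
  have B: "B > 0" using C by (simp add: B_def)
  have main: "\<exists>f :: real^'d \<Rightarrow> 'x. strongly_integrable torus f \<and> (\<forall>n. fourier_coeff f n = c n) \<and>
      (\<integral>\<^sup>+t. ennreal (exp (ln (3/2) * B powr (- 1 / \<beta>) * norm (f t) powr (1 / \<beta>))) \<partial>torus) \<le> ennreal (3/2 + 9 * D)"
    if c: "l1_log_norm q (b + 1) c \<le> ennreal \<rho>" for c :: "int^'d \<Rightarrow> 'x"
  proof -
    define z where "z = (\<lambda>i. enn2real (decr_rearr (count_space UNIV) c (real (2 ^ i - 1))))"
    have dr: "decr_rearr (count_space UNIV) c (real (2 ^ i - 1)) \<noteq> top" for i using R(2)[OF c] by blast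
    have lq: "lq_bounded q R (\<lambda>i. (1 + real i) powr (b + 1) * (2 ^ i * z i))"
      using R(2)[OF c] unfolding z_def by blast
    have z0: "0 \<le> z i" for i by (simp add: z_def)
    have mono: "z j \<le> z i" if "i \<le> j" for i j
      unfolding z_def
    proof (rule enn2real_mono)
      have "(2::nat) ^ i \<le> 2 ^ j" using that by (intro power_increasing) auto
      then have "(2::nat) ^ i - 1 \<le> 2 ^ j - 1" by (rule diff_le_mono)
      then show "decr_rearr (count_space UNIV) c (real (2 ^ j - 1)) \<le> decr_rearr (count_space UNIV) c (real (2 ^ i - 1))"
        by (intro decr_rearr_antimono of_nat_mono)
      show "decr_rearr (count_space UNIV) c (real (2 ^ i - 1)) < top" using dr[of i] by (simp add: less_top)
    qed
    have distr: "emeasure (count_space UNIV) {n. z i < norm (c n)} \<le> ennreal (real (2 ^ i - 1))" for i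
      using decr_rearr_finite_distribution[OF _ dr[of i]] unfolding z_def by simp
    have head: "(\<Sum>i\<in>A. 2 ^ i * z i) \<le> C * (1 + real I) powr \<beta>" if "finite A" "A \<subseteq> {..I}" for I A
      by (rule C(2)[OF _ lq]) (use z0 that \<beta> in auto)
    define S where "S = (\<lambda>I. {n. z I < norm (c n)})"
    have Sfin: "finite (S I)" for I
      unfolding S_def
      by (rule sequence_truncation(1)[where z=z and p=p and \<beta>=\<beta> and G=G and C=C]; (erule (1) head | rule z0 distr C(1) \<beta> p G(2) | erule mono))
    have Ssum: "(\<Sum>n\<in>S I. norm (c n)) \<le> 2 * C * (1 + real I) powr \<beta>" for I
      unfolding S_def
      by (rule sequence_truncation(2)[where z=z and p=p and \<beta>=\<beta> and G=G and C=C]; (erule (1) head | rule z0 distr C(1) \<beta> p G(2) | erule mono))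
    have Sdiff: "(\<Sum>n\<in>S J - S I. norm (c n) powr p) \<le> C3 * (2 powr (- ((p - 1) * real I)) * (1 + real I) powr (\<beta> * p))" if "I \<le> J" for I J
      unfolding S_def C3_def
      by (rule sequence_truncation(3)[where z=z and p=p and \<beta>=\<beta> and G=G and C=C]; (erule (1) head | rule z0 distr C(1) \<beta> p G(2) that | erule mono))
    have Sev: "\<forall>\<^sub>F I in sequentially. n \<in> S I" if "c n \<noteq> 0" for n
      unfolding S_def
      by (rule sequence_truncation(4)[where z=z and p=p and \<beta>=\<beta> and G=G and C=C]; (erule (1) head | rule z0 distr C(1) \<beta> p G(2) that | erule mono))
    have Smono: "S I \<subseteq> S J" if "I \<le> J" for I J using mono[OF that] by (auto simp: S_def)
    define P where "P = (\<lambda>I (t::real^'d). \<Sum>n\<in>S I. character n t *\<^sub>C c n)"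
    have Pcont: "continuous_on UNIV (P I)" for I
      unfolding P_def by (intro continuous_intros scaleC.continuous_on)
    have Pm: "(\<lambda>t. norm (P J t - P I t)) \<in> borel_measurable torus" for I J
      by (intro borel_measurable_torus_continuous continuous_intros Pcont)
    have Pint: "has_strong_integral torus (\<lambda>t. character (- n) t *\<^sub>C P I t) (if n \<in> S I then c n else 0)" for n I
      unfolding P_def by (rule trig_poly_strong_integral[OF Sfin])
    have Pnorm: "norm (P I t) \<le> 2 * C * (1 + real I) powr \<beta>" for I t
    proof -
      have "norm (P I t) \<le> (\<Sum>n\<in>S I. norm (c n))"
        unfolding P_def by (rule order_trans[OF norm_sum]) (simp add: norm_scaleC)
      then show ?thesis using Ssum by (rule order_trans)
    qed
    have cauchy: "(\<integral>\<^sup>+t. ennreal (norm (P J t - P I t) powr r) \<partial>torus) \<le> ennreal (\<kappa> I)" if "I \<le> J" for I J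
    proof -
      have "P J t - P I t = (\<Sum>n\<in>S J - S I. character n t *\<^sub>C c n)" for t
        unfolding P_def by (rule sum_diff[OF Sfin Smono[OF that], symmetric])
      then have "(\<integral>\<^sup>+t. ennreal (norm (P J t - P I t) powr r) \<partial>torus) \<le> ennreal (K * (\<Sum>n\<in>S J - S I. norm (c n) powr p) powr (1 / (p - 1)))"
        using type[of "S J - S I" c] Sfin by (simp add: r_def)
      also have "\<dots> \<le> ennreal (K * (C3 * (2 powr (- ((p - 1) * real I)) * (1 + real I) powr (\<beta> * p))) powr (1 / (p - 1)))"
        using K p by (intro ennreal_leI mult_left_mono powr_mono2 Sdiff that sum_nonneg) auto
      also have "\<dots> = ennreal (\<kappa> I)" unfolding \<kappa>_eq ..
      finally show ?thesis .
    qed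
    obtain f where f: "AE t in torus. (\<lambda>I. P I t) \<longlonglongrightarrow> f t"
      "\<And>I. (\<lambda>t. norm (f t - P I t)) \<in> borel_measurable torus"
      "\<And>I. (\<integral>\<^sup>+t. ennreal (norm (f t - P I t) powr r) \<partial>torus) \<le> ennreal (\<kappa> I)"
      "(\<lambda>I. \<integral>\<^sup>+t. ennreal (norm (f t - P I t)) \<partial>torus) \<longlonglongrightarrow> 0"
    proof (rule almost_everywhere_limit[OF prob_space_torus complete_measure_torus r Pm \<kappa>0 sm])
      show "(\<integral>\<^sup>+t. ennreal (norm (P J t - P I t) powr r) \<partial>torus) \<le> ennreal (\<kappa> I)" if "I \<le> J" for I J
        using that by (rule cauchy)
    qed (rule that)
    have coeff: "has_strong_integral torus (\<lambda>t. character (- n) t *\<^sub>C f t) (c n)" for n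
    proof -
      \<comment> \<open>The coefficient of the partial sums at \<open>n\<close> is constantly
        \<open>c n\<close> from some level on, so the integral of the limit must be
        \<open>c n\<close>.\<close>
      have "\<exists>w. has_strong_integral torus (\<lambda>t. character (- n) t *\<^sub>C f t) w \<and> (\<lambda>I. if n \<in> S I then c n else 0) \<longlonglongrightarrow> w"
      proof (rule has_strong_integral_limit[OF complete_measure_torus Pint])
        show "AE t in torus. (\<lambda>I. character (- n) t *\<^sub>C P I t) \<longlonglongrightarrow> character (- n) t *\<^sub>C f t"
          using f(1) by eventually_elim (intro scaleC.tendsto tendsto_const)
        show "(\<lambda>I. \<integral>\<^sup>+t. ennreal (norm (character (- n) t *\<^sub>C f t - character (- n) t *\<^sub>C P I t)) \<partial>torus) \<longlonglongrightarrow> 0"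
          using f(4) by (simp add: scaleC.diff_right[symmetric] norm_scaleC)
      qed
      then obtain w where w: "has_strong_integral torus (\<lambda>t. character (- n) t *\<^sub>C f t) w"
        "(\<lambda>I. if n \<in> S I then c n else 0) \<longlonglongrightarrow> w" by blast
      have "(\<lambda>I. if n \<in> S I then c n else 0) \<longlonglongrightarrow> c n"
      proof (cases "c n = 0")
        case False
        have "\<forall>\<^sub>F I in sequentially. c n = (if n \<in> S I then c n else 0)"
          using Sev[OF False] by eventually_elim simp
        then show ?thesis by (rule Lim_transform_eventually[OF tendsto_const])
      qed (simp cong: if_cong)
      then have "w = c n" using w(2) LIMSEQ_unique by blast
      then show ?thesis using w(1) by simp
    qed
    \<comment> \<open>The trivial character is 1, so the coefficient at 0 already contains the
      integrability of \<open>f\<close>.\<close>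
    have int: "strongly_integrable torus f"
      using coeff[of 0] by (auto simp: strongly_integrable_def)
    have fsm: "strongly_measurable torus f"
      using int by (auto simp: strongly_integrable_def has_strong_integral_def)
    have fm [measurable]: "(\<lambda>t. norm (f t)) \<in> borel_measurable torus"
      by (rule strongly_measurable_norm[OF complete_measure_torus fsm])
    have tail: "emeasure torus {t \<in> space torus. B * (1 + real I) powr \<beta> < norm (f t)} \<le> ennreal (D * (1/2) ^ I)" for I
    proof -
      define L where "L = ((1 + real I) powr \<beta>) powr r"
      have L: "L > 0" by (simp add: L_def)
      have [measurable]: "(\<lambda>t. norm (f t - P I t)) \<in> borel_measurable torus" by (rule f(2))
      have "emeasure torus {t \<in> space torus. B * (1 + real I) powr \<beta> < norm (f t)}
        = (\<integral>\<^sup>+t. indicator {t \<in> space torus. B * (1 + real I) powr \<beta> < norm (f t)} t \<partial>torus)"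
        by simp
      also have "\<dots> \<le> (\<integral>\<^sup>+t. ennreal (1 / L) * ennreal (norm (f t - P I t) powr r) \<partial>torus)"
      proof (rule nn_integral_mono)
        fix t
        show "indicator {t \<in> space torus. B * (1 + real I) powr \<beta> < norm (f t)} t \<le> ennreal (1 / L) * ennreal (norm (f t - P I t) powr r)"
        proof (cases "B * (1 + real I) powr \<beta> < norm (f t)")
          case True
          then have "2 * C * (1 + real I) powr \<beta> + (1 + real I) powr \<beta> < norm (f t)" by (simp add: B_def distrib_right)
          moreover have "norm (f t) \<le> norm (f t - P I t) + norm (P I t)" using norm_triangle_ineq[of "f t - P I t" "P I t"] by simp
          ultimately have "(1 + real I) powr \<beta> \<le> norm (f t - P I t)" using Pnorm[of I t] by linarith
          then have "L \<le> norm (f t - P I t) powr r" unfolding L_def using r by (intro powr_mono2) auto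
          then have "1 \<le> 1 / L * norm (f t - P I t) powr r" using L by (simp add: field_simps)
          then have "ennreal 1 \<le> ennreal (1 / L * norm (f t - P I t) powr r)" by (rule ennreal_leI)
          also have "\<dots> = ennreal (1 / L) * ennreal (norm (f t - P I t) powr r)" using L by (intro ennreal_mult) auto
          finally show ?thesis by (auto simp: indicator_def)
        qed (simp add: indicator_def)
      qed
      also have "\<dots> = ennreal (1 / L) * (\<integral>\<^sup>+t. ennreal (norm (f t - P I t) powr r) \<partial>torus)"
        by (rule nn_integral_cmult) simp
      also have "\<dots> \<le> ennreal (1 / L) * ennreal (\<kappa> I)" by (intro mult_left_mono f(3)) simp
      also have "\<dots> = ennreal (1 / L * \<kappa> I)" using L \<kappa>0 by (intro ennreal_mult[symmetric]) auto
      also have "1 / L * \<kappa> I = D * (1/2) ^ I" using L by (simp add: \<kappa>_def L_def)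
      finally show ?thesis .
    qed
    have "(\<integral>\<^sup>+t. ennreal (exp (ln (3/2) * B powr (- 1 / \<beta>) * norm (f t) powr (1 / \<beta>))) \<partial>torus) \<le> ennreal (3/2 + 9 * D)"
      by (rule exp_integral_bound[OF prob_space_torus fm norm_ge_zero B \<beta> less_imp_le[OF D] tail])
    moreover have "fourier_coeff f n = c n" for n
      unfolding fourier_coeff_character by (rule strong_integral_eqI[OF complete_measure_torus coeff])
    ultimately show ?thesis using int by blast
  qed
  show ?thesis
  proof (rule that[of "ln (3/2) * B powr (- 1 / \<beta>)" "3/2 + 9 * D"])
    show "ln (3/2) * B powr (- 1 / \<beta>) > 0" using B by simp
    show "3/2 + 9 * D > 0" using D by simp
  next
    fix c :: "int^'d \<Rightarrow> 'x" assume "l1_log_norm q (b + 1) c \<le> ennreal \<rho>"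
    from main[OF this]
    show "\<exists>f :: real^'d \<Rightarrow> 'x. strongly_integrable torus f \<and> (\<forall>n. fourier_coeff f n = c n) \<and>
      (\<integral>\<^sup>+t. ennreal (exp (ln (3/2) * B powr (- 1 / \<beta>) * norm (f t) powr (- 1 / (b + enn2real (1 / q))))) \<partial>torus) \<le> ennreal (3/2 + 9 * D)"
      unfolding \<beta>' .
  qed
qed

theorem theorem7p3:
  assumes nonzero: "\<exists>x::'x::complex_banach. x \<noteq> 0"
    and type: "nontrivial_fourier_type TYPE('d::finite) TYPE('x)"
  shows
    "(\<forall>(q::ennreal) (b::real) (\<rho>::real). 1 \<le> q \<and> b + enn2real (1 / q) > 0 \<and> \<rho> > 0 \<longrightarrow>
       (\<exists>a A::real. a > 0 \<and> A > 0 \<and>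
         (\<forall>f :: real^'d \<Rightarrow> 'x.
            strongly_measurable torus f \<and> L1_log_norm q (b + 1) f \<le> ennreal \<rho> \<longrightarrow>
            (\<integral>\<^sup>+n. (if fourier_coeff f n = 0 then 0
                   else ennreal (exp (- a * norm (fourier_coeff f n) powr (- 1 / (b + enn2real (1 / q))))))
               \<partial>count_space UNIV) \<le> ennreal A)))
     \<and>
     (\<forall>(q::ennreal) (b::real) (\<rho>::real). 1 \<le> q \<and> b + enn2real (1 / q) < 0 \<and> \<rho> > 0 \<longrightarrow>
       (\<exists>a A::real. a > 0 \<and> A > 0 \<and>
         (\<forall>c :: int^'d \<Rightarrow> 'x. l1_log_norm q (b + 1) c \<le> ennreal \<rho> \<longrightarrow>
            (\<exists>f :: real^'d \<Rightarrow> 'x. strongly_integrable torus f \<and> (\<forall>n. fourier_coeff f n = c n) \<and>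
               (\<integral>\<^sup>+t. ennreal (exp (a * norm (f t) powr (- 1 / (b + enn2real (1 / q))))) \<partial>torus)
                 \<le> ennreal A))))"
proof -
  obtain p D :: real where p: "1 < p" and D: "0 < D"
    and schwartz: "\<And>(f :: real^'d \<Rightarrow> 'x) y. schwartz f \<Longrightarrow> 0 \<le> y \<Longrightarrow> (\<integral>\<^sup>+x. ennreal (norm (f x) powr p) \<partial>lebesgue) \<le> ennreal y \<Longrightarrow>
      (\<integral>\<^sup>+x. ennreal (norm (fourier_transform f x) powr (p / (p - 1))) \<partial>lebesgue)
        \<le> ennreal (D * y powr (1 / (p - 1)))"
    by (rule fourier_type_schwartz[OF type]) blast
  show ?thesis
  proof (intro conjI allI impI; elim conjE)
    fix q :: ennreal and b \<rho> :: real
    assume q: "1 \<le> q" and b: "b + enn2real (1 / q) > 0" and \<rho>: "\<rho> > 0"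
    obtain K where K: "0 < K" "\<And>(f :: real^'d \<Rightarrow> 'x) b y N. strongly_measurable torus f \<Longrightarrow> (\<And>x. norm (f x) \<le> b) \<Longrightarrow>
      0 \<le> y \<Longrightarrow> (\<integral>\<^sup>+x. ennreal (norm (f x) powr p) \<partial>torus) \<le> ennreal y \<Longrightarrow> finite N \<Longrightarrow>
      (\<Sum>n\<in>N. norm (fourier_coeff f n) powr (p / (p - 1))) \<le> K * y powr (1 / (p - 1))"
    proof (rule fourier_type_torus[OF p D schwartz])
      fix K :: real
      assume K: "0 < K" "\<And>(f :: real^'d \<Rightarrow> 'x) b y N. strongly_measurable torus f \<Longrightarrow> (\<And>x. norm (f x) \<le> b) \<Longrightarrow>
        0 \<le> y \<Longrightarrow> (\<integral>\<^sup>+x. ennreal (norm (f x) powr p) \<partial>torus) \<le> ennreal y \<Longrightarrow> finite N \<Longrightarrow>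
        (\<Sum>n\<in>N. norm (fourier_coeff f n) powr (p / (p - 1))) \<le> K * y powr (1 / (p - 1))"
      show thesis by (rule that[OF K(1)]) (rule K(2))
    qed
    obtain a where a: "a > 0" "\<And>f :: real^'d \<Rightarrow> 'x. strongly_measurable torus f \<Longrightarrow> L1_log_norm q (b + 1) f \<le> ennreal \<rho> \<Longrightarrow>
      (\<integral>\<^sup>+n. (if fourier_coeff f n = 0 then 0
                   else ennreal (exp (- a * norm (fourier_coeff f n) powr (- 1 / (b + enn2real (1 / q))))))
               \<partial>count_space UNIV) \<le> ennreal 2"
    proof (rule fourier_coeff_exp_sum[OF p K q b \<rho>])
      fix a :: real
      assume a: "a > 0" "\<And>f :: real^'d \<Rightarrow> 'x. strongly_measurable torus f \<Longrightarrow> L1_log_norm q (b + 1) f \<le> ennreal \<rho> \<Longrightarrow>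
        (\<integral>\<^sup>+n. (if fourier_coeff f n = 0 then 0
                   else ennreal (exp (- a * norm (fourier_coeff f n) powr (- 1 / (b + enn2real (1 / q))))))
               \<partial>count_space UNIV) \<le> ennreal 2"
      show thesis by (rule that[OF a(1)]) (rule a(2))
    qed
    \<comment> \<open>The second constant is 2 for all parameters; the dependence on the data sits
      in \<open>a\<close>.\<close>
    show "\<exists>a A::real. a > 0 \<and> A > 0 \<and>
         (\<forall>f :: real^'d \<Rightarrow> 'x.
            strongly_measurable torus f \<and> L1_log_norm q (b + 1) f \<le> ennreal \<rho> \<longrightarrow>
            (\<integral>\<^sup>+n. (if fourier_coeff f n = 0 then 0
                   else ennreal (exp (- a * norm (fourier_coeff f n) powr (- 1 / (b + enn2real (1 / q))))))
               \<partial>count_space UNIV) \<le> ennreal A)"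
      by (intro exI[of _ a] exI[of _ 2] conjI allI impI a; (elim conjE)?; (assumption | simp))
  next
    fix q :: ennreal and b \<rho> :: real
    assume q: "1 \<le> q" and b: "b + enn2real (1 / q) < 0" and \<rho>: "\<rho> > 0"
    obtain K where K: "0 < K" "\<And>(N :: (int^'d) set) (c :: int^'d \<Rightarrow> 'x). finite N \<Longrightarrow>
      (\<integral>\<^sup>+x. ennreal (norm (\<Sum>n\<in>N. character n x *\<^sub>C c n) powr (p / (p - 1))) \<partial>torus)
        \<le> ennreal (K * (\<Sum>n\<in>N. norm (c n) powr p) powr (1 / (p - 1)))"
    proof (rule fourier_type_sequence[OF p D schwartz])
      fix K :: real
      assume K: "0 < K" "\<And>(N :: (int^'d) set) (c :: int^'d \<Rightarrow> 'x). finite N \<Longrightarrow>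
        (\<integral>\<^sup>+x. ennreal (norm (\<Sum>n\<in>N. character n x *\<^sub>C c n) powr (p / (p - 1))) \<partial>torus)
          \<le> ennreal (K * (\<Sum>n\<in>N. norm (c n) powr p) powr (1 / (p - 1)))"
      show thesis by (rule that[OF K(1)]) (rule K(2))
    qed
    obtain a A where a: "a > 0" "A > 0" "\<And>c :: int^'d \<Rightarrow> 'x. l1_log_norm q (b + 1) c \<le> ennreal \<rho> \<Longrightarrow>
      \<exists>f :: real^'d \<Rightarrow> 'x. strongly_integrable torus f \<and> (\<forall>n. fourier_coeff f n = c n) \<and>
        (\<integral>\<^sup>+t. ennreal (exp (a * norm (f t) powr (- 1 / (b + enn2real (1 / q))))) \<partial>torus) \<le> ennreal A"
    proof (rule fourier_series_exp_integrable[OF p K q b \<rho>])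
      fix a A :: real
      assume a: "a > 0" "A > 0" "\<And>c :: int^'d \<Rightarrow> 'x. l1_log_norm q (b + 1) c \<le> ennreal \<rho> \<Longrightarrow>
        \<exists>f :: real^'d \<Rightarrow> 'x. strongly_integrable torus f \<and> (\<forall>n. fourier_coeff f n = c n) \<and>
          (\<integral>\<^sup>+t. ennreal (exp (a * norm (f t) powr (- 1 / (b + enn2real (1 / q))))) \<partial>torus) \<le> ennreal A"
      show thesis by (rule that[OF a(1,2)]) (rule a(3))
    qed
    show "\<exists>a A::real. a > 0 \<and> A > 0 \<and>
         (\<forall>c :: int^'d \<Rightarrow> 'x. l1_log_norm q (b + 1) c \<le> ennreal \<rho> \<longrightarrow>
            (\<exists>f :: real^'d \<Rightarrow> 'x. strongly_integrable torus f \<and> (\<forall>n. fourier_coeff f n = c n) \<and>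
               (\<integral>\<^sup>+t. ennreal (exp (a * norm (f t) powr (- 1 / (b + enn2real (1 / q))))) \<partial>torus)
                 \<le> ennreal A))"
      by (intro exI[of _ a] exI[of _ A] conjI allI impI a(1,2)) (rule a(3))
  qed
qed

end
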